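(* Let $(X,\tau)$ be a definable topological space with definable basis $\mathcal{B}$. (1) For every $x\in X$ there exists a definable family $\{A_{(s,t)}:s,t>0\}\subseteq\mathcal{B}$ that is a basis of neighborhoods of $x$ and such that for every neighborhood $A$ of $x$ there exist $s_A,t_A>0$ with $A_{(s,t)}\subseteq A$ whenever $s\le s_A$ and $t\ge t_A$. (2) If $\mathcal{R}$ expands an ordered field, then for every $x\in X$ there exists a definable family $\{A_t:t>0\}\subseteq\mathcal{B}$ that is a basis of neighborhoods of $x$ and such that for every neighborhood $A$ of $x$ there exists $t_A>0$ with $A_t\subseteq A$ whenever $0<t\le t_A$.
   Context: Standing assumptions: $\mathcal{R}=(R,0,+,<,\ldots)$ is an o-minimal expansion of an ordered group, and "definable" means definable in $\mathcal{R}$ with parameters from $R$; $s,t$ range over $R$. A definable topological space is a topological space $(X,\tau)$ with $X\subseteq R^n$ together with a definable family $\mathcal{B}$ of subsets of $X$ that is a basis of $\tau$. "$\mathcal{R}$ expands an ordered field" means there are definable $\oplus,\otimes:R^2\to R$ such that $(R,<,\oplus,\otimes)$ is a real closed ordered field. *)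

theory Defs
  imports "HOL-Analysis.Abstract_Topology" "HOL-Algebra.Polynomials"
begin

text \<open>
  The universe \<open>R\<close> of the structure is the whole type \<open>'a\<close>, and \<open>R\<^sup>n\<close> is the set of lists
  of length \<open>n\<close>. The symbols \<open>0\<close>, \<open>+\<close>, \<open><\<close> of the ordered group are built into the syntax;
  the record collects the further symbols of the expansion. The components
  \<open>fun_int\<close> and \<open>rel_int\<close> are only ever consulted on lists whose length is the arity.
\<close>

record ('f, 'r, 'a) expansion =
  fun_arity :: "'f \<Rightarrow> nat"
  rel_arity :: "'r \<Rightarrow> nat"
  fun_int :: "'f \<Rightarrow> 'a list \<Rightarrow> 'a"
  rel_int :: "'r \<Rightarrow> 'a list \<Rightarrow> bool"

datatype 'f tm =
    Var nat
  | Zero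
  | Plus "'f tm" "'f tm"
  | Fn 'f "'f tm list"

datatype ('f, 'r) fm =
    Equal "'f tm" "'f tm"
  | Less "'f tm" "'f tm"
  | Rel 'r "'f tm list"
  | Neg "('f, 'r) fm"
  | Conj "('f, 'r) fm" "('f, 'r) fm"
  | Exists nat "('f, 'r) fm"

primrec wf_tm :: "('f, 'r, 'a) expansion \<Rightarrow> 'f tm \<Rightarrow> bool" where
  "wf_tm M (Var i) \<longleftrightarrow> True"
| "wf_tm M Zero \<longleftrightarrow> True"
| "wf_tm M (Plus t u) \<longleftrightarrow> wf_tm M t \<and> wf_tm M u"
| "wf_tm M (Fn f ts) \<longleftrightarrow> length ts = fun_arity M f \<and> list_all (wf_tm M) ts"

primrec wf_fm :: "('f, 'r, 'a) expansion \<Rightarrow> ('f, 'r) fm \<Rightarrow> bool" where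
  "wf_fm M (Equal t u) \<longleftrightarrow> wf_tm M t \<and> wf_tm M u"
| "wf_fm M (Less t u) \<longleftrightarrow> wf_tm M t \<and> wf_tm M u"
| "wf_fm M (Rel r ts) \<longleftrightarrow> length ts = rel_arity M r \<and> list_all (wf_tm M) ts"
| "wf_fm M (Neg \<phi>) \<longleftrightarrow> wf_fm M \<phi>"
| "wf_fm M (Conj \<phi> \<psi>) \<longleftrightarrow> wf_fm M \<phi> \<and> wf_fm M \<psi>"
| "wf_fm M (Exists i \<phi>) \<longleftrightarrow> wf_fm M \<phi>"

primrec tm_val :: "('f, 'r, 'a::{group_add, linorder}) expansion \<Rightarrow> (nat \<Rightarrow> 'a) \<Rightarrow> 'f tm \<Rightarrow> 'a" where
  "tm_val M e (Var i) = e i"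
| "tm_val M e Zero = 0"
| "tm_val M e (Plus t u) = tm_val M e t + tm_val M e u"
| "tm_val M e (Fn f ts) = fun_int M f (map (tm_val M e) ts)"

primrec sat :: "('f, 'r, 'a::{group_add, linorder}) expansion \<Rightarrow> (nat \<Rightarrow> 'a) \<Rightarrow> ('f, 'r) fm \<Rightarrow> bool" where
  "sat M e (Equal t u) \<longleftrightarrow> tm_val M e t = tm_val M e u"
| "sat M e (Less t u) \<longleftrightarrow> tm_val M e t < tm_val M e u"
| "sat M e (Rel r ts) \<longleftrightarrow> rel_int M r (map (tm_val M e) ts)"
| "sat M e (Neg \<phi>) \<longleftrightarrow> \<not> sat M e \<phi>"
| "sat M e (Conj \<phi> \<psi>) \<longleftrightarrow> sat M e \<phi> \<and> sat M e \<psi>"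
| "sat M e (Exists i \<phi>) \<longleftrightarrow> (\<exists>a. sat M (e(i := a)) \<phi>)"

text \<open>
  Definability in \<open>R\<^sup>n\<close> with parameters: the variables with index below \<open>n\<close> range over the
  coordinates, and the finitely many remaining free variables of \<open>\<phi>\<close> are
  replaced by the parameters given by \<open>e\<close>.
\<close>

definition definable ::
    "('f, 'r, 'a::{group_add, linorder}) expansion \<Rightarrow> nat \<Rightarrow> 'a list set \<Rightarrow> bool" where
  "definable M n A \<longleftrightarrow>
    (\<exists>(\<phi> :: ('f, 'r) fm) e. wf_fm M \<phi> \<and>
      A = {a. length a = n \<and> sat M (\<lambda>i. if i < n then a ! i else e i) \<phi>})"

definition point_or_open_interval :: "'a::linorder set \<Rightarrow> bool" where
  "point_or_open_interval J \<longleftrightarrow>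
    (\<exists>a. J = {a}) \<or> (\<exists>a b. J = {a<..<b}) \<or> (\<exists>a. J = {a<..}) \<or> (\<exists>b. J = {..<b}) \<or> J = UNIV"

text \<open>
  The group is not assumed to be commutative, hence order-invariance is required on both sides.
  As usual for o-minimality, the underlying order is dense without endpoints
  (this is in the sort of \<open>'a\<close>, and for an o-minimal ordered group it only excludes the
  trivial group).
\<close>

definition ominimal_ordered_group ::
    "('f, 'r, 'a::{group_add, unbounded_dense_linorder}) expansion \<Rightarrow> bool" where
  "ominimal_ordered_group M \<longleftrightarrow>
    (\<forall>(a::'a) b c. a < b \<longrightarrow> c + a < c + b \<and> a + c < b + c) \<and>
    (\<forall>S :: 'a set. definable M 1 {[x] |x. x \<in> S} \<longrightarrow>
      (\<exists>\<I>. finite \<I> \<and> (\<forall>J\<in>\<I>. point_or_open_interval J) \<and> S = \<Union>\<I>))"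

text \<open>
  A definable family \<open>{A u : u \<in> \<Omega>}\<close> of subsets of \<open>R\<^sup>n\<close> with index set \<open>\<Omega> \<subseteq> R\<^sup>m\<close>.
\<close>

definition definable_family ::
    "('f, 'r, 'a::{group_add, linorder}) expansion \<Rightarrow> nat \<Rightarrow> nat \<Rightarrow>
      'a list set \<Rightarrow> ('a list \<Rightarrow> 'a list set) \<Rightarrow> bool" where
  "definable_family M m n \<Omega> A \<longleftrightarrow>
    definable M m \<Omega> \<and>
    (\<forall>u\<in>\<Omega>. \<forall>x\<in>A u. length x = n) \<and>
    definable M (m + n) {u @ x |u x. u \<in> \<Omega> \<and> x \<in> A u}"

definition definable_topological_space ::
    "('f, 'r, 'a::{group_add, linorder}) expansion \<Rightarrow> nat \<Rightarrow>
      'a list topology \<Rightarrow> 'a list set set \<Rightarrow> bool" where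
  "definable_topological_space M n T \<B> \<longleftrightarrow>
    (\<forall>x\<in>topspace T. length x = n) \<and>
    (\<exists>m \<Omega> B. definable_family M m n \<Omega> B \<and> \<B> = B ` \<Omega>) \<and>
    openin T = arbitrary union_of (\<lambda>U. U \<in> \<B>)"

definition nhd :: "'b topology \<Rightarrow> 'b \<Rightarrow> 'b set \<Rightarrow> bool" where
  "nhd T x A \<longleftrightarrow> A \<subseteq> topspace T \<and> (\<exists>U. openin T U \<and> x \<in> U \<and> U \<subseteq> A)"

definition nhd_basis :: "'b topology \<Rightarrow> 'b \<Rightarrow> 'b set set \<Rightarrow> bool" where
  "nhd_basis T x \<N> \<longleftrightarrow>
    (\<forall>N\<in>\<N>. nhd T x N) \<and> (\<forall>A. nhd T x A \<longrightarrow> (\<exists>N\<in>\<N>. N \<subseteq> A))"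

text \<open>
  \<open>R\<close> as a HOL-Algebra ring. The zero of this field need not be the zero of the group \<open>R\<close>.
\<close>

definition field_on ::
    "('a \<Rightarrow> 'a \<Rightarrow> 'a) \<Rightarrow> ('a \<Rightarrow> 'a \<Rightarrow> 'a) \<Rightarrow> 'a \<Rightarrow> 'a \<Rightarrow> 'a ring" where
  "field_on ad mu z e = \<lparr>carrier = UNIV, mult = mu, one = e, zero = z, add = ad\<rparr>"

text \<open>
  Real closed ordered field: positive elements are squares and every polynomial of odd degree has
  a root. A univariate polynomial is the list of its coefficients, leading coefficient first.
\<close>

definition real_closed_ordered_field :: "('a::linorder) ring \<Rightarrow> bool" where
  "real_closed_ordered_field F \<longleftrightarrow>
    carrier F = UNIV \<and> field F \<and>
    (\<forall>x y w. x < y \<longrightarrow> x \<oplus>\<^bsub>F\<^esub> w < y \<oplus>\<^bsub>F\<^esub> w) \<and>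
    (\<forall>x y. \<zero>\<^bsub>F\<^esub> < x \<longrightarrow> \<zero>\<^bsub>F\<^esub> < y \<longrightarrow> \<zero>\<^bsub>F\<^esub> < x \<otimes>\<^bsub>F\<^esub> y) \<and>
    (\<forall>x. \<zero>\<^bsub>F\<^esub> < x \<longrightarrow> (\<exists>y. y \<otimes>\<^bsub>F\<^esub> y = x)) \<and>
    (\<forall>p \<in> carrier (univ_poly F (carrier F)). odd (degree p) \<longrightarrow> (\<exists>x. ring.eval F p x = \<zero>\<^bsub>F\<^esub>))"

definition expands_ordered_field ::
    "('f, 'r, 'a::{group_add, linorder}) expansion \<Rightarrow> bool" where
  "expands_ordered_field M \<longleftrightarrow>
    (\<exists>(ad :: 'a \<Rightarrow> 'a \<Rightarrow> 'a) mu z e.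
      definable M 3 {[x, y, ad x y] |x y. True} \<and>
      definable M 3 {[x, y, mu x y] |x y. True} \<and>
      real_closed_ordered_field (field_on ad mu z e))"

end

theory Submission
  imports Defs
begin

text \<open>
  Fix \<open>x\<close>. The indices \<open>u\<close> with \<open>x \<in> B u\<close>, preordered by inclusion of the sets \<open>B u\<close>, form a
  definable directed set \<open>\<Omega>\<close>. It suffices to write \<open>\<Omega>\<close> as an increasing definable union of sets
  \<open>D(s,t)\<close>, growing as \<open>s\<close> decreases and \<open>t\<close> increases, each of which has a lower bound in \<open>\<Omega>\<close>:
  a definable choice of lower bounds is then the required family.

  The sets \<open>D(s,t)\<close> are built one coordinate at a time. Given a definable family of bounded sets
  \<open>D\<^sub>x\<close>, call \<open>z\<close> bad if no neighbourhood of \<open>z\<close> has a bounded union of the \<open>D\<^sub>x\<close>. If there are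
  only finitely many bad points, the set of \<open>x\<close> with \<open>-t \<le> x \<le> t\<close> at distance at least \<open>s\<close> from
  them has a bounded union by definable compactness, and the bad points are added by directedness.

  That the bad points are finite in number is a dimension count. Take \<open>d\<close> minimal such that \<open>\<Omega>\<close> is
  covered by a definable family \<open>C\<^sub>y\<close>, \<open>y \<in> R\<^sup>d\<close>, of bounded upward closed sets. By minimality every
  \<open>u \<in> \<Omega>\<close> lies in \<open>C\<^sub>y\<close> for a large set of \<open>y\<close>. If \<open>D\<^sub>x\<close> is bounded for all \<open>x\<close> in an
  interval, exchanging quantifiers yields a single \<open>y\<close> such that \<open>D\<^sub>x \<subseteq> C\<^sub>y\<close> for infinitely many
  \<open>x\<close>, hence on a subinterval. Largeness is iterated infinity of fibres, so only one-variable
  o-minimality is needed, and neither monotonicity nor cell decomposition is used.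

  In the field case \<open>t\<close> is taken to be a definable function of \<open>s\<close> with a pole at \<open>0\<close>.
\<close>

section \<open>Definable predicates and functions\<close>

lemma tm_val_cong:
  fixes M :: "('f, 'r, 'a::{group_add, linorder}) expansion"
  shows "\<exists>N. \<forall>e e'. (\<forall>i<N. e i = e' i) \<longrightarrow> tm_val M e t = tm_val M e' t"
proof (induction t)
  case (Var i)
  then show ?case by (intro exI[of _ "Suc i"]) auto
next
  case (Plus t u)
  then obtain N N' where N:
    "\<And>e e'. \<forall>i<N. e i = e' i \<Longrightarrow> tm_val M e t = tm_val M e' t"
    "\<And>e e'. \<forall>i<N'. e i = e' i \<Longrightarrow> tm_val M e u = tm_val M e' u" by blast
  show ?case
  proof (intro exI[of _ "max N N'"] allI impI)
    fix e e' :: "nat \<Rightarrow> 'a"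
    assume "\<forall>i<max N N'. e i = e' i"
    then show "tm_val M e (Plus t u) = tm_val M e' (Plus t u)" using N[of e e'] by simp
  qed
next
  case (Fn f ts)
  then have "\<forall>t\<in>set ts. \<exists>N. \<forall>e e'. (\<forall>i<N. e i = e' i) \<longrightarrow> tm_val M e t = tm_val M e' t"
    by blast
  then obtain N where N:
    "\<And>t e e'. t \<in> set ts \<Longrightarrow> \<forall>i<N t. e i = e' i \<Longrightarrow> tm_val M e t = tm_val M e' t"
    unfolding bchoice_iff by blast
  show ?case
  proof (intro exI[of _ "Max (N ` set ts)"] allI impI)
    fix e e' :: "nat \<Rightarrow> 'a"
    assume e: "\<forall>i<Max (N ` set ts). e i = e' i"
    have "tm_val M e t = tm_val M e' t" if "t \<in> set ts" for t
    proof (rule N[OF that], intro allI impI)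
      fix i assume "i < N t"
      also have "N t \<le> Max (N ` set ts)" using that by simp
      finally show "e i = e' i" using e by blast
    qed
    then have "map (tm_val M e) ts = map (tm_val M e') ts" by simp
    then show "tm_val M e (Fn f ts) = tm_val M e' (Fn f ts)" by (simp only: tm_val.simps)
  qed
qed auto

lemma tms_val_cong:
  fixes M :: "('f, 'r, 'a::{group_add, linorder}) expansion"
  shows "\<exists>N. \<forall>e e'. (\<forall>i<N. e i = e' i) \<longrightarrow> map (tm_val M e) ts = map (tm_val M e') ts"
proof (induction ts)
  case (Cons t ts)
  then obtain N where N:
    "\<And>e e'. \<forall>i<N. e i = e' i \<Longrightarrow> map (tm_val M e) ts = map (tm_val M e') ts" by blast
  obtain N' where N':
    "\<And>e e'. \<forall>i<N'. e i = e' i \<Longrightarrow> tm_val M e t = tm_val M e' t"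
    using tm_val_cong by blast
  show ?case
  proof (intro exI[of _ "max N N'"] allI impI)
    fix e e' :: "nat \<Rightarrow> 'a"
    assume e: "\<forall>i<max N N'. e i = e' i"
    have "map (tm_val M e) ts = map (tm_val M e') ts" by (rule N) (use e in simp)
    moreover have "tm_val M e t = tm_val M e' t" by (rule N') (use e in simp)
    ultimately show "map (tm_val M e) (t # ts) = map (tm_val M e') (t # ts)" by simp
  qed
qed auto

lemma sat_cong:
  fixes M :: "('f, 'r, 'a::{group_add, linorder}) expansion"
  shows "\<exists>N. \<forall>e e'. (\<forall>i<N. e i = e' i) \<longrightarrow> sat M e \<phi> = sat M e' \<phi>"
proof (induction \<phi>)
  case (Equal t u)
  obtain N where N: "\<forall>e e'. (\<forall>i<N. e i = e' i) \<longrightarrow>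
      map (tm_val M e) [t, u] = map (tm_val M e') [t, u]"
    using tms_val_cong by blast
  show ?case
  proof (intro exI[of _ N] allI impI)
    fix e e' :: "nat \<Rightarrow> 'a"
    assume "\<forall>i<N. e i = e' i"
    then have "map (tm_val M e) [t, u] = map (tm_val M e') [t, u]" using N by blast
    then show "sat M e (Equal t u) = sat M e' (Equal t u)" by simp
  qed
next
  case (Less t u)
  obtain N where N: "\<forall>e e'. (\<forall>i<N. e i = e' i) \<longrightarrow>
      map (tm_val M e) [t, u] = map (tm_val M e') [t, u]"
    using tms_val_cong by blast
  show ?case
  proof (intro exI[of _ N] allI impI)
    fix e e' :: "nat \<Rightarrow> 'a"
    assume "\<forall>i<N. e i = e' i"
    then have "map (tm_val M e) [t, u] = map (tm_val M e') [t, u]" using N by blast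
    then show "sat M e (Less t u) = sat M e' (Less t u)" by simp
  qed
next
  case (Rel r ts)
  obtain N where N: "\<forall>e e'. (\<forall>i<N. e i = e' i) \<longrightarrow>
      map (tm_val M e) ts = map (tm_val M e') ts"
    using tms_val_cong by blast
  show ?case
  proof (intro exI[of _ N] allI impI)
    fix e e' :: "nat \<Rightarrow> 'a"
    assume "\<forall>i<N. e i = e' i"
    then have "map (tm_val M e) ts = map (tm_val M e') ts" using N by blast
    then show "sat M e (Rel r ts) = sat M e' (Rel r ts)" by (simp only: sat.simps)
  qed
next
  case (Conj \<phi> \<psi>)
  then obtain N N' where N:
    "\<And>e e'. \<forall>i<N. e i = e' i \<Longrightarrow> sat M e \<phi> = sat M e' \<phi>"
    "\<And>e e'. \<forall>i<N'. e i = e' i \<Longrightarrow> sat M e \<psi> = sat M e' \<psi>" by blast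
  show ?case
  proof (intro exI[of _ "max N N'"] allI impI)
    fix e e' :: "nat \<Rightarrow> 'a"
    assume "\<forall>i<max N N'. e i = e' i"
    then show "sat M e (Conj \<phi> \<psi>) = sat M e' (Conj \<phi> \<psi>)" using N[of e e'] by simp
  qed
next
  case (Exists i \<phi>)
  then obtain N where N: "\<And>e e'. \<forall>i<N. e i = e' i \<Longrightarrow> sat M e \<phi> = sat M e' \<phi>" by blast
  have "sat M (e(i := a)) \<phi> = sat M (e'(i := a)) \<phi>" if "\<forall>i<N. e i = e' i" for e e' a
    by (rule N) (use that in simp)
  then show ?case by (intro exI[of _ N] allI impI) (simp only: sat.simps)
qed auto

section \<open>Renaming of variables\<close>

lemma tm_rename:
  "wf_tm M t \<Longrightarrow> \<exists>t'. wf_tm M t' \<and> (\<forall>e. tm_val M e t' = tm_val M (\<lambda>i. e (\<rho> i)) t)"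
proof (induction t)
  case (Var i)
  show ?case by (rule exI[of _ "Var (\<rho> i)"]) simp
next
  case Zero
  show ?case by (rule exI[of _ Zero]) simp
next
  case (Plus t u)
  then obtain t' u' where "wf_tm M t'" "\<forall>e. tm_val M e t' = tm_val M (\<lambda>i. e (\<rho> i)) t"
    "wf_tm M u'" "\<forall>e. tm_val M e u' = tm_val M (\<lambda>i. e (\<rho> i)) u" by auto
  then show ?case by (intro exI[of _ "Plus t' u'"]) simp
next
  case (Fn f ts)
  then have "\<forall>t\<in>set ts. \<exists>t'. wf_tm M t' \<and> (\<forall>e. tm_val M e t' = tm_val M (\<lambda>i. e (\<rho> i)) t)"
    by (auto simp: list_all_iff)
  then obtain h where "\<forall>t\<in>set ts. wf_tm M (h t) \<and> (\<forall>e. tm_val M e (h t) = tm_val M (\<lambda>i. e (\<rho> i)) t)"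
    by metis
  with Fn.prems show ?case
    by (intro exI[of _ "Fn f (map h ts)"]) (simp add: list_all_iff comp_def cong: map_cong)
qed

lemma tms_rename:
  "list_all (wf_tm M) ts \<Longrightarrow> \<exists>ts'. length ts' = length ts \<and> list_all (wf_tm M) ts' \<and>
     (\<forall>e. map (tm_val M e) ts' = map (tm_val M (\<lambda>i. e (\<rho> i))) ts)"
proof (induction ts)
  case (Cons t ts)
  then obtain ts' where "length ts' = length ts" "list_all (wf_tm M) ts'"
     "\<forall>e. map (tm_val M e) ts' = map (tm_val M (\<lambda>i. e (\<rho> i))) ts" by auto
  moreover obtain t' where "wf_tm M t'" "\<forall>e. tm_val M e t' = tm_val M (\<lambda>i. e (\<rho> i)) t"
    using tm_rename[of M t] Cons.prems by auto
  ultimately show ?case by (intro exI[of _ "t' # ts'"]) simp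
qed simp

text \<open>The device by which coordinates and parameters are rearranged below. The induction
  generalises \<open>\<rho>\<close>, because passing under a quantifier changes it.\<close>

lemma fm_rename:
  "wf_fm M \<phi> \<Longrightarrow> \<exists>\<psi>. wf_fm M \<psi> \<and> (\<forall>e. sat M e \<psi> = sat M (\<lambda>i. e (\<rho> i)) \<phi>)"
proof (induction \<phi> arbitrary: \<rho>)
  case (Equal t u)
  then obtain t' u' where "wf_tm M t'" "\<forall>e. tm_val M e t' = tm_val M (\<lambda>i. e (\<rho> i)) t"
    "wf_tm M u'" "\<forall>e. tm_val M e u' = tm_val M (\<lambda>i. e (\<rho> i)) u" by (metis tm_rename wf_fm.simps(1))
  then show ?case by (intro exI[of _ "Equal t' u'"]) simp
next
  case (Less t u)
  then obtain t' u' where "wf_tm M t'" "\<forall>e. tm_val M e t' = tm_val M (\<lambda>i. e (\<rho> i)) t"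
    "wf_tm M u'" "\<forall>e. tm_val M e u' = tm_val M (\<lambda>i. e (\<rho> i)) u" by (metis tm_rename wf_fm.simps(2))
  then show ?case by (intro exI[of _ "Less t' u'"]) simp
next
  case (Rel r ts)
  then obtain ts' where "length ts' = length ts" "list_all (wf_tm M) ts'"
     "\<forall>e. map (tm_val M e) ts' = map (tm_val M (\<lambda>i. e (\<rho> i))) ts"
    by (metis tms_rename wf_fm.simps(3))
  then show ?case using Rel by (intro exI[of _ "Rel r ts'"]) simp
next
  case (Neg \<phi>)
  then obtain \<psi> where "wf_fm M \<psi>" "\<forall>e. sat M e \<psi> = sat M (\<lambda>i. e (\<rho> i)) \<phi>" by fastforce
  then show ?case by (intro exI[of _ "Neg \<psi>"]) simp
next
  case (Conj \<phi>1 \<phi>2)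
  then obtain \<psi>1 \<psi>2 where "wf_fm M \<psi>1" "\<forall>e. sat M e \<psi>1 = sat M (\<lambda>i. e (\<rho> i)) \<phi>1"
    "wf_fm M \<psi>2" "\<forall>e. sat M e \<psi>2 = sat M (\<lambda>i. e (\<rho> i)) \<phi>2" by (metis wf_fm.simps(5))
  then show ?case by (intro exI[of _ "Conj \<psi>1 \<psi>2"]) simp
next
  case (Exists i \<phi>)
  obtain N where N: "\<forall>e e'. (\<forall>i<N. e i = e' i) \<longrightarrow> sat M e \<phi> = sat M e' \<phi>"
    using sat_cong by blast
  \<comment> \<open>Since \<open>\<rho>\<close> need not be injective, the bound variable moves
    above the images of all variables that matter to \<open>\<phi>\<close>; otherwise it could
    capture one of them. Inserting 0 guards against the maximum of an empty set.\<close>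
  define k where "k = Suc (Max (insert 0 (\<rho> ` {..<N})))"
  have k: "\<rho> j < k" if "j < N" for j
    unfolding k_def using that by (intro le_imp_less_Suc Max_ge) auto
  obtain \<psi> where \<psi>: "wf_fm M \<psi>" "\<forall>e. sat M e \<psi> = sat M (\<lambda>j. e ((\<rho>(i := k)) j)) \<phi>"
    using Exists by fastforce
  have "sat M (e(k := a)) \<psi> = sat M ((\<lambda>j. e (\<rho> j))(i := a)) \<phi>" for e a
  proof -
    have "(e(k := a)) ((\<rho>(i := k)) j) = ((\<lambda>j. e (\<rho> j))(i := a)) j" if "j < N" for j
      using k[OF that] by auto
    then have "sat M (\<lambda>j. (e(k := a)) ((\<rho>(i := k)) j)) \<phi> = sat M ((\<lambda>j. e (\<rho> j))(i := a)) \<phi>"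
      by (rule N[rule_format])
    then show ?thesis unfolding \<psi>(2)[rule_format] .
  qed
  then show ?case using \<psi>(1) by (intro exI[of _ "Exists k \<psi>"]) (simp only: sat.simps wf_fm.simps simp_thms)
qed

text \<open>Interleaving leaves infinitely many variables for the arguments and infinitely many for
  the parameters, so that no arity has to be tracked while predicates are built.\<close>

definition mix :: "(nat \<Rightarrow> 'a) \<Rightarrow> (nat \<Rightarrow> 'a) \<Rightarrow> nat \<Rightarrow> 'a" where
  "mix e c i = (if even i then e (i div 2) else c (i div 2))"

lemma mix_simps [simp]: "mix e c (2 * i) = e i" "mix e c (Suc (2 * i)) = c i"
  by (auto simp: mix_def)

text \<open>Normal forms of the indices that arise when the parameters are themselves interleaved,
  as in \<open>mix e (mix c d)\<close>.\<close>

lemma mix_4 [simp]: "mix e c (4 * i) = e (2 * i)" "mix e c (Suc (4 * i)) = c (2 * i)"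
  "mix e c (Suc (Suc (Suc (4 * i)))) = c (Suc (2 * i))"
  using mix_simps[of e c "2 * i"] mix_simps(2)[of e c "Suc (2 * i)"] by (simp_all add: mult.assoc[symmetric] del: mix_simps)

lemma even_odd_cases:
  fixes i :: nat
  obtains j where "i = 2 * j" | j where "i = Suc (2 * j)"
  by (metis evenE oddE Suc_eq_plus1)

section \<open>Closure properties of definable predicates\<close>

named_theorems dfn_intros

text \<open>
  Predicates definable with parameters, on assignments of values to all variables; the
  parameters occupy the odd variables of the formula. Quantifiers are treated in de Bruijn style.
\<close>

definition dfn :: "('f, 'r, 'a::{group_add, linorder}) expansion \<Rightarrow> ((nat \<Rightarrow> 'a) \<Rightarrow> bool) \<Rightarrow> bool" where
  "dfn M P \<longleftrightarrow> (\<exists>(\<phi> :: ('f, 'r) fm) c. wf_fm M \<phi> \<and> (\<forall>e. P e \<longleftrightarrow> sat M (mix e c) \<phi>))"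

lemma dfn_assign:
  assumes "dfn M P"
  shows "dfn M (\<lambda>e. P (\<lambda>i. case \<sigma> i of Inl j \<Rightarrow> e j | Inr a \<Rightarrow> a))"
proof -
  obtain \<phi> c where \<phi>: "wf_fm M \<phi>" "\<forall>e. P e \<longleftrightarrow> sat M (mix e c) \<phi>"
    using assms unfolding dfn_def by blast
  \<comment> \<open>The inserted constants become the even-numbered new parameters, the old
    parameters the odd-numbered ones. The entries \<open>c 0\<close> are fillers that
    \<open>\<rho>\<close> never reaches.\<close>
  define c' where "c' = mix (\<lambda>i. case \<sigma> i of Inl j \<Rightarrow> c 0 | Inr a \<Rightarrow> a) c"
  define \<rho> where "\<rho> i = (if even i then (case \<sigma> (i div 2) of Inl j \<Rightarrow> 2 * j | Inr a \<Rightarrow> Suc (2 * i))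
     else Suc (2 * i))" for i
  obtain \<psi> where \<psi>: "wf_fm M \<psi>" "\<forall>e. sat M e \<psi> = sat M (\<lambda>i. e (\<rho> i)) \<phi>"
    using fm_rename \<phi>(1) by blast
  have "mix e c' (\<rho> i) = mix (\<lambda>i. case \<sigma> i of Inl j \<Rightarrow> e j | Inr a \<Rightarrow> a) c i" for e i
    by (rule even_odd_cases[of i]) (auto simp: \<rho>_def c'_def split: sum.splits)
  then have "(\<lambda>i. mix e c' (\<rho> i)) = mix (\<lambda>i. case \<sigma> i of Inl j \<Rightarrow> e j | Inr a \<Rightarrow> a) c" for e
    by auto
  then show ?thesis unfolding dfn_def using \<phi> \<psi> by metis
qed

lemma dfn_rename: "dfn M P \<Longrightarrow> dfn M (\<lambda>e. P (\<lambda>i. e (\<rho> i)))"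
  using dfn_assign[of M P "\<lambda>i. Inl (\<rho> i)"] by simp

lemma dfn_neg [dfn_intros]: "dfn M P \<Longrightarrow> dfn M (\<lambda>e. \<not> P e)"
  unfolding dfn_def by (metis sat.simps(4) wf_fm.simps(4))

lemma dfn_conj [dfn_intros]:
  assumes "dfn M P" "dfn M Q"
  shows "dfn M (\<lambda>e. P e \<and> Q e)"
proof -
  obtain \<phi> c where \<phi>: "wf_fm M \<phi>" "\<forall>e. P e \<longleftrightarrow> sat M (mix e c) \<phi>"
    using assms(1) unfolding dfn_def by blast
  obtain \<psi> d where \<psi>: "wf_fm M \<psi>" "\<forall>e. Q e \<longleftrightarrow> sat M (mix e d) \<psi>"
    using assms(2) unfolding dfn_def by blast
  \<comment> \<open>The joint parameters are \<open>mix c d\<close>: \<open>\<rho>\<close> sends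
    parameter \<open>j\<close> of \<open>\<phi>\<close> to slot \<open>2 * j\<close>, and
    \<open>\<rho>'\<close> sends parameter \<open>j\<close> of \<open>\<psi>\<close> to slot
    \<open>2 * j + 1\<close>.\<close>
  define \<rho> where "\<rho> i = (if even i then i else Suc (2 * (2 * (i div 2))))" for i :: nat
  define \<rho>' where "\<rho>' i = (if even i then i else Suc (2 * (Suc (2 * (i div 2)))))" for i :: nat
  obtain \<phi>' where \<phi>': "wf_fm M \<phi>'" "\<forall>e. sat M e \<phi>' = sat M (\<lambda>i. e (\<rho> i)) \<phi>"
    using fm_rename \<phi>(1) by blast
  obtain \<psi>' where \<psi>': "wf_fm M \<psi>'" "\<forall>e. sat M e \<psi>' = sat M (\<lambda>i. e (\<rho>' i)) \<psi>"
    using fm_rename \<psi>(1) by blast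
  have "(\<lambda>i. mix e (mix c d) (\<rho> i)) = mix e c" for e
    by (rule ext, rule_tac i = i in even_odd_cases) (auto simp: \<rho>_def)
  moreover have "(\<lambda>i. mix e (mix c d) (\<rho>' i)) = mix e d" for e
    by (rule ext, rule_tac i = i in even_odd_cases) (auto simp: \<rho>'_def)
  ultimately show ?thesis unfolding dfn_def
    using \<phi> \<psi> \<phi>' \<psi>' by (intro exI[of _ "Conj \<phi>' \<psi>'"] exI[of _ "mix c d"]) auto
qed

lemma dfn_ex [dfn_intros]:
  assumes "dfn M (\<lambda>e. P (\<lambda>i. e (Suc i)) (e 0))"
  shows "dfn M (\<lambda>e. \<exists>x. P e x)"
proof -
  obtain \<phi> c where \<phi>: "wf_fm M \<phi>" "\<forall>e. P (\<lambda>i. e (Suc i)) (e 0) \<longleftrightarrow> sat M (mix e c) \<phi>"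
    using assms unfolding dfn_def by blast
  \<comment> \<open>The quantified variable takes over variable 1, the first parameter slot.
    Parameters therefore move up by one slot, the other arguments down by one; the first entry of
    \<open>case_nat (c 0) c\<close> is a filler that the quantifier overwrites.\<close>
  define \<rho> where "\<rho> i = (if i = 0 then 1 else if even i then i - 2 else i + 2)" for i :: nat
  obtain \<psi> where \<psi>: "wf_fm M \<psi>" "\<forall>e. sat M e \<psi> = sat M (\<lambda>i. e (\<rho> i)) \<phi>"
    using fm_rename \<phi>(1) by blast
  have "P e x \<longleftrightarrow> sat M ((mix e (case_nat (c 0) c))(1 := x)) \<psi>" for e x
  proof -
    have "((mix e (case_nat (c 0) c))(1 := x)) (\<rho> i) = mix (case_nat x e) c i" for i
    proof (rule even_odd_cases[of i])
      fix j assume "i = 2 * j"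
      then show ?thesis
        using mix_simps(1)[of "case_nat x e" c j] mix_simps(1)[of e "case_nat (c 0) c" "j - 1"]
        by (cases j) (auto simp: \<rho>_def simp del: mix_simps)
    next
      fix j assume "i = Suc (2 * j)"
      then show ?thesis using mix_simps(2)[of e "case_nat (c 0) c" "Suc j"]
        by (simp add: \<rho>_def del: mix_simps) simp
    qed
    then have *: "(\<lambda>i. ((mix e (case_nat (c 0) c))(1 := x)) (\<rho> i)) = mix (case_nat x e) c" by auto
    have "P e x \<longleftrightarrow> sat M (mix (case_nat x e) c) \<phi>"
      using \<phi>(2)[rule_format, of "case_nat x e"] by simp
    then show ?thesis unfolding \<psi>(2)[rule_format] * .
  qed
  then have "\<forall>e. (\<exists>x. P e x) \<longleftrightarrow> sat M (mix e (case_nat (c 0) c)) (Exists 1 \<psi>)" by simp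
  then show ?thesis unfolding dfn_def using \<psi>(1) wf_fm.simps(6) by blast
qed

lemma dfn_var_eq: "dfn M (\<lambda>e. e i = e j)"
  unfolding dfn_def by (rule exI[of _ "Equal (Var (2*i)) (Var (2*j))"]) simp

lemma dfn_var_less: "dfn M (\<lambda>e. e i < e j)"
  unfolding dfn_def by (rule exI[of _ "Less (Var (2*i)) (Var (2*j))"]) simp

lemma dfn_var_plus: "dfn M (\<lambda>e. e i = e j + e k)"
  unfolding dfn_def
  by (rule exI[of _ "Equal (Var (2*i)) (Plus (Var (2*j)) (Var (2*k)))"]) simp

lemma dfn_const [dfn_intros]: "dfn M (\<lambda>e. b)"
proof (cases b)
  case True
  then show ?thesis using dfn_var_eq[of M 0 0] by simp
next
  case False
  then show ?thesis using dfn_neg[OF dfn_var_eq[of M 0 0]] by simp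
qed

lemma dfn_disj [dfn_intros]: "dfn M P \<Longrightarrow> dfn M Q \<Longrightarrow> dfn M (\<lambda>e. P e \<or> Q e)"
  using dfn_neg[OF dfn_conj[OF dfn_neg dfn_neg]] by simp

lemma dfn_imp [dfn_intros]: "dfn M P \<Longrightarrow> dfn M Q \<Longrightarrow> dfn M (\<lambda>e. P e \<longrightarrow> Q e)"
  unfolding imp_conv_disj by (intro dfn_disj dfn_neg)

lemma dfn_all [dfn_intros]:
  assumes "dfn M (\<lambda>e. P (\<lambda>i. e (Suc i)) (e 0))"
  shows "dfn M (\<lambda>e. \<forall>x. P e x)"
proof -
  have "dfn M (\<lambda>e. \<not> (\<exists>x. \<not> P e x))" by (intro dfn_neg dfn_ex assms)
  then show ?thesis by simp
qed

section \<open>Definable functions and substitution\<close>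

definition dt :: "('f, 'r, 'a::{group_add, linorder}) expansion \<Rightarrow> ((nat \<Rightarrow> 'a) \<Rightarrow> 'a) \<Rightarrow> bool" where
  "dt M t \<longleftrightarrow> dfn M (\<lambda>e. e 0 = t (\<lambda>i. e (Suc i)))"

lemma dt_eqD: "dt M t \<Longrightarrow> dfn M (\<lambda>e. e j = t (\<lambda>i. e (\<rho> i)))"
  unfolding dt_def by (drule dfn_rename[where \<rho> = "case_nat j \<rho>"]) simp

lemma dt_var [dfn_intros]: "dt M (\<lambda>e. e i)"
  unfolding dt_def by (rule dfn_var_eq)

lemma dt_const [dfn_intros]: "dt M (\<lambda>e. a)"
  unfolding dt_def using dfn_assign[OF dfn_var_eq[of M 0 1], of "\<lambda>i. if i = 0 then Inl 0 else Inr a"]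
  by simp

lemma dfn_subst1:
  assumes "dt M t" "dfn M (\<lambda>e. P (\<lambda>i. e (Suc i)) (e 0))"
  shows "dfn M (\<lambda>e. P e (t e))"
proof -
  have "dfn M (\<lambda>e. \<exists>x. x = t e \<and> P e x)"
    by (intro dfn_ex dfn_conj assms(2) dt_eqD[OF assms(1)])
  then show ?thesis by simp
qed

lemma dt_shift: "dt M t \<Longrightarrow> dt M (\<lambda>e. t (\<lambda>i. e (\<rho> i)))"
  unfolding dt_def by (drule dfn_rename[where \<rho> = "case_nat 0 (\<lambda>i. Suc (\<rho> i))"]) simp

text \<open>A substitution for all variables at once. No uniformity in \<open>i\<close> is asked
  for, since a definable predicate reads only finitely many variables.\<close>

definition dte :: 
    "('f, 'r, 'a::{group_add, linorder}) expansion \<Rightarrow> ((nat \<Rightarrow> 'a) \<Rightarrow> nat \<Rightarrow> 'a) \<Rightarrow> bool" where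
  "dte M \<sigma> \<longleftrightarrow> (\<forall>i. dt M (\<lambda>e. \<sigma> e i))"

lemma dfn_support:
  assumes "dfn M P"
  obtains N where "\<And>e e'. (\<And>i. i < N \<Longrightarrow> e i = e' i) \<Longrightarrow> P e \<longleftrightarrow> P e'"
proof -
  obtain \<phi> c where \<phi>: "\<forall>e. P e \<longleftrightarrow> sat M (mix e c) \<phi>"
    using assms unfolding dfn_def by blast
  obtain N where N: "\<forall>e e'. (\<forall>i<N. e i = e' i) \<longrightarrow> sat M e \<phi> = sat M e' \<phi>"
    using sat_cong by blast
  have "P e \<longleftrightarrow> P e'" if "\<And>i. i < N \<Longrightarrow> e i = e' i" for e e'
  proof -
    have "mix e c i = mix e' c i" if "i < N" for i
      using that \<open>\<And>i. i < N \<Longrightarrow> e i = e' i\<close>[of "i div 2"] by (auto simp: mix_def)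
    then show ?thesis using \<phi> N by metis
  qed
  then show ?thesis using that by blast
qed

text \<open>The arguments of \<open>\<sigma>\<close> are read from variables moved up by
  \<open>N\<close>, so that replacing the variables below \<open>N\<close> one after another does
  not disturb them; a final renaming moves them back.\<close>

lemma dfn_subst:
  assumes "dfn M P" "dte M \<sigma>"
  shows "dfn M (\<lambda>e. P (\<sigma> e))"
proof -
  obtain N where N: "\<And>e e'. (\<And>i. i < N \<Longrightarrow> e i = e' i) \<Longrightarrow> P e \<longleftrightarrow> P e'"
    using dfn_support[OF assms(1)] by blast
  text \<open>Only finitely many variables matter; they are substituted one at a time.\<close>
  have "dfn M (\<lambda>e. P (\<lambda>i. if i < k then \<sigma> (\<lambda>i. e (i + N)) i else e i))" if "k \<le> N" for k
    using that
  proof (induction k)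
    case 0
    then show ?case using assms(1) by simp
  next
    case (Suc k)
    define Q where "Q e x = P (\<lambda>i. if i < k then \<sigma> (\<lambda>i. e (i + N)) i else if i = k then x else e i)"
      for e x
    have "dfn M (\<lambda>e. Q (\<lambda>i. e (Suc i)) (e 0))"
    proof -
      have IH: "dfn M (\<lambda>e. P (\<lambda>i. if i < k then \<sigma> (\<lambda>i. e (i + N)) i else e i))"
        using Suc by simp
      define \<rho> where "\<rho> i = (if i = k then 0 else Suc i)" for i
      have "Q (\<lambda>i. e (Suc i)) (e 0) =
          P (\<lambda>i. if i < k then \<sigma> (\<lambda>i. e (\<rho> (i + N))) i else e (\<rho> i))" for e
      proof -
        have "(\<lambda>i. e (Suc (i + N))) = (\<lambda>i. e (\<rho> (i + N)))"
          using Suc.prems by (auto simp: \<rho>_def)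
        then show ?thesis unfolding Q_def by (intro arg_cong[of _ _ P] ext) (simp add: \<rho>_def)
      qed
      then show ?thesis using dfn_rename[OF IH, of \<rho>] by (simp only:)
    qed
    from dfn_subst1[OF dt_shift this]
    have "dt M (\<lambda>e. \<sigma> e k) \<Longrightarrow> dfn M (\<lambda>e. Q e (\<sigma> (\<lambda>i. e (i + N)) k))" .
    with assms(2) have "dfn M (\<lambda>e. Q e (\<sigma> (\<lambda>i. e (i + N)) k))" unfolding dte_def by blast
    moreover have "Q e (\<sigma> (\<lambda>i. e (i + N)) k) =
      P (\<lambda>i. if i < Suc k then \<sigma> (\<lambda>i. e (i + N)) i else e i)" for e
      unfolding Q_def by (rule arg_cong[of _ _ P]) (auto simp: less_Suc_eq)
    ultimately show ?case by (simp only:)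
  qed
  from this[OF order_refl] have "dfn M (\<lambda>e. P (\<lambda>i. if i < N then \<sigma> (\<lambda>i. e (i + N)) i else e i))" .
  from dfn_rename[OF this, of "\<lambda>i. i - N"]
  have "dfn M (\<lambda>e. P (\<lambda>i. if i < N then \<sigma> e i else e (i - N)))"
    by (simp only: add_diff_cancel_right')
  moreover have "P (\<lambda>i. if i < N then \<sigma> e i else e (i - N)) = P (\<sigma> e)" for e
    by (rule N) simp
  ultimately show ?thesis by (simp only:)
qed

lemma dt_if [dfn_intros]: "dt M t \<Longrightarrow> dt M s \<Longrightarrow> dt M (\<lambda>e. if b then t e else s e)"
  by (cases b) simp_all

lemma dfn_subst2:
  assumes "dt M t" "dt M s" "dfn M (\<lambda>e. P (e 0) (e 1))"
  shows "dfn M (\<lambda>e. P (t e) (s e))"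
proof -
  have "dte M (\<lambda>e i. if i = 0 then t e else s e)"
    unfolding dte_def by (intro allI dt_if assms)
  from dfn_subst[OF assms(3) this] show ?thesis by simp
qed

lemma dfn_eq [dfn_intros]: "dt M t \<Longrightarrow> dt M s \<Longrightarrow> dfn M (\<lambda>e. t e = s e)"
  by (rule dfn_subst2[where P = "(=)", OF _ _ dfn_var_eq])

lemma dfn_less [dfn_intros]: "dt M t \<Longrightarrow> dt M s \<Longrightarrow> dfn M (\<lambda>e. t e < s e)"
  by (rule dfn_subst2[where P = "(<)", OF _ _ dfn_var_less])

lemma dfn_le [dfn_intros]: "dt M t \<Longrightarrow> dt M s \<Longrightarrow> dfn M (\<lambda>e. t e \<le> s e)"
  unfolding linorder_not_less[symmetric] by (intro dfn_neg dfn_less)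

lemma dt_plus [dfn_intros]:
  assumes "dt M t" "dt M s"
  shows "dt M (\<lambda>e. t e + s e)"
proof -
  have "dte M (\<lambda>e i. if i = 0 then e 0 else if i = 1 then t (\<lambda>i. e (Suc i)) else s (\<lambda>i. e (Suc i)))"
    unfolding dte_def by (intro allI dt_if dt_var dt_shift[OF assms(1)] dt_shift[OF assms(2)])
  from dfn_subst[OF dfn_var_plus[of M 0 1 2] this] show ?thesis unfolding dt_def by simp
qed

lemma dt_uminus [dfn_intros]:
  assumes "dt M t"
  shows "dt M (\<lambda>e. - t e)"
proof -
  have "dfn M (\<lambda>e. 0 = e 0 + t (\<lambda>i. e (Suc i)))"
    by (rule dfn_eq[OF dt_const dt_plus[OF dt_var dt_shift[OF assms]]])
  moreover have "0 = e 0 + t (\<lambda>i. e (Suc i)) \<longleftrightarrow> e 0 = - t (\<lambda>i. e (Suc i))" for e :: "nat \<Rightarrow> 'c"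
    by (metis eq_neg_iff_add_eq_0)
  ultimately show ?thesis unfolding dt_def by simp
qed

section \<open>Tuples of definable functions and quantifiers over tuples\<close>

definition dtl ::
    "('f, 'r, 'a::{group_add, linorder}) expansion \<Rightarrow> nat \<Rightarrow> ((nat \<Rightarrow> 'a) \<Rightarrow> 'a list) \<Rightarrow> bool" where
  "dtl M m f \<longleftrightarrow> (\<forall>e. length (f e) = m) \<and> (\<forall>i<m. dt M (\<lambda>e. f e ! i))"

lemma dtl_shift: "dtl M m f \<Longrightarrow> dtl M m (\<lambda>e. f (\<lambda>i. e (\<rho> i)))"
  unfolding dtl_def by (auto intro: dt_shift[of M "\<lambda>e. f e ! i" for i])

lemma dte_shift: "dte M \<sigma> \<Longrightarrow> dte M (\<lambda>e. \<sigma> (\<lambda>i. e (\<rho> i)))"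
  unfolding dte_def by (auto intro: dt_shift[of M "\<lambda>e. \<sigma> e i" for i])

lemma dte_id [dfn_intros]: "dte M (\<lambda>e. e)" "dte M (\<lambda>e i. e (\<rho> i))"
  unfolding dte_def by (intro allI dt_var)+

lemma dte_case [dfn_intros]: "dt M t \<Longrightarrow> dte M \<sigma> \<Longrightarrow> dte M (\<lambda>e. case_nat (t e) (\<sigma> e))"
  unfolding dte_def by (rule allI, case_tac i) simp_all

lemma dte_app: "dte M \<sigma> \<Longrightarrow> dt M (\<lambda>e. \<sigma> e i)"
  unfolding dte_def by auto

lemma dtl_Nil [dfn_intros]: "dtl M 0 (\<lambda>e. [])"
  unfolding dtl_def by simp

lemma dtl_Cons [dfn_intros]: "dt M t \<Longrightarrow> dtl M m f \<Longrightarrow> dtl M (Suc m) (\<lambda>e. t e # f e)"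
  unfolding dtl_def by (rule conjI, simp, intro allI, case_tac i) simp_all

lemma dtl_append [dfn_intros]: "dtl M k f \<Longrightarrow> dtl M m g \<Longrightarrow> dtl M (k + m) (\<lambda>e. f e @ g e)"
  unfolding dtl_def by (rule conjI, simp, intro allI, case_tac "i < k") (simp_all add: nth_append)

lemma dtl_const [dfn_intros]: "length u = m \<Longrightarrow> dtl M m (\<lambda>e. u)"
  unfolding dtl_def by (auto intro: dt_const)

lemma dtl_map [dfn_intros]:
  "(\<And>i. i < m \<Longrightarrow> dt M (\<lambda>e. t i e)) \<Longrightarrow> dtl M m (\<lambda>e. map (\<lambda>i. t i e) [0..<m])"
  unfolding dtl_def by auto

lemma dtl_nth: "dtl M m f \<Longrightarrow> i < m \<Longrightarrow> dt M (\<lambda>e. f e ! i)"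
  unfolding dtl_def by auto

lemma dfn_list_ex [dfn_intros]:
  assumes "dfn M (\<lambda>e. P (\<lambda>i. e (i + m)) (map (\<lambda>i. e i) [0..<m]))"
  shows "dfn M (\<lambda>e. \<exists>u. length u = m \<and> P e u)"
  using assms
proof (induction m arbitrary: P)
  case 0
  then show ?case by simp
next
  case (Suc m)
  have "dfn M (\<lambda>e. \<exists>x. \<exists>u. length u = m \<and> P e (x # u))"
  proof (rule dfn_ex, rule Suc.IH)
    \<comment> \<open>Once the head and then the \<open>m\<close> entries of the tail have been
      bound, the head is variable \<open>m\<close>, whereas the hypothesis on \<open>P\<close> has
      it as variable 0.\<close>
    define \<rho> where "\<rho> i = (if i = 0 then m else if i \<le> m then i - 1 else i)" for i
    have *: "map (\<lambda>i. e (\<rho> i)) [0..<Suc m] = e (0 + m) # map (\<lambda>i. e i) [0..<m]"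
      and **: "(\<lambda>i. e (\<rho> (i + Suc m))) = (\<lambda>i. e (Suc i + m))" for e :: "nat \<Rightarrow> 'c"
      by (rule nth_equalityI) (auto simp: \<rho>_def nth_Cons simp del: upt_Suc split: nat.split)
    show "dfn M (\<lambda>e. P (\<lambda>i. e (Suc i + m)) (e (0 + m) # map (\<lambda>i. e i) [0..<m]))"
      using dfn_rename[OF Suc.prems, of \<rho>] unfolding * ** .
  qed
  moreover have "(\<exists>u. length u = Suc m \<and> P e u) \<longleftrightarrow> (\<exists>x. \<exists>u. length u = m \<and> P e (x # u))" for e
    by (metis length_Suc_conv)
  ultimately show ?case by simp
qed

lemma dfn_list_all [dfn_intros]:
  assumes "dfn M (\<lambda>e. P (\<lambda>i. e (i + m)) (map (\<lambda>i. e i) [0..<m]))"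
  shows "dfn M (\<lambda>e. \<forall>u. length u = m \<longrightarrow> P e u)"
proof -
  have "dfn M (\<lambda>e. \<not> (\<exists>u. length u = m \<and> \<not> P e u))" by (intro dfn_neg dfn_list_ex assms)
  then show ?thesis by simp
qed

lemma dfn_ball_less:
  "(\<And>i. i < m \<Longrightarrow> dfn M (\<lambda>e. P i e)) \<Longrightarrow> dfn M (\<lambda>e. \<forall>i<m. P i e)" for m :: nat
proof (induction m)
  case 0
  show ?case using dfn_const[of M True] by simp
next
  case (Suc m)
  then have "dfn M (\<lambda>e. P m e \<and> (\<forall>i<m. P i e))" by (intro dfn_conj) auto
  then show ?case by (simp add: All_less_Suc)
qed

lemma dfn_list_eq: "dtl M m f \<Longrightarrow> dtl M m g \<Longrightarrow> dfn M (\<lambda>e. f e = g e)"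
proof -
  assume "dtl M m f" "dtl M m g"
  then have "dfn M (\<lambda>e. \<forall>i<m. f e ! i = g e ! i)"
    by (intro dfn_ball_less dfn_eq dtl_nth)
  moreover have "f e = g e \<longleftrightarrow> (\<forall>i<m. f e ! i = g e ! i)" for e
    using \<open>dtl M m f\<close> \<open>dtl M m g\<close> unfolding dtl_def by (auto simp: list_eq_iff_nth_eq)
  ultimately show ?thesis by simp
qed

text \<open>The bridge between \<open>definable\<close>, where the coordinates are the variables
  below \<open>n\<close>, and the interleaved encoding used by \<open>dfn\<close>.\<close>

lemma definable_iff_dfn:
  fixes M :: "('f, 'r, 'a::{group_add, linorder}) expansion"
  shows "definable M n S \<longleftrightarrow> (\<forall>x\<in>S. length x = n) \<and> dfn M (\<lambda>e. map (\<lambda>i. e i) [0..<n] \<in> S)"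
proof
  assume "definable M n S"
  then obtain \<phi> :: "('f, 'r) fm" and c where \<phi>: "wf_fm M \<phi>"
    and S: "S = {a. length a = n \<and> sat M (\<lambda>i. if i < n then a ! i else c i) \<phi>}"
    unfolding definable_def by blast
  obtain \<psi> where \<psi>: "wf_fm M \<psi>" "\<forall>e. sat M e \<psi> = sat M (\<lambda>i. e (if i < n then 2 * i else Suc (2 * i))) \<phi>"
    using fm_rename[OF \<phi>, of "\<lambda>i. if i < n then 2 * i else Suc (2 * i)"] by blast
  have "(\<lambda>i. mix e c (if i < n then 2 * i else Suc (2 * i))) = (\<lambda>i. if i < n then map e [0..<n] ! i else c i)" for e
    by auto
  then have "map e [0..<n] \<in> S \<longleftrightarrow> sat M (mix e c) \<psi>" for e
    unfolding S using \<psi>(2) by simp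
  then show "(\<forall>x\<in>S. length x = n) \<and> dfn M (\<lambda>e. map (\<lambda>i. e i) [0..<n] \<in> S)"
    using \<psi>(1) S unfolding dfn_def by auto
next
  assume *: "(\<forall>x\<in>S. length x = n) \<and> dfn M (\<lambda>e. map (\<lambda>i. e i) [0..<n] \<in> S)"
  then obtain \<phi> c where \<phi>: "wf_fm M \<phi>" "\<forall>e. map e [0..<n] \<in> S \<longleftrightarrow> sat M (mix e c) \<phi>"
    unfolding dfn_def by auto
  define d where "d i = (if n \<le> i then (let j = i - n in mix (\<lambda>k. c 0) c j) else c 0)" for i
  \<comment> \<open>Coordinates return to their places below \<open>n\<close>, and every other
    variable moves up by \<open>n\<close>. Among these, the arguments beyond the coordinates do not
    affect membership, and \<open>d\<close> gives them the value \<open>c 0\<close>.\<close>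
  define \<rho> where "\<rho> i = (if even i \<and> i div 2 < n then i div 2 else i + n)" for i
  obtain \<psi> where \<psi>: "wf_fm M \<psi>" "\<forall>e. sat M e \<psi> = sat M (\<lambda>i. e (\<rho> i)) \<phi>"
    using fm_rename[OF \<phi>(1), of \<rho>] by blast
  have "a \<in> S \<longleftrightarrow> sat M (\<lambda>i. if i < n then a ! i else d i) \<psi>" if "length a = n" for a
  proof -
    have "(\<lambda>i. if \<rho> i < n then a ! \<rho> i else d (\<rho> i)) = mix (\<lambda>i. if i < n then a ! i else c 0) c"
      by (rule ext) (auto simp: \<rho>_def d_def mix_def Let_def)
    moreover have "map (\<lambda>i. if i < n then a ! i else c 0) [0..<n] = a"
      using that by (auto simp: list_eq_iff_nth_eq)
    ultimately show ?thesis
      using \<phi>(2)[rule_format, of "\<lambda>i. if i < n then a ! i else c 0"]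
      unfolding \<psi>(2)[rule_format] by (simp only:)
  qed
  then have "S = {a. length a = n \<and> sat M (\<lambda>i. if i < n then a ! i else d i) \<psi>}"
    using * by blast
  then show "definable M n S" unfolding definable_def using \<psi>(1) by blast
qed

lemma dfn_mem:
  assumes "definable M n S" "dtl M n f"
  shows "dfn M (\<lambda>e. f e \<in> S)"
proof -
  have "dfn M (\<lambda>e. map (\<lambda>i. if i < n then f e ! i else e i) [0..<n] \<in> S)"
  proof (rule dfn_subst[of M "\<lambda>e. map (\<lambda>i. e i) [0..<n] \<in> S"])
    show "dfn M (\<lambda>e. map (\<lambda>i. e i) [0..<n] \<in> S)" using assms(1) by (simp add: definable_iff_dfn)
    have "dt M (\<lambda>e. if i < n then f e ! i else e i)" for i
      using dtl_nth[OF assms(2)] by (cases "i < n") (simp_all add: dt_var)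
    then show "dte M (\<lambda>e i. if i < n then f e ! i else e i)" unfolding dte_def by blast
  qed
  moreover have "map (\<lambda>i. if i < n then f e ! i else e i) [0..<n] = f e" for e
    using assms unfolding dtl_def by (auto simp: list_eq_iff_nth_eq)
  ultimately show ?thesis by simp
qed

section \<open>One-variable o-minimality\<close>

locale omin =
  fixes M :: "('f, 'r, 'a::{group_add, unbounded_dense_linorder}) expansion"
  assumes om: "ominimal_ordered_group M"
begin

lemma add_less [simp]: "c + a < c + b \<longleftrightarrow> a < b" "a + c < b + c \<longleftrightarrow> a < b" for a b c :: 'a
  using om unfolding ominimal_ordered_group_def by (metis less_asym linorder_neqE)+

lemma add_le [simp]: "c + a \<le> c + b \<longleftrightarrow> a \<le> b" "a + c \<le> b + c \<longleftrightarrow> a \<le> b" for a b c :: 'a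
  by (simp_all flip: not_less)

section \<open>Definable subsets of the line\<close>

definition dset :: "'a set \<Rightarrow> bool" where
  "dset S \<longleftrightarrow> dfn M (\<lambda>e. e 0 \<in> S)"

lemma dsetI: "dfn M (\<lambda>e. P (e 0)) \<Longrightarrow> dset {x. P x}"
  unfolding dset_def by simp

lemma dset_pieces:
  assumes "dset S"
  obtains \<I> where "finite \<I>" "\<forall>J\<in>\<I>. point_or_open_interval J" "S = \<Union>\<I>"
proof -
  have "map (\<lambda>i. e i) [0..<1] \<in> {[x] |x. x \<in> S} \<longleftrightarrow> e 0 \<in> S" for e :: "nat \<Rightarrow> 'a" by simp
  then have "definable M 1 {[x] |x. x \<in> S}"
    using assms unfolding definable_iff_dfn dset_def by (simp only:) auto
  moreover have "definable M 1 {[x] |x. x \<in> S} \<longrightarrow>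
      (\<exists>\<I>. finite \<I> \<and> (\<forall>J\<in>\<I>. point_or_open_interval J) \<and> S = \<Union>\<I>)"
    by (rule spec[OF conjunct2[OF om[unfolded ominimal_ordered_group_def]]])
  ultimately show ?thesis using that by blast
qed

lemma dset_infinite:
  assumes "dset S" "infinite S"
  obtains a b where "a < b" "{a<..<b} \<subseteq> S"
proof -
  obtain \<I> where I: "finite \<I>" "\<forall>J\<in>\<I>. point_or_open_interval J" "S = \<Union>\<I>"
    by (rule dset_pieces[OF assms(1)])
  then obtain J where J: "J \<in> \<I>" "infinite J" using assms(2) by blast
  have "\<exists>a b. a < b \<and> {a<..<b} \<subseteq> J"
    using bspec[OF I(2) J(1)] J(2) unfolding point_or_open_interval_def
  proof (elim disjE exE)
    fix a b assume "J = {a<..<b}"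
    moreover from this have "a < b" using J(2) by (metis finite.emptyI greaterThanLessThan_empty not_less)
    ultimately show ?thesis by blast
  next
    fix a assume "J = {a<..}"
    then show ?thesis using gt_ex[of a] by (metis greaterThan_iff greaterThanLessThan_iff subsetI)
  next
    fix b assume "J = {..<b}"
    then show ?thesis using lt_ex[of b] by (metis lessThan_iff greaterThanLessThan_iff subsetI)
  next
    assume "J = UNIV"
    then show ?thesis using gt_ex[of 0] by auto
  qed simp
  then obtain a b where "a < b" "{a<..<b} \<subseteq> J" by blast
  then show ?thesis using that[of a b] I(3) J(1) by blast
qed

text \<open>This turns "there are infinitely many" into a first-order quantifier, so that definable
  predicates may use it.\<close>

lemma infinite_iff:
  assumes "dset {x. P x}"
  shows "infinite {x. P x} \<longleftrightarrow> (\<exists>a b. a < b \<and> (\<forall>x. a < x \<and> x < b \<longrightarrow> P x))"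
proof
  assume "infinite {x. P x}"
  then show "\<exists>a b. a < b \<and> (\<forall>x. a < x \<and> x < b \<longrightarrow> P x)"
    by (rule dset_infinite[OF assms]) (intro exI conjI, assumption, auto)
next
  assume "\<exists>a b. a < b \<and> (\<forall>x. a < x \<and> x < b \<longrightarrow> P x)"
  then obtain a b where "a < b" "{a<..<b} \<subseteq> {x. P x}"
    by (metis (no_types, lifting) greaterThanLessThan_iff mem_Collect_eq subsetI)
  then show "infinite {x. P x}" using infinite_Ioo infinite_super by blast
qed

lemma dfn_at:
  assumes "dfn M (\<lambda>e. P (\<lambda>i. e (Suc i)) (e 0))"
  shows "dfn M (\<lambda>e. P c (e 0))"
  using dfn_assign[OF assms, of "case_nat (Inl 0) (\<lambda>i. Inr (c i))"] by simp

lemma dset_at: "dfn M (\<lambda>e. P (\<lambda>i. e (Suc i)) (e 0)) \<Longrightarrow> dset {x. P c x}"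
  by (rule dsetI, rule dfn_at)

lemma dfn_infinite [dfn_intros]:
  assumes "dfn M (\<lambda>e. P (\<lambda>i. e (Suc i)) (e 0))"
  shows "dfn M (\<lambda>e. infinite {x. P e x})"
proof -
  have "dfn M (\<lambda>e. \<exists>a b. a < b \<and> (\<forall>x. a < x \<and> x < b \<longrightarrow> P e x))"
    by (intro dfn_intros)
      (rule dfn_rename[OF assms, of "case_nat 0 (\<lambda>i. Suc (Suc (Suc i)))", unfolded nat.case])
  then show ?thesis using infinite_iff[OF dset_at[OF assms]] by (simp only:)
qed

text \<open>The order itself may be incomplete. Each nonempty bounded piece has a supremum, namely
  an end point of it, and the largest of these finitely many end points is the supremum of
  \<open>S\<close>.\<close>

lemma dset_lub:
  assumes "dset S" "x \<in> S" "\<And>x. x \<in> S \<Longrightarrow> x \<le> B"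
  obtains c where "\<forall>x\<in>S. x \<le> c" "\<forall>c'. (\<forall>x\<in>S. x \<le> c') \<longrightarrow> c \<le> c'"
proof -
  obtain \<I> where I: "finite \<I>" "\<forall>J\<in>\<I>. point_or_open_interval J" "S = \<Union>\<I>"
    by (rule dset_pieces[OF assms(1)])
  define \<K> where "\<K> = {J \<in> \<I>. J \<noteq> {}}"
  have "\<exists>c. \<forall>c'. c \<le> c' \<longleftrightarrow> (\<forall>x\<in>J. x \<le> c')" if J: "J \<in> \<K>" for J
  proof -
    have B: "x \<le> B" if "x \<in> J" for x using assms(3) I(3) J that unfolding \<K>_def by blast
    have "point_or_open_interval J" "J \<noteq> {}" using J I(2) unfolding \<K>_def by auto
    then show ?thesis unfolding point_or_open_interval_def
    proof (elim disjE exE)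
      fix a b assume ab: "J = {a<..<b}"
      with \<open>J \<noteq> {}\<close> have "a < b" by auto
      show ?thesis
      proof (intro exI[of _ b] allI iffI ballI)
        fix c' assume c': "\<forall>x\<in>J. x \<le> c'"
        show "b \<le> c'"
        proof (rule ccontr)
          assume "\<not> b \<le> c'"
          then have "max a c' < b" using \<open>a < b\<close> by simp
          then obtain z where "max a c' < z" "z < b" using dense by blast
          then have "z \<in> J" "c' < z" using ab by simp_all
          then show False using c' by (meson not_less)
        qed
      qed (use ab in auto)
    next
      fix a assume "J = {a<..}"
      moreover obtain z where "max a B < z" using gt_ex by blast
      ultimately show ?thesis using B[of z] by auto
    next
      fix b assume b: "J = {..<b}"
      show ?thesis
      proof (intro exI[of _ b] allI iffI ballI)
        fix c' assume c': "\<forall>x\<in>J. x \<le> c'"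
        show "b \<le> c'"
        proof (rule ccontr)
          assume "\<not> b \<le> c'"
          then have "c' < b" by simp
          then obtain z where "c' < z" "z < b" using dense by blast
          then have "z \<in> J" "c' < z" using b by simp_all
          then show False using c' by (meson not_less)
        qed
      qed (use b in auto)
    next
      assume "J = UNIV"
      moreover obtain z where "B < z" using gt_ex by blast
      ultimately show ?thesis using B[of z] by auto
    qed auto
  qed
  then have "\<forall>J\<in>\<K>. \<exists>c. \<forall>c'. c \<le> c' \<longleftrightarrow> (\<forall>x\<in>J. x \<le> c')" by blast
  from bchoice[OF this]
  obtain c where c: "\<And>J c'. J \<in> \<K> \<Longrightarrow> c J \<le> c' \<longleftrightarrow> (\<forall>x\<in>J. x \<le> c')" by blast
  have K: "finite \<K>" "\<K> \<noteq> {}" "S = \<Union>\<K>" using I assms(2) unfolding \<K>_def by auto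
  then have *: "Max (c ` \<K>) \<le> c' \<longleftrightarrow> (\<forall>x\<in>S. x \<le> c')" for c' using c by auto
  show ?thesis by (rule that[of "Max (c ` \<K>)"]) (use * in auto)
qed

text \<open>Obtained as the supremum of the definable set of lower bounds.\<close>

lemma dset_glb:
  assumes "dset S" "x \<in> S" "\<And>x. x \<in> S \<Longrightarrow> B \<le> x"
  obtains c where "\<forall>x\<in>S. c \<le> x" "\<forall>c'. (\<forall>x\<in>S. c' \<le> x) \<longrightarrow> c' \<le> c"
proof -
  have S: "dfn M (\<lambda>e. t e \<in> S)" if "dt M t" for t
    using dfn_subst1[OF that, of "\<lambda>e x. x \<in> S"] assms(1) unfolding dset_def by blast
  have "dset {y. \<forall>x. x \<in> S \<longrightarrow> y \<le> x}"
    by (intro dsetI dfn_intros S)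
  then obtain c where c: "\<forall>y\<in>{y. \<forall>x. x \<in> S \<longrightarrow> y \<le> x}. y \<le> c"
      "\<forall>c'. (\<forall>y\<in>{y. \<forall>x. x \<in> S \<longrightarrow> y \<le> x}. y \<le> c') \<longrightarrow> c \<le> c'"
    by (rule dset_lub[of _ B x]) (use assms(2,3) in auto)
  show ?thesis by (rule that[of c]) (use c in auto)
qed

text \<open>Each of the finitely many pieces is either present or absent just to the right of
  \<open>a\<close>, and this dichotomy passes to the union. Definable choice relies on it.\<close>

lemma dset_germ_right:
  assumes "dset S"
  obtains b where "a < b" "(\<forall>x. a < x \<and> x < b \<longrightarrow> x \<in> S) \<or> (\<forall>x. a < x \<and> x < b \<longrightarrow> x \<notin> S)"
proof -
  obtain \<I> where I: "finite \<I>" "\<forall>J\<in>\<I>. point_or_open_interval J" "S = \<Union>\<I>"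
    by (rule dset_pieces[OF assms(1)])
  from I(1,2) have "\<exists>b>a. (\<forall>x. a < x \<and> x < b \<longrightarrow> x \<in> \<Union>\<I>) \<or> (\<forall>x. a < x \<and> x < b \<longrightarrow> x \<notin> \<Union>\<I>)"
  proof (induction \<I>)
    case empty
    then show ?case using gt_ex by auto
  next
    case (insert J \<I>)
    have "\<exists>b>a. (\<forall>x. a < x \<and> x < b \<longrightarrow> x \<in> J) \<or> (\<forall>x. a < x \<and> x < b \<longrightarrow> x \<notin> J)"
    proof -
      have "point_or_open_interval J" using insert by simp
      then show ?thesis unfolding point_or_open_interval_def
      proof (elim disjE exE)
        fix p assume J: "J = {p}"
        obtain b where "a < b" using gt_ex by blast
        then show ?thesis using J by (cases "a < p") force+
      next
        fix p q assume J: "J = {p<..<q}"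
        obtain b where b: "a < b" using gt_ex by blast
        consider "a < p" | "p \<le> a" "a < q" | "q \<le> a" by (metis not_less)
        then show ?thesis
        proof cases
          case 2 then show ?thesis using J by (intro exI[of _ q]) auto
        next
          case 3 then show ?thesis using J b by (intro exI[of _ b]) auto
        qed (use J in force)
      next
        fix p assume J: "J = {p<..}"
        obtain b where "a < b" using gt_ex by blast
        then show ?thesis using J by (cases "a < p") force+
      next
        fix p assume J: "J = {..<p}"
        obtain b where "a < b" using gt_ex by blast
        then show ?thesis using J by (cases "a < p") force+
      next
        assume "J = UNIV"
        then show ?thesis using gt_ex by auto
      qed
    qed
    then obtain b where b: "a < b"
      "(\<forall>x. a < x \<and> x < b \<longrightarrow> x \<in> J) \<or> (\<forall>x. a < x \<and> x < b \<longrightarrow> x \<notin> J)" by blast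
    obtain c where c: "a < c"
      "(\<forall>x. a < x \<and> x < c \<longrightarrow> x \<in> \<Union>\<I>) \<or> (\<forall>x. a < x \<and> x < c \<longrightarrow> x \<notin> \<Union>\<I>)"
      using insert by auto
    show ?case by (rule exI[of _ "min b c"]) (use b c in auto)
  qed
  then show ?thesis using that I(3) by blast
qed

text \<open>The same argument at the lower end of the line, for sets without a lower bound.\<close>

lemma dset_germ_bot:
  assumes "dset S"
  obtains b where "(\<forall>x<b. x \<in> S) \<or> (\<forall>x<b. x \<notin> S)"
proof -
  obtain \<I> where I: "finite \<I>" "\<forall>J\<in>\<I>. point_or_open_interval J" "S = \<Union>\<I>"
    by (rule dset_pieces[OF assms(1)])
  from I(1,2) have "\<exists>b. (\<forall>x<b. x \<in> \<Union>\<I>) \<or> (\<forall>x<b. x \<notin> \<Union>\<I>)"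
  proof (induction \<I>)
    case empty
    then show ?case by auto
  next
    case (insert J \<I>)
    have "point_or_open_interval J" using insert by simp
    then have "\<exists>b. (\<forall>x<b. x \<in> J) \<or> (\<forall>x<b. x \<notin> J)"
      unfolding point_or_open_interval_def
    proof (elim disjE exE)
      fix a assume "J = {a}"
      then show ?thesis by (intro exI[of _ a]) auto
    next
      fix a b assume "J = {a<..<b}"
      then show ?thesis by (intro exI[of _ a]) auto
    next
      fix a assume "J = {a<..}"
      then show ?thesis by (intro exI[of _ a]) auto
    next
      fix a assume "J = {..<a}"
      then show ?thesis by (intro exI[of _ a]) auto
    qed auto
    then obtain b where b: "(\<forall>x<b. x \<in> J) \<or> (\<forall>x<b. x \<notin> J)" by blast
    obtain c where c: "(\<forall>x<c. x \<in> \<Union>\<I>) \<or> (\<forall>x<c. x \<notin> \<Union>\<I>)"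
      using insert by auto
    show ?case by (rule exI[of _ "min b c"]) (use b c in auto)
  qed
  then show ?thesis using that I(3) by blast
qed

section \<open>Preorders on the line and chains of finite sets\<close>

lemma dfn_rel: "dfn M (\<lambda>e. F (e 0) (e 1)) \<Longrightarrow> dt M t \<Longrightarrow> dt M s \<Longrightarrow> dfn M (\<lambda>e. F (t e) (s e))"
  by (rule dfn_subst2)

text \<open>
  Otherwise the \<open>x\<close> that are minimal in their own segment \<open>{y. E y x}\<close> contain an interval, on
  which \<open>E\<close> reverses the order.
\<close>

lemma preorder_infinite_segment:
  assumes U: "dset U" "infinite U" and E: "dfn M (\<lambda>e. E (e 0) (e 1))"
    and refl: "\<And>x. E x x" and trans: "\<And>x y z. E x y \<Longrightarrow> E y z \<Longrightarrow> E x z"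
    and total: "\<And>x y. E x y \<or> E y x"
  obtains x where "x \<in> U" "infinite {y \<in> U. E y x}"
proof (rule ccontr)
  assume "\<not> thesis"
  with that have fin: "finite {y \<in> U. E y x}" if "x \<in> U" for x using that by blast
  obtain a b where ab: "a < b" "{a<..<b} \<subseteq> U"
    by (rule dset_infinite[OF U])
  define V where "V = {x. a < x \<and> x < b \<and> (\<forall>y. a < y \<and> y < x \<longrightarrow> \<not> E y x)}"
  have "dset V" unfolding V_def by (intro dsetI dfn_intros dfn_rel[OF E])
  \<comment> \<open>The least point of the finite segment of \<open>x\<close> inside the interval
    has, by transitivity, no smaller point of the interval in its own segment.\<close>
  have below: "\<exists>z\<in>V. z \<le> x" if x: "a < x" "x < b" for x
  proof -
    let ?S = "{y. a < y \<and> y < b \<and> E y x}"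
    have f: "finite ?S" by (rule finite_subset[OF _ fin[of x]]) (use x ab(2) in auto)
    have "x \<in> ?S" using x refl by auto
    then have "?S \<noteq> {}" by blast
    from Min_in[OF f this] have "Min ?S \<in> ?S" .
    moreover have "Min ?S \<le> x" by (rule Min_le[OF f \<open>x \<in> ?S\<close>])
    moreover have "\<not> E y (Min ?S)" if y: "a < y" "y < Min ?S" for y
    proof
      assume "E y (Min ?S)"
      then have "y \<in> ?S" using y \<open>Min ?S \<in> ?S\<close> trans by force
      then show False using f y by (meson Min_le not_less)
    qed
    ultimately show ?thesis unfolding V_def by blast
  qed
  \<comment> \<open>\<open>V\<close> comes arbitrarily close to \<open>a\<close> without containing
    it.\<close>
  have "infinite V"
  proof
    assume f: "finite V"
    have "V \<noteq> {}" using below dense[OF ab(1)] by blast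
    then have "Min V \<in> V" using f by simp
    then have "a < Min V" "Min V < b" unfolding V_def by auto
    then obtain x where x: "a < x" "x < Min V" using dense by blast
    then have "x < b" using \<open>Min V < b\<close> by (rule_tac less_trans)
    then obtain z where "z \<in> V" "z \<le> x" using below x by blast
    then show False using f x by (meson Min_le not_less order_trans)
  qed
  then obtain c d where cd: "c < d" "{c<..<d} \<subseteq> V"
    by (rule dset_infinite[OF \<open>dset V\<close>])
  obtain x where x: "c < x" "x < d" using dense cd(1) by blast
  then have xV: "x \<in> V" using cd by auto
  \<comment> \<open>For \<open>x < y\<close> both in \<open>V\<close> the relation
    \<open>E x y\<close> fails, so \<open>E y x\<close> holds by totality; hence the segment of
    \<open>x\<close> contains a whole interval.\<close>
  have "{x<..<d} \<subseteq> {y \<in> U. E y x}"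
  proof
    fix y assume y: "y \<in> {x<..<d}"
    then have "y \<in> V" using cd x by auto
    then have "\<not> E x y" using xV y unfolding V_def by auto
    then show "y \<in> {y \<in> U. E y x}" using total ab \<open>y \<in> V\<close> unfolding V_def by auto
  qed
  moreover have "finite {y \<in> U. E y x}" using fin xV ab(2) unfolding V_def by auto
  ultimately show False using x(2) infinite_Ioo infinite_super by blast
qed

text \<open>Compare points by the indices \<open>p\<close> whose set contains them. This preorder is
  total because the sets form a chain, and an infinite segment below \<open>x\<close> would lie
  inside every set that contains \<open>x\<close>.\<close>

lemma finite_chain_union:
  assumes F: "dfn M (\<lambda>e. F (e 0) (e 1))"
    and chain: "\<And>p q. (\<forall>x. F p x \<longrightarrow> F q x) \<or> (\<forall>x. F q x \<longrightarrow> F p x)"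
    and fin: "\<And>p. finite {x. F p x}"
  shows "finite {x. \<exists>p. F p x}"
proof (rule ccontr)
  assume inf: "infinite {x. \<exists>p. F p x}"
  define E where "E y x \<longleftrightarrow> (\<forall>p. F p x \<longrightarrow> F p y)" for x y
  have "dfn M (\<lambda>e. E (e 0) (e 1))" unfolding E_def by (intro dfn_intros dfn_rel[OF F])
  moreover have "dset {x. \<exists>p. F p x}" by (intro dsetI dfn_intros dfn_rel[OF F])
  moreover have "E x y \<or> E y x" for x y unfolding E_def using chain by blast
  moreover have "E x x" "E x y \<Longrightarrow> E y z \<Longrightarrow> E x z" for x y z unfolding E_def by blast+
  ultimately obtain x where "x \<in> {x. \<exists>p. F p x}" and
    inf: "infinite {y \<in> {x. \<exists>p. F p x}. E y x}"
    using preorder_infinite_segment[OF _ inf] by blast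
  then obtain p where "F p x" by blast
  then have "{y \<in> {x. \<exists>p. F p x}. E y x} \<subseteq> {y. F p y}" unfolding E_def by blast
  then show False using fin[of p] inf infinite_super by blast
qed

end

section \<open>Exchange of quantifiers\<close>

context omin
begin

text \<open>
  The fibres \<open>{y. A x y}\<close> contain intervals, infinitely many of them of a common length \<open>d\<close>
  and with left end points accumulating at some \<open>c\<close>; these contain a common point.
\<close>

lemma infinite_swap:
  assumes A: "dfn M (\<lambda>e. A (e 0) (e 1))" and inf: "infinite {x. infinite {y. A x y}}"
  shows "infinite {y. infinite {x. A x y}}"
proof
  assume finY: "finite {y. infinite {x. A x y}}"
  \<comment> \<open>Removing the finitely many exceptional \<open>y\<close> makes every
    \<open>{x. B x y}\<close> finite, while infinitely many \<open>{y. B x y}\<close> remain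
    infinite.\<close>
  define B where "B x y \<longleftrightarrow> A x y \<and> \<not> infinite {x. A x y}" for x y
  note dA = dfn_rel[OF A]
  have dB: "dfn M (\<lambda>e. B (t e) (s e))" if "dt M t" "dt M s" for t s
    by (rule dfn_rel[OF _ that], unfold B_def) (intro dfn_intros dA)
  have finB: "finite {x. B x y}" for y
    by (cases "infinite {x. A x y}") (simp_all add: B_def)
  define P where "P d y x \<longleftrightarrow> (\<forall>z. y < z \<and> z < y + d \<longrightarrow> B x z)" for d y x
  have dP: "dfn M (\<lambda>e. P (d e) (y e) (x e))" if "dt M d" "dt M y" "dt M x" for d y x
    unfolding P_def by (intro dfn_intros dB dt_shift[OF that(1)] dt_shift[OF that(2)] dt_shift[OF that(3)])
  \<comment> \<open>A shorter length admits more \<open>x\<close>, so these sets of \<open>x\<close>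
    form a chain indexed by \<open>d\<close>. If all of them were finite, their union would be, but
    it contains every \<open>x\<close> with an infinite fibre.\<close>
  obtain d where d: "0 < d" "infinite {x. \<exists>y. P d y x}"
  proof (rule ccontr)
    assume "\<not> thesis"
    then have fin: "finite {x. 0 < d \<and> (\<exists>y. P d y x)}" for d using that by (cases "0 < d") auto
    have "finite {x. \<exists>d. 0 < d \<and> (\<exists>y. P d y x)}"
    proof (rule finite_chain_union[OF _ _ fin])
      show "dfn M (\<lambda>e. 0 < e 0 \<and> (\<exists>y. P (e 0) y (e 1)))" by (intro dfn_intros dP)
      have *: "P d' y x" if "d' \<le> d" "P d y x" for d d' y x
      proof -
        have "y + d' \<le> y + d" using that(1) by simp
        then have "z < y + d" if "z < y + d'" for z using that by (rule_tac less_le_trans)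
        then show ?thesis using that(2) unfolding P_def by blast
      qed
      show "(\<forall>x. 0 < d \<and> (\<exists>y. P d y x) \<longrightarrow> 0 < d' \<and> (\<exists>y. P d' y x)) \<or>
          (\<forall>x. 0 < d' \<and> (\<exists>y. P d' y x) \<longrightarrow> 0 < d \<and> (\<exists>y. P d y x))" for d d'
      proof (cases "0 < d \<and> 0 < d'")
        case True
        show ?thesis using linear[of d d'] * True by blast
      qed blast
    qed
    moreover have "{x. infinite {y. A x y}} \<subseteq> {x. \<exists>d. 0 < d \<and> (\<exists>y. P d y x)}"
    proof
      fix x assume "x \<in> {x. infinite {y. A x y}}"
      then have "infinite ({y. A x y} - {y. infinite {x. A x y}})" using finY by (simp add: Diff_infinite_finite)
      moreover have "{y. A x y} - {y. infinite {x. A x y}} = {y. B x y}" by (auto simp: B_def)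
      ultimately have i: "infinite {y. B x y}" by simp
      have "dset {y. B x y}" by (intro dsetI dB dfn_intros)
      then obtain a b where "a < b" "{a<..<b} \<subseteq> {y. B x y}" using i by (rule dset_infinite)
      then have "P (- a + b) a x" "0 < - a + b" using add_less(1)[of a 0 "- a + b"]
        unfolding P_def by auto
      then show "x \<in> {x. \<exists>d. 0 < d \<and> (\<exists>y. P d y x)}" by blast
    qed
    ultimately show False using inf finite_subset by blast
  qed
  \<comment> \<open>The same chain argument confines the left end points \<open>y\<close> to
    \<open>y \<le> T\<close>, and below to \<open>L \<le> y\<close>, still for infinitely many
    \<open>x\<close>.\<close>
  obtain T where T: "infinite {x. \<exists>y. y \<le> T \<and> P d y x}"
  proof (rule ccontr)
    assume "\<not> thesis"
    then have fin: "finite {x. \<exists>y. y \<le> T \<and> P d y x}" for T using that by blast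
    have "finite {x. \<exists>T. \<exists>y. y \<le> T \<and> P d y x}"
    proof (rule finite_chain_union[OF _ _ fin])
      show "dfn M (\<lambda>e. \<exists>y. y \<le> e 0 \<and> P d y (e 1))" by (intro dfn_intros dP)
      show "(\<forall>x. (\<exists>y. y \<le> p \<and> P d y x) \<longrightarrow> (\<exists>y. y \<le> q \<and> P d y x)) \<or>
          (\<forall>x. (\<exists>y. y \<le> q \<and> P d y x) \<longrightarrow> (\<exists>y. y \<le> p \<and> P d y x))" for p q
        by (meson linear order_trans)
    qed
    moreover have "{x. \<exists>T. \<exists>y. y \<le> T \<and> P d y x} = {x. \<exists>y. P d y x}" by auto
    ultimately show False using d(2) by simp
  qed
  obtain L where L: "infinite {x. \<exists>y. L \<le> y \<and> y \<le> T \<and> P d y x}"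
  proof (rule ccontr)
    assume "\<not> thesis"
    then have fin: "finite {x. \<exists>y. L \<le> y \<and> y \<le> T \<and> P d y x}" for L using that by blast
    have "finite {x. \<exists>L. \<exists>y. L \<le> y \<and> y \<le> T \<and> P d y x}"
    proof (rule finite_chain_union[OF _ _ fin])
      show "dfn M (\<lambda>e. \<exists>y. e 0 \<le> y \<and> y \<le> T \<and> P d y (e 1))" by (intro dfn_intros dP)
      show "(\<forall>x. (\<exists>y. p \<le> y \<and> y \<le> T \<and> P d y x) \<longrightarrow> (\<exists>y. q \<le> y \<and> y \<le> T \<and> P d y x)) \<or>
          (\<forall>x. (\<exists>y. q \<le> y \<and> y \<le> T \<and> P d y x) \<longrightarrow> (\<exists>y. p \<le> y \<and> y \<le> T \<and> P d y x))" for p q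
        by (meson linear order_trans)
    qed
    moreover have "{x. \<exists>L. \<exists>y. L \<le> y \<and> y \<le> T \<and> P d y x} = {x. \<exists>y. y \<le> T \<and> P d y x}" by auto
    ultimately show False using T by simp
  qed
  \<comment> \<open>The left end points accumulate at the infimum \<open>c\<close> of those
    \<open>q\<close> for which infinitely many \<open>x\<close> have an interval that starts in
    \<open>[L, q]\<close>.\<close>
  define K where "K q = {x. \<exists>y. L \<le> y \<and> y \<le> q \<and> P d y x}" for q
  have "dset {q. infinite (K q)}" unfolding K_def by (intro dsetI dfn_intros dP)
  moreover have "T \<in> {q. infinite (K q)}" using L unfolding K_def by simp
  moreover have "L \<le> q" if "q \<in> {q. infinite (K q)}" for q
  proof -
    have "K q \<noteq> {}" using that by auto
    then show ?thesis unfolding K_def by auto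
  qed
  ultimately obtain c where c: "\<forall>q\<in>{q. infinite (K q)}. c \<le> q"
    "\<forall>c'. (\<forall>q\<in>{q. infinite (K q)}. c' \<le> q) \<longrightarrow> c' \<le> c"
    by (rule dset_glb)
  have "c < c + d" using add_less(1)[of c 0 d] d(1) by simp
  then obtain z where z: "c < z" "z < c + d" using dense by blast
  then obtain c'' where c'': "c < c''" "c'' < z" using dense by blast
  \<comment> \<open>An interval of length \<open>d\<close> that starts after \<open>c'\<close> and
    not after \<open>c''\<close> contains \<open>z\<close>. As \<open>c' < c < c''\<close>, such
    intervals occur for infinitely many \<open>x\<close>, contradicting the finiteness of
    \<open>{x. B x z}\<close>.\<close>
  define c' where "c' = z - d"
  have c'd: "c' + d = z" unfolding c'_def by simp
  have "c' < c" using add_less(2)[of c' d c] z(2) unfolding c'd by simp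
  then have "finite (K c')" using c(1) not_less by blast
  moreover have "infinite (K c'')"
  proof -
    obtain q where q: "infinite (K q)" "q < c''" using c(2) c''(1) by (meson mem_Collect_eq not_le)
    then have "K q \<subseteq> K c''" unfolding K_def by (auto intro: order_trans less_imp_le)
    then show ?thesis using q(1) infinite_super by blast
  qed
  ultimately have "infinite (K c'' - K c')" by (simp add: Diff_infinite_finite)
  moreover have "K c'' - K c' \<subseteq> {x. B x z}"
  proof
    fix x assume x: "x \<in> K c'' - K c'"
    then obtain y where y: "L \<le> y" "y \<le> c''" "P d y x" unfolding K_def by blast
    have "\<not> y \<le> c'" using x y unfolding K_def by blast
    then have "c' < y" by simp
    then have "z < y + d" using c'd by (metis add_less(2))
    moreover have "y < z" using y(2) c''(2) by simp
    ultimately show "x \<in> {x. B x z}" using y(3) unfolding P_def by blast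
  qed
  ultimately show False using finB[of z] infinite_super by blast
qed

text \<open>A substitute for having full dimension \<open>d\<close>, obtained by iterating
  "infinitely many" with the first coordinate outermost; for definable \<open>P\<close> this stays
  definable.\<close>

primrec Large :: "nat \<Rightarrow> ('a list \<Rightarrow> bool) \<Rightarrow> bool" where
  "Large 0 P \<longleftrightarrow> P []"
| "Large (Suc d) P \<longleftrightarrow> infinite {x. Large d (\<lambda>l. P (x # l))}"

lemma Large_mono:
  "Large d P \<Longrightarrow> (\<And>l. length l = d \<Longrightarrow> P l \<Longrightarrow> Q l) \<Longrightarrow> Large d Q"
proof (induction d arbitrary: P Q)
  case (Suc d)
  have "{x. Large d (\<lambda>l. P (x # l))} \<subseteq> {x. Large d (\<lambda>l. Q (x # l))}"
  proof
    fix x assume "x \<in> {x. Large d (\<lambda>l. P (x # l))}"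
    then have "Large d (\<lambda>l. P (x # l))" by simp
    then have "Large d (\<lambda>l. Q (x # l))" by (rule Suc.IH) (simp add: Suc.prems(2))
    then show "x \<in> {x. Large d (\<lambda>l. Q (x # l))}" by simp
  qed
  then show ?case using Suc.prems(1) infinite_super by auto
qed simp

lemma Large_ex: "Large d P \<Longrightarrow> \<exists>l. length l = d \<and> P l"
proof (induction d arbitrary: P)
  case (Suc d)
  then have "{x. Large d (\<lambda>l. P (x # l))} \<noteq> {}" by (metis Large.simps(2) finite.emptyI)
  then obtain x where "Large d (\<lambda>l. P (x # l))" by blast
  from Suc.IH[OF this] obtain l where "length l = d" "P (x # l)" by blast
  then show ?case by (intro exI[of _ "x # l"]) simp
qed simp

lemma dfn_list:
  assumes P: "dfn M (\<lambda>e. P (\<lambda>i. e (i + k)) (map (\<lambda>i. e i) [0..<k]))"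
    and \<sigma>: "dte M \<sigma>" and f: "dtl M k f"
  shows "dfn M (\<lambda>e. P (\<sigma> e) (f e))"
proof -
  have "dt M (\<lambda>e. if i < k then f e ! i else \<sigma> e (i - k))" for i
    using dtl_nth[OF f] dte_app[OF \<sigma>] by (cases "i < k") simp_all
  then have "dte M (\<lambda>e i. if i < k then f e ! i else \<sigma> e (i - k))" unfolding dte_def by blast
  from dfn_subst[OF P this]
  have "dfn M (\<lambda>e. P (\<sigma> e) (map (\<lambda>i. if i < k then f e ! i else \<sigma> e (i - k)) [0..<k]))"
    by simp
  moreover have "map (\<lambda>i. if i < k then f e ! i else \<sigma> e (i - k)) [0..<k] = f e" for e
    using f unfolding dtl_def by (auto simp: list_eq_iff_nth_eq)
  ultimately show ?thesis by (simp only:)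
qed

text \<open>The hypothesis allows arbitrary substitutions so that the induction can pass to fibres:
  the first coordinate is moved into the assignment as variable 0 (see \<open>P'\<close>).\<close>

lemma dfn_Large_aux:
  assumes "\<forall>\<sigma> f. dte M \<sigma> \<longrightarrow> dtl M d f \<longrightarrow> dfn M (\<lambda>e. P (\<sigma> e) (f e))" "dte M \<sigma>"
  shows "dfn M (\<lambda>e. Large d (P (\<sigma> e)))"
  using assms
proof (induction d arbitrary: P \<sigma>)
  case 0
  then have "dfn M (\<lambda>e. P (\<sigma> e) [])" using dtl_Nil[of M] by blast
  then show ?case by simp
next
  case (Suc d)
  define P' where "P' e l = P (\<lambda>i. e (Suc i)) (e 0 # l)" for e l
  have 1: "\<forall>\<sigma> f. dte M \<sigma> \<longrightarrow> dtl M d f \<longrightarrow> dfn M (\<lambda>e. P' (\<sigma> e) (f e))"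
  proof (intro allI impI)
    fix \<sigma> f assume \<sigma>: "dte M \<sigma>" and f: "dtl M d f"
    have "dte M (\<lambda>e i. \<sigma> e (Suc i))" using \<sigma> unfolding dte_def by blast
    moreover have "dtl M (Suc d) (\<lambda>e. \<sigma> e 0 # f e)" by (intro dtl_Cons f dte_app[OF \<sigma>])
    ultimately show "dfn M (\<lambda>e. P' (\<sigma> e) (f e))" unfolding P'_def using Suc.prems(1) by blast
  qed
  have 2: "dte M (\<lambda>e. case_nat (e 0) (\<sigma> (\<lambda>i. e (Suc i))))"
    by (intro dte_case dt_var dte_shift[OF Suc.prems(2)])
  have "dfn M (\<lambda>e. infinite {x. Large d (\<lambda>l. P (\<sigma> e) (x # l))})"
    by (rule dfn_infinite) (use Suc.IH[OF 1 2] in \<open>simp add: P'_def\<close>)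
  then show ?case by simp
qed

lemma dfn_Large [dfn_intros]:
  assumes "dfn M (\<lambda>e. P (\<lambda>i. e (i + d)) (map (\<lambda>i. e i) [0..<d]))"
  shows "dfn M (\<lambda>e. Large d (\<lambda>l. P e l))"
  using dfn_Large_aux[of d P "\<lambda>e. e"] dfn_list[OF assms] dte_id(1) by blast

text \<open>\<open>infinite_swap\<close> moves the quantifier over \<open>x\<close> past the first
  coordinate; over each value of that coordinate the induction hypothesis moves it past the
  others.\<close>

lemma Large_swap:
  assumes "\<forall>t f. dt M t \<longrightarrow> dtl M d f \<longrightarrow> dfn M (\<lambda>e. P (t e) (f e))"
    "infinite {x. Large d (P x)}"
  shows "Large d (\<lambda>l. infinite {x. P x l})"
  using assms
proof (induction d arbitrary: P)
  case 0
  then show ?case by simp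
next
  case (Suc d)
  have dP: "dfn M (\<lambda>e. P (t e) (f e))" if "dt M t" "dtl M (Suc d) f" for t f
    using Suc.prems(1) that by blast
  have "dfn M (\<lambda>e. Large d (\<lambda>l. P (e 0) (e 1 # l)))" by (intro dfn_intros dP)
  moreover have "infinite {x. infinite {y. Large d (\<lambda>l. P x (y # l))}}"
    using Suc.prems(2) by simp
  ultimately have "infinite {y. infinite {x. Large d (\<lambda>l. P x (y # l))}}"
    by (rule infinite_swap)
  moreover have "{y. infinite {x. Large d (\<lambda>l. P x (y # l))}} \<subseteq>
      {y. Large d (\<lambda>l. infinite {x. P x (y # l)})}"
  proof
    fix y assume "y \<in> {y. infinite {x. Large d (\<lambda>l. P x (y # l))}}"
    then have y: "infinite {x. Large d (\<lambda>l. P x (y # l))}" by simp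
    have "Large d (\<lambda>l. infinite {x. P x (y # l)})"
      by (rule Suc.IH[OF _ y]) (intro allI impI dP dtl_Cons dt_const)
    then show "y \<in> {y. Large d (\<lambda>l. infinite {x. P x (y # l)})}" by simp
  qed
  ultimately show ?case using infinite_super by auto
qed

lemma dt_hd: "dtl M (Suc k) f \<Longrightarrow> dt M (\<lambda>e. hd (f e))"
proof -
  assume f: "dtl M (Suc k) f"
  then have "f e \<noteq> []" for e unfolding dtl_def by (metis length_0_conv nat.distinct(1))
  then have "hd (f e) = f e ! 0" for e by (simp add: hd_conv_nth)
  then show ?thesis using dtl_nth[OF f, of 0] by simp
qed

lemma dtl_tl: "dtl M (Suc k) f \<Longrightarrow> dtl M k (\<lambda>e. tl (f e))"
  unfolding dtl_def by (simp add: nth_tl)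

end

section \<open>Covers of a directed set by bounded sets\<close>

text \<open>In the application \<open>\<Omega>\<close> indexes the basic open sets around a point
  and \<open>le\<close> is inclusion, so lower bounds are finer neighbourhoods. Distinct indices may
  give the same set, hence only a preorder.\<close>

locale directed_in_omin = omin M
  for M :: "('f, 'r, 'a::{group_add, unbounded_dense_linorder}) expansion" +
  fixes m :: nat and \<Omega> :: "'a list set" and le :: "'a list \<Rightarrow> 'a list \<Rightarrow> bool"
  assumes len: "u \<in> \<Omega> \<Longrightarrow> length u = m"
    and d\<Omega>: "dtl M m f \<Longrightarrow> dfn M (\<lambda>e. f e \<in> \<Omega>)"
    and dle: "dtl M m f \<Longrightarrow> dtl M m g \<Longrightarrow> dfn M (\<lambda>e. le (f e) (g e))"
    and le_refl: "le u u"
    and le_trans: "le u v \<Longrightarrow> le v w \<Longrightarrow> le u w"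
    and directed: "u \<in> \<Omega> \<Longrightarrow> v \<in> \<Omega> \<Longrightarrow> \<exists>w\<in>\<Omega>. le w u \<and> le w v"
    and nonempty: "\<Omega> \<noteq> {}"
begin

text \<open>Bounded means having a lower bound in \<open>\<Omega>\<close>. By directedness the
  bounded predicates form an ideal, closed under finite unions.\<close>

definition bdd :: "('a list \<Rightarrow> bool) \<Rightarrow> bool" where
  "bdd S \<longleftrightarrow> (\<exists>w\<in>\<Omega>. \<forall>u\<in>\<Omega>. S u \<longrightarrow> le w u)"

lemma bdd_mono: "bdd S \<Longrightarrow> (\<And>u. u \<in> \<Omega> \<Longrightarrow> R u \<Longrightarrow> S u) \<Longrightarrow> bdd R"
  unfolding bdd_def by blast

lemma bdd_empty: "bdd (\<lambda>u. False)"
  unfolding bdd_def using nonempty by blast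

lemma bdd_disj: "bdd S \<Longrightarrow> bdd R \<Longrightarrow> bdd (\<lambda>u. S u \<or> R u)"
  unfolding bdd_def
proof (elim bexE)
  fix w v assume w: "w \<in> \<Omega>" "\<forall>u\<in>\<Omega>. S u \<longrightarrow> le w u" and v: "v \<in> \<Omega>" "\<forall>u\<in>\<Omega>. R u \<longrightarrow> le v u"
  from directed[OF w(1) v(1)] obtain z where "z \<in> \<Omega>" "le z w" "le z v" by blast
  then show "\<exists>w\<in>\<Omega>. \<forall>u\<in>\<Omega>. S u \<or> R u \<longrightarrow> le w u"
    using w(2) v(2) le_trans[of z w] le_trans[of z v] by blast
qed

lemma bdd_finite: "finite A \<Longrightarrow> (\<And>a. a \<in> A \<Longrightarrow> bdd (S a)) \<Longrightarrow> bdd (\<lambda>u. \<exists>a\<in>A. S a u)"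
proof (induction A rule: finite_induct)
  case empty
  then show ?case using bdd_empty by simp
next
  case (insert a A)
  then have "bdd (\<lambda>u. S a u \<or> (\<exists>a\<in>A. S a u))" by (intro bdd_disj) auto
  then show ?case by simp
qed

lemma dfn_bex [dfn_intros]:
  assumes "dfn M (\<lambda>e. P (\<lambda>i. e (i + m)) (map (\<lambda>i. e i) [0..<m]))"
  shows "dfn M (\<lambda>e. \<exists>u\<in>\<Omega>. P e u)"
proof -
  have "dfn M (\<lambda>e. \<exists>u. length u = m \<and> u \<in> \<Omega> \<and> P e u)"
    by (intro dfn_list_ex dfn_conj d\<Omega> dtl_map dt_var assms)
  moreover have "(\<exists>u. length u = m \<and> u \<in> \<Omega> \<and> P e u) \<longleftrightarrow> (\<exists>u\<in>\<Omega>. P e u)" for e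
    using len by blast
  ultimately show ?thesis by (simp only:)
qed

lemma dfn_ball [dfn_intros]:
  assumes "dfn M (\<lambda>e. P (\<lambda>i. e (i + m)) (map (\<lambda>i. e i) [0..<m]))"
  shows "dfn M (\<lambda>e. \<forall>u\<in>\<Omega>. P e u)"
proof -
  have "dfn M (\<lambda>e. \<not> (\<exists>u\<in>\<Omega>. \<not> P e u))" by (intro dfn_neg dfn_bex assms)
  then show ?thesis by simp
qed

lemma dfn_bdd [dfn_intros]:
  assumes "dfn M (\<lambda>e. S (\<lambda>i. e (i + m)) (map (\<lambda>i. e i) [0..<m]))"
  shows "dfn M (\<lambda>e. bdd (\<lambda>u. S e u))"
  unfolding bdd_def by (intro dfn_intros d\<Omega> dle dfn_list[OF assms])

text \<open>
  If \<open>N\<close> is not large in \<open>R\<^sup>k\<^sup>+\<^sup>1\<close>, then somewhere along each branch only finitely many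
  values of a coordinate are allowed. Dropping that coordinate merges finitely many
  of the sets \<open>C y\<close>, which keeps them bounded; so \<open>{C y : y \<in> N}\<close> is covered by a
  bounded family indexed by \<open>R\<^sup>k\<close>.
\<close>

primrec collapse :: "nat \<Rightarrow> ('a list \<Rightarrow> bool) \<Rightarrow> ('a list \<Rightarrow> 'a list \<Rightarrow> bool) \<Rightarrow> 'a list \<Rightarrow> 'a list \<Rightarrow> bool" where
  "collapse 0 N C l u \<longleftrightarrow> (\<exists>z. N [z] \<and> C [z] u)"
| "collapse (Suc k) N C l u \<longleftrightarrow>
    (\<exists>z. Large (Suc k) (\<lambda>l'. N (z # l')) \<and> C (z # l) u) \<or>
    (\<not> Large (Suc k) (\<lambda>l'. N (hd l # l')) \<and>
      collapse k (\<lambda>l'. N (hd l # l')) (\<lambda>l'. C (hd l # l')) (tl l) u)"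

text \<open>If \<open>N\<close> is not large, only finitely many first coordinates have a large
  fibre, and merging over these is a finite union. Over any other first coordinate the fibre is
  again not large and the induction hypothesis applies.\<close>

lemma collapse_bdd:
  assumes "\<not> Large (Suc k) N" "\<And>y. length y = Suc k \<Longrightarrow> bdd (C y)" "length l = k"
  shows "bdd (collapse k N C l)"
  using assms
proof (induction k arbitrary: N C l)
  case 0
  then have "bdd (\<lambda>u. \<exists>z\<in>{z. N [z]}. C [z] u)" by (intro bdd_finite) auto
  then show ?case by (rule bdd_mono) auto
next
  case (Suc k)
  have "bdd (\<lambda>u. \<exists>z\<in>{z. Large (Suc k) (\<lambda>l'. N (z # l'))}. C (z # l) u)"
    by (rule bdd_finite) (use Suc.prems in auto)
  moreover have "bdd (\<lambda>u. \<not> Large (Suc k) (\<lambda>l'. N (hd l # l')) \<and>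
      collapse k (\<lambda>l'. N (hd l # l')) (\<lambda>l'. C (hd l # l')) (tl l) u)"
  proof (cases "Large (Suc k) (\<lambda>l'. N (hd l # l'))")
    case True
    then show ?thesis using bdd_empty by simp
  next
    case False
    have "bdd (collapse k (\<lambda>l'. N (hd l # l')) (\<lambda>l'. C (hd l # l')) (tl l))"
      by (rule Suc.IH[OF False]) (use Suc.prems in auto)
    then show ?thesis by (rule bdd_mono) simp
  qed
  ultimately have "bdd (\<lambda>u. (\<exists>z\<in>{z. Large (Suc k) (\<lambda>l'. N (z # l'))}. C (z # l) u) \<or>
    \<not> Large (Suc k) (\<lambda>l'. N (hd l # l')) \<and>
      collapse k (\<lambda>l'. N (hd l # l')) (\<lambda>l'. C (hd l # l')) (tl l) u)" by (rule bdd_disj)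
  then show ?case by (rule bdd_mono) (unfold collapse.simps, blast)
qed

text \<open>From \<open>y\<close> drop the first coordinate after which the fibre of
  \<open>N\<close> is large; if there is none, drop the last coordinate.\<close>

lemma collapse_cover:
  assumes "N y" "length y = Suc k" "C y u"
  shows "\<exists>l. length l = k \<and> collapse k N C l u"
  using assms
proof (induction k arbitrary: N C y)
  case 0
  then obtain z where "y = [z]" by (metis length_0_conv length_Suc_conv)
  then show ?case using 0 by auto
next
  case (Suc k)
  then obtain x y' where y: "y = x # y'" "length y' = Suc k" by (metis length_Suc_conv)
  show ?case
  proof (cases "Large (Suc k) (\<lambda>l'. N (x # l'))")
    case True
    have "collapse (Suc k) N C y' u" unfolding collapse.simps
      by (intro disjI1 exI[of _ x] conjI True) (use Suc.prems y in simp)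
    then show ?thesis using y(2) by blast
  next
    case False
    have "\<exists>l. length l = k \<and> collapse k (\<lambda>l'. N (x # l')) (\<lambda>l'. C (x # l')) l u"
      by (rule Suc.IH[of _ y']) (use Suc.prems y in simp_all)
    then obtain l where l: "length l = k" "collapse k (\<lambda>l'. N (x # l')) (\<lambda>l'. C (x # l')) l u" by blast
    have "collapse (Suc k) N C (x # l) u" unfolding collapse.simps list.sel
      by (intro disjI2 conjI False l(2))
    then show ?thesis using l(1) by (intro exI[of _ "x # l"]) simp
  qed
qed

text \<open>As in \<open>dfn_Large_aux\<close>, the head of the list is moved into the assignment,
  so that fibres of \<open>N\<close> and \<open>C\<close> are again families with
  parameters.\<close>

lemma collapse_dfn:
  assumes "\<forall>\<sigma> f. dte M \<sigma> \<longrightarrow> dtl M (Suc k) f \<longrightarrow> dfn M (\<lambda>e. N (\<sigma> e) (f e))"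
    "\<forall>\<sigma> f g. dte M \<sigma> \<longrightarrow> dtl M (Suc k) f \<longrightarrow> dtl M m g \<longrightarrow> dfn M (\<lambda>e. C (\<sigma> e) (f e) (g e))"
    and "dte M \<sigma>" "dtl M k f" "dtl M m g"
  shows "dfn M (\<lambda>e. collapse k (N (\<sigma> e)) (C (\<sigma> e)) (f e) (g e))"
  using assms
proof (induction k arbitrary: N C \<sigma> f)
  case 0
  have N: "dfn M (\<lambda>e. N (\<sigma> e) (f e))" if "dte M \<sigma>" "dtl M (Suc 0) f" for \<sigma> f
    using 0(1) that by blast
  have C: "dfn M (\<lambda>e. C (\<sigma> e) (f e) (g e))" if "dte M \<sigma>" "dtl M (Suc 0) f" "dtl M m g" for \<sigma> f g
    using 0(2) that by blast
  show ?case unfolding collapse.simps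
    by (intro dfn_intros N C dte_shift[OF 0(3)] dtl_shift[OF 0(5)])
next
  case (Suc k)
  have N: "dfn M (\<lambda>e. N (\<sigma> e) (f e))" if "dte M \<sigma>" "dtl M (Suc (Suc k)) f" for \<sigma> f
    using Suc.prems(1) that by blast
  have C: "dfn M (\<lambda>e. C (\<sigma> e) (f e) (g e))"
    if "dte M \<sigma>" "dtl M (Suc (Suc k)) f" "dtl M m g" for \<sigma> f g
    using Suc.prems(2) that by blast
  note \<sigma> = Suc.prems(3) and f = Suc.prems(4) and g = Suc.prems(5)
  have *: "dte M (\<lambda>e. case_nat (hd (f e)) (\<sigma> e))" by (intro dte_case dt_hd[OF f] \<sigma>)
  have "dfn M (\<lambda>e. collapse k (\<lambda>l'. N (\<lambda>i. (case_nat (hd (f e)) (\<sigma> e)) (Suc i)) ((case_nat (hd (f e)) (\<sigma> e)) 0 # l'))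
     (\<lambda>l'. C (\<lambda>i. (case_nat (hd (f e)) (\<sigma> e)) (Suc i)) ((case_nat (hd (f e)) (\<sigma> e)) 0 # l')) (tl (f e)) (g e))"
  proof (rule Suc.IH[of "\<lambda>e l'. N (\<lambda>i. e (Suc i)) (e 0 # l')" "\<lambda>e l'. C (\<lambda>i. e (Suc i)) (e 0 # l')",
        OF _ _ * dtl_tl[OF f] g], goal_cases)
    case 1
    show ?case
    proof (intro allI impI N dtl_Cons)
      fix \<sigma> f assume "dte M \<sigma>"
      then show "dte M (\<lambda>e i. \<sigma> e (Suc i))" "dt M (\<lambda>e. \<sigma> e 0)" unfolding dte_def by blast+
    qed
  next
    case 2
    show ?case
    proof (intro allI impI C dtl_Cons)
      fix \<sigma> f assume "dte M \<sigma>"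
      then show "dte M (\<lambda>e i. \<sigma> e (Suc i))" "dt M (\<lambda>e. \<sigma> e 0)" unfolding dte_def by blast+
    qed
  qed
  then have r: "dfn M (\<lambda>e. collapse k (\<lambda>l'. N (\<sigma> e) (hd (f e) # l')) (\<lambda>l'. C (\<sigma> e) (hd (f e) # l')) (tl (f e)) (g e))"
    by simp
  show ?case unfolding collapse.simps
    by (intro dfn_disj dfn_conj dfn_neg dfn_ex r dfn_Large C N dtl_Cons dtl_map dt_var
      dte_shift[OF \<sigma>] dtl_shift[OF f] dtl_shift[OF g] dt_shift[OF dt_hd[OF f]])
qed

text \<open>The covers by bounded upward closed sets \<open>C y\<close>, \<open>y\<close> in
  \<open>R^d\<close>, whose number \<open>d\<close> of parameters is to be minimised.\<close>

definition cofinal_system :: "nat \<Rightarrow> ('a list \<Rightarrow> 'a list \<Rightarrow> bool) \<Rightarrow> bool" where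
  "cofinal_system d C \<longleftrightarrow>
    (\<forall>f g. dtl M d f \<longrightarrow> dtl M m g \<longrightarrow> dfn M (\<lambda>e. C (f e) (g e))) \<and>
    (\<forall>y u v. C y u \<longrightarrow> le u v \<longrightarrow> C y v) \<and>
    (\<forall>y. length y = d \<longrightarrow> bdd (C y)) \<and>
    (\<forall>u\<in>\<Omega>. \<exists>y. length y = d \<and> C y u)"

text \<open>Take \<open>d\<close> minimal and suppose that the \<open>y\<close> with
  \<open>C y u0\<close> are not large. Every \<open>u\<close> has some \<open>v\<close> below both
  \<open>u\<close> and \<open>u0\<close>; a set \<open>C y\<close> containing \<open>v\<close> also
  contains \<open>u0\<close>. So the \<open>C y\<close> with \<open>C y u0\<close> suffice to reach
  below every \<open>u\<close>, and collapsing them saves one parameter.\<close>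

lemma large_cofinal_system:
  obtains d C where "cofinal_system d C" "\<forall>u\<in>\<Omega>. Large d (\<lambda>y. C y u)"
proof -
  \<comment> \<open>The cones above points of \<open>\<Omega>\<close>; the clause
    \<open>y \<in> \<Omega>\<close> makes the cone empty, hence bounded, for all other
    lists.\<close>
  have 0: "cofinal_system m (\<lambda>y u. y \<in> \<Omega> \<and> le y u)"
    unfolding cofinal_system_def
  proof (intro conjI allI impI)
    show "bdd (\<lambda>u. y \<in> \<Omega> \<and> le y u)" for y
      using bdd_empty unfolding bdd_def by (cases "y \<in> \<Omega>") auto
    show "\<forall>u\<in>\<Omega>. \<exists>y. length y = m \<and> y \<in> \<Omega> \<and> le y u"
      using le_refl len by blast
  qed (auto intro: dfn_conj d\<Omega> dle le_trans)
  define d where "d = (LEAST d. \<exists>C. cofinal_system d C)"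
  have "\<exists>C. cofinal_system d C"
    unfolding d_def by (rule LeastI[of _ m]) (rule exI, rule 0)
  then obtain C where C: "cofinal_system d C" by blast
  have min: "\<not> cofinal_system k C'" if "k < d" for k C'
    using not_less_Least[of k "\<lambda>d. \<exists>C. cofinal_system d C"] that unfolding d_def by blast
  have dC: "dfn M (\<lambda>e. C (f e) (g e))" if "dtl M d f" "dtl M m g" for f g
    using C that unfolding cofinal_system_def by blast
  have up: "C y v" if "C y u" "le u v" for y u v
    using C that unfolding cofinal_system_def by blast
  have bC: "bdd (C y)" if "length y = d" for y
    using C that unfolding cofinal_system_def by blast
  have cov: "\<exists>y. length y = d \<and> C y u" if "u \<in> \<Omega>" for u
    using C that unfolding cofinal_system_def by blast
  have "Large d (\<lambda>y. C y u0)" if u0: "u0 \<in> \<Omega>" for u0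
  proof (rule ccontr)
    assume not: "\<not> Large d (\<lambda>y. C y u0)"
    show False
    proof (cases d)
      case 0
      then show False using not cov[OF u0] by simp
    next
      case (Suc k)
      \<comment> \<open>The upward closure is taken because the collapsed sets are only known to
        contain some \<open>v\<close> below \<open>u\<close>.\<close>
      define C' where "C' y u \<longleftrightarrow> (\<exists>v\<in>\<Omega>. collapse k (\<lambda>y. C y u0) C y v \<and> le v u)" for y u
      have "cofinal_system k C'" unfolding cofinal_system_def
      proof (intro conjI allI impI ballI)
        fix f g assume f: "dtl M k f" and g: "dtl M m g"
        have r: "dfn M (\<lambda>e. collapse k (\<lambda>y. C y u0) C (f e) (g e))" if "dtl M k f" "dtl M m g" for f g
          by (rule collapse_dfn[of k "\<lambda>_ y. C y u0" "\<lambda>_. C", OF _ _ dte_id(1) that])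
            (intro allI impI dC dtl_const len u0; simp only: Suc)+
        show "dfn M (\<lambda>e. C' (f e) (g e))" unfolding C'_def
          by (intro dfn_intros r dle dtl_shift[OF f] dtl_shift[OF g])
      next
        show "C' y v" if "C' y u" "le u v" for y u v
          using that le_trans unfolding C'_def by blast
      next
        fix y :: "'a list" assume "length y = k"
        then have "bdd (collapse k (\<lambda>y. C y u0) C y)" by (intro collapse_bdd) (use not bC Suc in auto)
        then obtain w where "w \<in> \<Omega>" "\<forall>v\<in>\<Omega>. collapse k (\<lambda>y. C y u0) C y v \<longrightarrow> le w v"
          unfolding bdd_def by blast
        then show "bdd (C' y)" unfolding bdd_def C'_def using le_trans[of w] by blast
      next
        fix u assume "u \<in> \<Omega>"
        then obtain v where v: "v \<in> \<Omega>" "le v u" "le v u0" using directed u0 by blast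
        then obtain y where y: "length y = d" "C y v" using cov by blast
        then have "\<exists>l. length l = k \<and> collapse k (\<lambda>y. C y u0) C l v"
          by (intro collapse_cover[of _ y]) (use up v Suc in auto)
        then show "\<exists>y. length y = k \<and> C' y u" unfolding C'_def using v by blast
      qed
      then show False using min Suc by blast
    qed
  qed
  then show ?thesis using that C by blast
qed

lemma bdd_subinterval:
  assumes D: "\<forall>t g. dt M t \<longrightarrow> dtl M m g \<longrightarrow> dfn M (\<lambda>e. D (t e) (g e))"
    and ab: "a < b" and bD: "\<And>x. a < x \<Longrightarrow> x < b \<Longrightarrow> bdd (D x)"
  obtains a' b' where "a' < b'" "{a'<..<b'} \<subseteq> {a<..<b}" "bdd (\<lambda>u. \<exists>x. a' < x \<and> x < b' \<and> D x u)"
proof -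
  obtain d C where C: "cofinal_system d C" "\<forall>u\<in>\<Omega>. Large d (\<lambda>y. C y u)"
    by (rule large_cofinal_system)
  have dC: "dfn M (\<lambda>e. C (f e) (g e))" if "dtl M d f" "dtl M m g" for f g
    using C that unfolding cofinal_system_def by blast
  have up: "C y v" if "C y u" "le u v" for y u v
    using C that unfolding cofinal_system_def by blast
  have bC: "bdd (C y)" if "length y = d" for y
    using C that unfolding cofinal_system_def by blast
  have dD: "dfn M (\<lambda>e. D (t e) (g e))" if "dt M t" "dtl M m g" for t g
    using D that by blast
  define P where "P x y \<longleftrightarrow> a < x \<and> x < b \<and> (\<forall>u\<in>\<Omega>. D x u \<longrightarrow> C y u)" for x y
  have dP: "dfn M (\<lambda>e. P (t e) (f e))" if "dt M t" "dtl M d f" for t f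
    unfolding P_def by (intro dfn_intros dD dC dt_shift[OF that(1)] dtl_shift[OF that(2)])
  have "{a<..<b} \<subseteq> {x. Large d (P x)}"
  proof
    fix x assume x: "x \<in> {a<..<b}"
    then obtain w where w: "w \<in> \<Omega>" "\<forall>u\<in>\<Omega>. D x u \<longrightarrow> le w u" using bD unfolding bdd_def by auto
    \<comment> \<open>A set \<open>C y\<close> that contains the lower bound \<open>w\<close> of
      \<open>D x\<close> contains all of \<open>D x\<close>, being upward closed.\<close>
    have "Large d (P x)"
      by (rule Large_mono[OF bspec[OF C(2) w(1)]]) (use w x up in \<open>auto simp: P_def\<close>)
    then show "x \<in> {x. Large d (P x)}" by simp
  qed
  then have "infinite {x. Large d (P x)}" using ab infinite_Ioo infinite_super by blast
  from Large_swap[OF _ this] dP have "Large d (\<lambda>l. infinite {x. P x l})" by blast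
  from Large_ex[OF this] obtain y where y: "length y = d" "infinite {x. P x y}" by blast
  have "dset {x. P x y}" by (intro dsetI dP dt_var dtl_const y(1))
  then obtain a' b' where ab': "a' < b'" "{a'<..<b'} \<subseteq> {x. P x y}" using y(2) by (rule dset_infinite)
  show ?thesis
  proof (rule that[OF ab'(1)])
    show "{a'<..<b'} \<subseteq> {a<..<b}" using ab'(2) unfolding P_def by auto
    show "bdd (\<lambda>u. \<exists>x. a' < x \<and> x < b' \<and> D x u)"
      by (rule bdd_mono[OF bC[OF y(1)]]) (use ab'(2) in \<open>auto simp: P_def\<close>)
  qed
qed

end

section \<open>Exhaustion by bounded sets\<close>

context directed_in_omin
begin

definition bad_at :: "('a \<Rightarrow> 'a list \<Rightarrow> bool) \<Rightarrow> 'a \<Rightarrow> bool" where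
  "bad_at W z \<longleftrightarrow> (\<forall>a b. a < z \<and> z < b \<longrightarrow> \<not> bdd (\<lambda>u. \<exists>x. a < x \<and> x < b \<and> W x u))"

text \<open>Collecting the bad points for all parameters gives one exceptional set independent of
  \<open>s\<close> and \<open>t\<close>; this makes \<open>exhaustion\<close> monotone in
  them.\<close>

definition bad :: "('a \<Rightarrow> 'a \<Rightarrow> 'a \<Rightarrow> 'a list \<Rightarrow> bool) \<Rightarrow> 'a \<Rightarrow> bool" where
  "bad W z \<longleftrightarrow> (\<exists>t. \<exists>s. 0 < s \<and> 0 < t \<and> bad_at (W s t) z)"

lemma bad_at_mono: "bad_at W z \<Longrightarrow> (\<And>x u. W x u \<Longrightarrow> W' x u) \<Longrightarrow> bad_at W' z"
  unfolding bad_at_def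
proof (intro allI impI notI)
  fix a b
  assume W: "\<forall>a b. a < z \<and> z < b \<longrightarrow> \<not> bdd (\<lambda>u. \<exists>x. a < x \<and> x < b \<and> W x u)"
    and sub: "\<And>x u. W x u \<Longrightarrow> W' x u"
    and "a < z \<and> z < b" "bdd (\<lambda>u. \<exists>x. a < x \<and> x < b \<and> W' x u)"
  moreover from this(4) have "bdd (\<lambda>u. \<exists>x. a < x \<and> x < b \<and> W x u)"
    by (rule bdd_mono) (use sub in blast)
  ultimately show False by blast
qed

text \<open>For fixed \<open>s\<close> and \<open>t\<close>, infinitely many bad points would fill
  an interval, against \<open>bdd_subinterval\<close>. By monotonicity of \<open>W\<close> the sets
  of bad points form chains in \<open>s\<close> and in \<open>t\<close>, and
  \<open>finite_chain_union\<close> applies to each parameter in turn.\<close>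

lemma finite_bad:
  assumes W: "\<forall>s t x g. dt M s \<longrightarrow> dt M t \<longrightarrow> dt M x \<longrightarrow> dtl M m g \<longrightarrow> dfn M (\<lambda>e. W (s e) (t e) (x e) (g e))"
    and mono: "\<And>s t s' t' x u. 0 < s' \<Longrightarrow> s' \<le> s \<Longrightarrow> 0 < t \<Longrightarrow> t \<le> t' \<Longrightarrow> W s t x u \<Longrightarrow> W s' t' x u"
    and bW: "\<And>s t x. 0 < s \<Longrightarrow> 0 < t \<Longrightarrow> bdd (W s t x)"
  shows "finite {z. bad W z}"
proof -
  have dW: "dfn M (\<lambda>e. W (s e) (t e) (x e) (g e))"
    if "dt M s" "dt M t" "dt M x" "dtl M m g" for s t x g
    using W that by blast
  have db: "dfn M (\<lambda>e. bad_at (W (s e) (t e)) (z e))" if s: "dt M s" and t: "dt M t" and z: "dt M z" for s t z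
    unfolding bad_at_def by (intro dfn_intros dW dt_shift[OF s] dt_shift[OF t] dt_shift[OF z])
  have 1: "finite {z. bad_at (W s t) z}" if st: "0 < s" "0 < t" for s t
  proof (rule ccontr)
    assume inf: "infinite {z. bad_at (W s t) z}"
    have "dset {z. bad_at (W s t) z}" by (intro dsetI db dfn_intros)
    then obtain a b where ab: "a < b" "{a<..<b} \<subseteq> {z. bad_at (W s t) z}" using inf by (rule dset_infinite)
    have dD: "\<forall>x g. dt M x \<longrightarrow> dtl M m g \<longrightarrow> dfn M (\<lambda>e. W s t (x e) (g e))"
      by (intro allI impI dW dt_const)
    obtain a' b' where a'b': "a' < b'" "{a'<..<b'} \<subseteq> {a<..<b}" "bdd (\<lambda>u. \<exists>x. a' < x \<and> x < b' \<and> W s t x u)"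
      by (rule bdd_subinterval[OF dD ab(1) bW[OF st]])
    obtain z where z: "a' < z" "z < b'" using dense a'b'(1) by blast
    then have "bad_at (W s t) z" using a'b'(2) ab(2) by auto
    then show False unfolding bad_at_def using z a'b'(3) by blast
  qed
  have 2: "finite {z. \<exists>s. 0 < s \<and> 0 < t \<and> bad_at (W s t) z}" for t
  proof (rule finite_chain_union)
    show "dfn M (\<lambda>e. 0 < e 0 \<and> 0 < t \<and> bad_at (W (e 0) t) (e 1))" by (intro dfn_intros db)
    show "finite {z. 0 < s \<and> 0 < t \<and> bad_at (W s t) z}" for s
      by (rule finite_subset[of _ "if 0 < s \<and> 0 < t then {z. bad_at (W s t) z} else {}"]) (auto simp: 1)
    have "bad_at (W s' t) z" if "0 < s'" "s' \<le> s" "0 < t" "bad_at (W s t) z" for s s' z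
      by (rule bad_at_mono[OF that(4)]) (use mono that in blast)
    then show "(\<forall>z. 0 < p \<and> 0 < t \<and> bad_at (W p t) z \<longrightarrow> 0 < q \<and> 0 < t \<and> bad_at (W q t) z) \<or>
        (\<forall>z. 0 < q \<and> 0 < t \<and> bad_at (W q t) z \<longrightarrow> 0 < p \<and> 0 < t \<and> bad_at (W p t) z)" for p q
      using linear[of p q] by (metis (no_types))
  qed
  have "finite {z. \<exists>t. \<exists>s. 0 < s \<and> 0 < t \<and> bad_at (W s t) z}"
  proof (rule finite_chain_union[OF _ _ 2])
    show "dfn M (\<lambda>e. \<exists>s. 0 < s \<and> 0 < e 0 \<and> bad_at (W s (e 0)) (e 1))" by (intro dfn_intros db)
    have *: "bad_at (W s t') z" if "0 < s" "0 < t" "t \<le> t'" "bad_at (W s t) z" for s t t' z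
      by (rule bad_at_mono[OF that(4)]) (use mono that in blast)
    have **: "\<exists>s. 0 < s \<and> 0 < q \<and> bad_at (W s q) z"
      if "p \<le> q" "\<exists>s. 0 < s \<and> 0 < p \<and> bad_at (W s p) z" for p q z
    proof -
      from that(2) obtain s where s: "0 < s" "0 < p" "bad_at (W s p) z" by blast
      have "0 < q" using s(2) that(1) by (rule less_le_trans)
      then show ?thesis using s *[OF s(1,2) that(1) s(3)] by blast
    qed
    show "(\<forall>z. (\<exists>s. 0 < s \<and> 0 < p \<and> bad_at (W s p) z) \<longrightarrow> (\<exists>s. 0 < s \<and> 0 < q \<and> bad_at (W s q) z)) \<or>
        (\<forall>z. (\<exists>s. 0 < s \<and> 0 < q \<and> bad_at (W s q) z) \<longrightarrow> (\<exists>s. 0 < s \<and> 0 < p \<and> bad_at (W s p) z))" for p q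
      using linear[of p q] **[of p q] **[of q p] by blast
  qed
  then show ?thesis unfolding bad_def .
qed

text \<open>The supremum proof of the Heine-Borel theorem: the end points \<open>y\<close> for which
  the union over \<open>[p, y]\<close> is bounded form a definable set, and local boundedness at its
  supremum forces that supremum to be \<open>q\<close>.\<close>

lemma bdd_compact:
  assumes W: "\<forall>x g. dt M x \<longrightarrow> dtl M m g \<longrightarrow> dfn M (\<lambda>e. W (x e) (g e))"
    and loc: "\<And>x. \<not> bad_at W x"
  shows "bdd (\<lambda>u. \<exists>x. p \<le> x \<and> x \<le> q \<and> W x u)"
proof (cases "p \<le> q")
  case False
  show ?thesis by (rule bdd_mono[OF bdd_empty]) (use False order_trans in blast)
next
  case True
  have dW: "dfn M (\<lambda>e. W (x e) (g e))" if "dt M x" "dtl M m g" for x g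
    using W that by blast
  have nb: "\<exists>a b. a < x \<and> x < b \<and> bdd (\<lambda>u. \<exists>y. a < y \<and> y < b \<and> W y u)" for x
    using loc[of x] unfolding bad_at_def by blast
  define S where "S = {y. p \<le> y \<and> y \<le> q \<and> bdd (\<lambda>u. \<exists>x. p \<le> x \<and> x \<le> y \<and> W x u)}"
  have "dset S" unfolding S_def by (intro dsetI dfn_intros dW)
  moreover have "p \<in> S"
  proof -
    obtain a b where ab: "a < p" "p < b" "bdd (\<lambda>u. \<exists>y. a < y \<and> y < b \<and> W y u)" using nb by blast
    from ab(3) have "bdd (\<lambda>u. \<exists>x. p \<le> x \<and> x \<le> p \<and> W x u)"
      by (rule bdd_mono) (use ab in \<open>metis antisym\<close>)
    then show ?thesis unfolding S_def using True by blast
  qed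
  moreover have "y \<le> q" if "y \<in> S" for y using that unfolding S_def by blast
  ultimately obtain c where c: "\<forall>y\<in>S. y \<le> c" "\<forall>c'. (\<forall>y\<in>S. y \<le> c') \<longrightarrow> c \<le> c'"
    by (rule dset_lub)
  have pc: "p \<le> c" using c(1) \<open>p \<in> S\<close> by blast
  have cq: "c \<le> q" using c(2) unfolding S_def by blast
  obtain a b where ab: "a < c" "c < b" "bdd (\<lambda>u. \<exists>y. a < y \<and> y < b \<and> W y u)" using nb by blast
  obtain y where y: "y \<in> S" "a < y" using c(2) ab(1) by (meson not_le)
  then have "bdd (\<lambda>u. (\<exists>x. p \<le> x \<and> x \<le> y \<and> W x u) \<or> (\<exists>y. a < y \<and> y < b \<and> W y u))"
    using ab(3) unfolding S_def by (intro bdd_disj) auto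
  then have ext: "bdd (\<lambda>u. \<exists>x. p \<le> x \<and> x \<le> z \<and> W x u)" if "z < b" for z
  proof (rule bdd_mono)
    fix u assume "\<exists>x. p \<le> x \<and> x \<le> z \<and> W x u"
    then obtain x where x: "p \<le> x" "x \<le> z" "W x u" by blast
    show "(\<exists>x. p \<le> x \<and> x \<le> y \<and> W x u) \<or> (\<exists>y. a < y \<and> y < b \<and> W y u)"
    proof (cases "x \<le> y")
      case False
      then have "a < x" using y(2) by simp
      moreover have "x < b" using x(2) that by simp
      ultimately show ?thesis using x(3) by blast
    qed (use x in blast)
  qed
  have "c = q"
  proof (rule ccontr)
    assume "c \<noteq> q"
    then have "c < min b q" using cq ab(2) by simp
    then obtain z where z: "c < z" "z < min b q" using dense by blast
    then have "z \<in> S" unfolding S_def using ext[of z] pc by auto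
    then show False using c(1) z(1) by auto
  qed
  then show ?thesis using ext ab(2) by blast
qed

text \<open>These are the sets \<open>D(s,t)\<close>. The first coordinate is either bad, or in
  \<open>[-t, t]\<close> at distance at least \<open>s\<close> from all bad points; the tail lies in
  the exhaustion of the fibre over it. \<open>Z\<close> spells out what is named
  \<open>slice\<close> below, since \<open>slice\<close> itself refers to
  \<open>exhaustion\<close>.\<close>

primrec exhaustion :: "nat \<Rightarrow> ('a list \<Rightarrow> 'a list \<Rightarrow> bool) \<Rightarrow> 'a \<Rightarrow> 'a \<Rightarrow> 'a list \<Rightarrow> bool" where
  "exhaustion 0 V s t l \<longleftrightarrow> True"
| "exhaustion (Suc k) V s t l \<longleftrightarrow> exhaustion k (\<lambda>l'. V (hd l # l')) s t (tl l) \<and>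
    (let Z = bad (\<lambda>s t x u. \<exists>l'. length l' = k \<and> exhaustion k (\<lambda>l'. V (x # l')) s t l' \<and> V (x # l') u) in
      Z (hd l) \<or> - t \<le> hd l \<and> hd l \<le> t \<and> (\<forall>z. Z z \<longrightarrow> z + s \<le> hd l \<or> hd l + s \<le> z))"

text \<open>The union of the sets of \<open>V\<close> over the exhausted part of the fibre above
  \<open>x\<close>; this is the one-parameter family whose bad points are considered.\<close>

definition slice :: "nat \<Rightarrow> ('a list \<Rightarrow> 'a list \<Rightarrow> bool) \<Rightarrow> 'a \<Rightarrow> 'a \<Rightarrow> 'a \<Rightarrow> 'a list \<Rightarrow> bool" where
  "slice k V s t x u \<longleftrightarrow> (\<exists>l. length l = k \<and> exhaustion k (\<lambda>l'. V (x # l')) s t l \<and> V (x # l) u)"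

lemma exhaustion_Suc: "exhaustion (Suc k) V s t l \<longleftrightarrow> exhaustion k (\<lambda>l'. V (hd l # l')) s t (tl l) \<and>
    (bad (slice k V) (hd l) \<or>
      - t \<le> hd l \<and> hd l \<le> t \<and> (\<forall>z. bad (slice k V) z \<longrightarrow> z + s \<le> hd l \<or> hd l + s \<le> z))"
proof -
  have "slice k V = (\<lambda>s t x u. \<exists>l'. length l' = k \<and> exhaustion k (\<lambda>l'. V (x # l')) s t l' \<and> V (x # l') u)"
    by (intro ext) (simp add: slice_def)
  then show ?thesis by (simp only: exhaustion.simps Let_def)
qed

declare exhaustion.simps(2) [simp del]

lemma neg_le_mono: "t \<le> t' \<Longrightarrow> - t' \<le> - t" for t t' :: 'a
proof -
  assume "t \<le> t'"
  then have "(- t' + t) + - t \<le> (- t' + t') + - t" by (simp only: add_le)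
  then show ?thesis by (simp add: add.assoc)
qed

text \<open>The exceptional points do not depend on \<open>s\<close> and \<open>t\<close>, so only
  the explicit inequalities have to be compared.\<close>

lemma exhaustion_mono:
  "s' \<le> s \<Longrightarrow> t \<le> t' \<Longrightarrow> exhaustion k V s t l \<Longrightarrow> exhaustion k V s' t' l"
proof (induction k arbitrary: V l)
  case 0
  then show ?case by simp
next
  case (Suc k)
  have "exhaustion k (\<lambda>l'. V (hd l # l')) s' t' (tl l)"
    by (rule Suc.IH) (use Suc.prems in \<open>auto simp: exhaustion_Suc\<close>)
  moreover have "z + s' \<le> hd l" if "z + s \<le> hd l" for z
    using Suc.prems(1) that by (meson add_le(1) order_trans)
  moreover have "hd l + s' \<le> z" if "hd l + s \<le> z" for z
    using Suc.prems(1) that by (meson add_le(1) order_trans)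
  moreover have "- t' \<le> hd l" if "- t \<le> hd l"
    using neg_le_mono[OF Suc.prems(2)] that by (rule order_trans)
  moreover have "hd l \<le> t'" if "hd l \<le> t" using that Suc.prems(2) by (rule order_trans)
  ultimately show ?case using Suc.prems(3) unfolding exhaustion_Suc by blast
qed

lemma exhaustion_dfn:
  assumes "\<forall>\<sigma> f g. dte M \<sigma> \<longrightarrow> dtl M k f \<longrightarrow> dtl M m g \<longrightarrow> dfn M (\<lambda>e. V (\<sigma> e) (f e) (g e))"
    and "dte M \<sigma>" "dt M s" "dt M t" "dtl M k f"
  shows "dfn M (\<lambda>e. exhaustion k (V (\<sigma> e)) (s e) (t e) (f e))"
  using assms
proof (induction k arbitrary: V \<sigma> s t f)
  case 0
  show ?case by (simp add: dfn_const)
next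
  case (Suc k)
  have V: "dfn M (\<lambda>e. V (\<sigma> e) (f e) (g e))"
    if "dte M \<sigma>" "dtl M (Suc k) f" "dtl M m g" for \<sigma> f g
    using Suc.prems(1) that by blast
  have IH: "dfn M (\<lambda>e. exhaustion k (\<lambda>l'. V (\<sigma> e) (x e # l')) (s e) (t e) (f e))"
    if \<sigma>: "dte M \<sigma>" and x: "dt M x" and "dt M s" "dt M t" "dtl M k f" for \<sigma> x s t f
  proof -
    have *: "dte M (\<lambda>e. case_nat (x e) (\<sigma> e))" by (intro dte_case x \<sigma>)
    have "dfn M (\<lambda>e. exhaustion k (\<lambda>l'. V (\<lambda>i. case_nat (x e) (\<sigma> e) (Suc i)) (case_nat (x e) (\<sigma> e) 0 # l'))
        (s e) (t e) (f e))"
    proof (rule Suc.IH[of "\<lambda>e l'. V (\<lambda>i. e (Suc i)) (e 0 # l')", OF _ * that(3-5)],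
        intro allI impI V dtl_Cons)
      fix \<sigma> f assume "dte M \<sigma>"
      then show "dte M (\<lambda>e i. \<sigma> e (Suc i))" "dt M (\<lambda>e. \<sigma> e 0)" unfolding dte_def by blast+
    qed
    then show ?thesis by simp
  qed
  have sl: "dfn M (\<lambda>e. slice k (V (\<sigma> e)) (s e) (t e) (x e) (g e))"
    if "dte M \<sigma>" "dt M s" "dt M t" "dt M x" "dtl M m g" for \<sigma> s t x g
    unfolding slice_def
    by (intro dfn_list_ex dfn_conj IH V dtl_Cons dtl_map dt_var dte_shift[OF that(1)] dt_shift[OF that(2)]
      dt_shift[OF that(3)] dt_shift[OF that(4)] dtl_shift[OF that(5)])
  have bad: "dfn M (\<lambda>e. bad (slice k (V (\<sigma> e))) (x e))" if "dte M \<sigma>" "dt M x" for \<sigma> x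
    unfolding bad_def bad_at_def
    by (intro dfn_intros sl dte_shift[OF that(1)] dt_shift[OF that(2)])
  note s = Suc.prems(2-5)
  show ?case unfolding exhaustion_Suc
    by (intro dfn_conj dfn_disj dfn_le dfn_all dfn_imp dt_plus dt_uminus dt_var IH bad
      s dt_hd[OF s(4)] dtl_tl[OF s(4)] dte_shift[OF s(1)] dt_shift[OF s(2)] dt_shift[OF s(3)]
      dt_shift[OF dt_hd[OF s(4)]])
qed

lemma separation:
  fixes Z :: "'a set"
  assumes "finite Z" "x \<notin> Z"
  shows "\<exists>s>0. \<forall>z\<in>Z. z + s \<le> x \<or> x + s \<le> z"
  using assms
proof (induction Z rule: finite_induct)
  case empty
  obtain s :: 'a where "0 < s" using gt_ex by blast
  then show ?case by auto
next
  case (insert y Z)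
  then obtain s where s: "0 < s" "\<forall>z\<in>Z. z + s \<le> x \<or> x + s \<le> z" by auto
  have "\<exists>r>0. y + r \<le> x \<or> x + r \<le> y"
  proof (cases "y < x")
    case True
    \<comment> \<open>Without commutativity the distance is taken as \<open>- y + x\<close>, because
      \<open>y + (- y + x) = x\<close>.\<close>
    then show ?thesis using add_less(1)[of y 0 "- y + x"] by (intro exI[of _ "- y + x"]) simp
  next
    case False
    then have "x < y" using insert.prems by auto
    then show ?thesis using add_less(1)[of x 0 "- x + y"] by (intro exI[of _ "- x + y"]) simp
  qed
  then obtain r where r: "0 < r" "y + r \<le> x \<or> x + r \<le> y" by blast
  have le: "c + min s r \<le> d" if "c + s \<le> d \<or> c + r \<le> d" for c d
    using that add_le(1)[of c "min s r" s] add_le(1)[of c "min s r" r]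
    by (metis min.cobounded1 min.cobounded2 order_trans)
  show ?case
    by (rule exI[of _ "min s r"]) (use s r le in auto)
qed

text \<open>Both claims go through one induction. Boundedness over the fibres makes every
  \<open>slice\<close> bounded, so that \<open>finite_bad\<close> applies; the finiteness of the bad
  points is then used for covering, through \<open>separation\<close>, as well as for
  boundedness.\<close>

lemma exhaustion_covers_and_bdd:
  assumes "\<forall>f g. dtl M k f \<longrightarrow> dtl M m g \<longrightarrow> dfn M (\<lambda>e. V (f e) (g e))"
    and "\<And>l. length l = k \<Longrightarrow> bdd (V l)"
  shows "(\<forall>l. length l = k \<longrightarrow> (\<exists>s>0. \<exists>t>0. exhaustion k V s t l)) \<and>
    (\<forall>s>0. \<forall>t>0. bdd (\<lambda>u. \<exists>l. length l = k \<and> exhaustion k V s t l \<and> V l u))"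
  using assms
proof (induction k arbitrary: V)
  case 0
  obtain s :: 'a where s: "0 < s" using gt_ex by blast
  have b: "bdd (V [])" by (rule 0(2)) simp
  show ?case
  proof (intro conjI allI impI)
    show "\<exists>s>0. \<exists>t>0. exhaustion 0 V s t l" for l using s by auto
    show "bdd (\<lambda>u. \<exists>l. length l = 0 \<and> exhaustion 0 V s t l \<and> V l u)" for s t
      by (rule bdd_mono[OF b]) simp
  qed
next
  case (Suc k)
  have dV: "dfn M (\<lambda>e. V (f e) (g e))" if "dtl M (Suc k) f" "dtl M m g" for f g
    using Suc.prems(1) that by blast
  have "(\<forall>l. length l = k \<longrightarrow> (\<exists>s>0. \<exists>t>0. exhaustion k (\<lambda>l. V (x # l)) s t l)) \<and>
    (\<forall>s>0. \<forall>t>0. bdd (\<lambda>u. \<exists>l. length l = k \<and> exhaustion k (\<lambda>l. V (x # l)) s t l \<and> V (x # l) u))" for x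
  proof (rule Suc.IH)
    show "\<forall>f g. dtl M k f \<longrightarrow> dtl M m g \<longrightarrow> dfn M (\<lambda>e. V (x # f e) (g e))"
      by (intro allI impI dV dtl_Cons dt_const)
    show "bdd (V (x # l))" if "length l = k" for l by (rule Suc.prems(2)) (simp add: that)
  qed
  note IH = this
  have ex: "\<exists>s>0. \<exists>t>0. exhaustion k (\<lambda>l. V (x # l)) s t l" if "length l = k" for x l
    using conjunct1[OF IH[of x]] that by blast
  have bsl: "bdd (slice k V s t x)" if "0 < s" "0 < t" for s t x
  proof -
    have "bdd (\<lambda>u. \<exists>l. length l = k \<and> exhaustion k (\<lambda>l. V (x # l)) s t l \<and> V (x # l) u)"
      using conjunct2[OF IH[of x]] that by blast
    then show ?thesis by (rule bdd_mono) (simp add: slice_def)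
  qed
  have exd: "dfn M (\<lambda>e. exhaustion k (\<lambda>l'. V (x e # l')) (s e) (t e) (f e))"
    if "dt M x" "dt M s" "dt M t" "dtl M k f" for x s t f
  proof -
    have *: "dte M (\<lambda>e i. x e)" using that(1) unfolding dte_def by blast
    have "dfn M (\<lambda>e. exhaustion k (\<lambda>l'. V ((\<lambda>i::nat. x e) 0 # l')) (s e) (t e) (f e))"
    proof (rule exhaustion_dfn[of k "\<lambda>e l'. V (e 0 # l')", OF _ * that(2-4)], intro allI impI dV dtl_Cons)
      fix \<sigma> assume "dte M \<sigma>"
      then show "dt M (\<lambda>e. \<sigma> e 0)" unfolding dte_def by blast
    qed
    then show ?thesis by simp
  qed
  have dsl: "dfn M (\<lambda>e. slice k V (s e) (t e) (x e) (g e))"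
    if "dt M s" "dt M t" "dt M x" "dtl M m g" for s t x g
    unfolding slice_def
    by (intro dfn_list_ex dfn_conj exd dV dtl_Cons dtl_map dt_var dt_shift[OF that(1)]
      dt_shift[OF that(2)] dt_shift[OF that(3)] dtl_shift[OF that(4)])
  have fin: "finite {z. bad (slice k V) z}"
  proof (rule finite_bad)
    show "slice k V s' t' x u" if "s' \<le> s" "t \<le> t'" "slice k V s t x u" for s t s' t' x u
      using that(3) exhaustion_mono[OF that(1,2)] unfolding slice_def by blast
  qed (use bsl dsl in blast)+
  have dbad: "dfn M (\<lambda>e. bad (slice k V) (x e))" if "dt M x" for x
    unfolding bad_def bad_at_def
    by (intro dfn_intros dsl dt_shift[OF that])
  have A: "\<exists>s>0. \<exists>t>0. exhaustion (Suc k) V s t l" if l: "length l = Suc k" for l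
  proof -
    obtain x l' where xl: "l = x # l'" "length l' = k" using l by (metis length_Suc_conv)
    obtain s0 t0 where st: "0 < s0" "0 < t0" "exhaustion k (\<lambda>l. V (x # l)) s0 t0 l'" using ex[OF xl(2)] by blast
    show ?thesis
    proof (cases "bad (slice k V) x")
      case True
      then show ?thesis using st unfolding exhaustion_Suc xl list.sel by blast
    next
      case False
      then obtain s1 where s1: "0 < s1" "\<forall>z\<in>{z. bad (slice k V) z}. z + s1 \<le> x \<or> x + s1 \<le> z"
        using separation[OF fin, of x] by blast
      define s where "s = min s0 s1"
      \<comment> \<open>Dominating both \<open>x\<close> and \<open>- x\<close> places
        \<open>x\<close> in \<open>[-t, t]\<close>.\<close>
      define t where "t = max t0 (max x (- x))"
      have "0 < s" "0 < t" using st s1 unfolding s_def t_def by (auto simp: less_max_iff_disj)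
      moreover have "exhaustion k (\<lambda>l. V (x # l)) s t l'"
        by (rule exhaustion_mono[OF _ _ st(3)]) (auto simp: s_def t_def)
      moreover have "c + s \<le> d" if "c + s1 \<le> d" for c d
      proof -
        have "c + s \<le> c + s1" unfolding s_def by simp
        then show ?thesis using that by (rule order_trans)
      qed
      then have "\<forall>z. bad (slice k V) z \<longrightarrow> z + s \<le> x \<or> x + s \<le> z" using s1(2) by blast
      moreover have "x \<le> t" unfolding t_def by (simp add: le_max_iff_disj)
      moreover have "- x \<le> t" unfolding t_def by (simp add: le_max_iff_disj)
      then have "- t \<le> x" using neg_le_mono[of "- x" t] by simp
      ultimately show ?thesis unfolding exhaustion_Suc xl list.sel by blast
    qed
  qed
  have B: "bdd (\<lambda>u. \<exists>l. length l = Suc k \<and> exhaustion (Suc k) V s t l \<and> V l u)" if st: "0 < s" "0 < t" for s t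
  proof -
    \<comment> \<open>The part of the first coordinate kept away from bad points. Cutting the slices
      down to \<open>T\<close> removes every failure of local boundedness, so
      \<open>bdd_compact\<close> handles \<open>[-t, t]\<close>; the slices at the finitely many bad
      points are added afterwards.\<close>
    define T where "T x \<longleftrightarrow> - t \<le> x \<and> x \<le> t \<and> (\<forall>z. bad (slice k V) z \<longrightarrow> z + s \<le> x \<or> x + s \<le> z)" for x
    have "bdd (\<lambda>u. \<exists>x. - t \<le> x \<and> x \<le> t \<and> (T x \<and> slice k V s t x u))"
    proof (rule bdd_compact)
      show "\<forall>x g. dt M x \<longrightarrow> dtl M m g \<longrightarrow> dfn M (\<lambda>e. T (x e) \<and> slice k V s t (x e) (g e))"
      proof (intro allI impI)
        fix x g assume x: "dt M x" and g: "dtl M m g"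
        show "dfn M (\<lambda>e. T (x e) \<and> slice k V s t (x e) (g e))" unfolding T_def
          by (intro dfn_intros dbad dsl x g dt_shift[OF x])
      qed
      fix x
      show "\<not> bad_at (\<lambda>x u. T x \<and> slice k V s t x u) x"
      proof (cases "bad (slice k V) x")
        case False
        then have "\<not> bad_at (slice k V s t) x" using st unfolding bad_def by blast
        then show ?thesis using bad_at_mono[of "\<lambda>x u. T x \<and> slice k V s t x u" x "slice k V s t"] by blast
      next
        case True
        \<comment> \<open>Around a bad point \<open>x\<close> the interval from \<open>x - s\<close>
          to \<open>x + s\<close> contains no point of \<open>T\<close>, so the union there is
          empty.\<close>
        have "x - s < x" using add_less(2)[of "x - s" s x] add_less(1)[of x 0 s] st by simp
        moreover have "x < x + s" using add_less(1)[of x 0 s] st by simp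
        moreover have "\<not> T y" if "x - s < y" "y < x + s" for y
        proof
          assume "T y"
          then have "x + s \<le> y \<or> y + s \<le> x" using True unfolding T_def by blast
          moreover have "x < y + s" using add_less(2)[of "x - s" s y] that(1) by simp
          ultimately show False using that(2) by auto
        qed
        then have "bdd (\<lambda>u. \<exists>y. x - s < y \<and> y < x + s \<and> T y \<and> slice k V s t y u)"
          by (intro bdd_mono[OF bdd_empty]) blast
        ultimately show ?thesis unfolding bad_at_def by blast
      qed
    qed
    moreover have "bdd (\<lambda>u. \<exists>z\<in>{z. bad (slice k V) z}. slice k V s t z u)"
      by (rule bdd_finite[OF fin bsl[OF st]])
    ultimately have "bdd (\<lambda>u. (\<exists>x. - t \<le> x \<and> x \<le> t \<and> (T x \<and> slice k V s t x u)) \<or>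
      (\<exists>z\<in>{z. bad (slice k V) z}. slice k V s t z u))" by (rule bdd_disj)
    then show ?thesis
    proof (rule bdd_mono)
      fix u assume "\<exists>l. length l = Suc k \<and> exhaustion (Suc k) V s t l \<and> V l u"
      then obtain l where l: "length l = Suc k" "exhaustion (Suc k) V s t l" "V l u" by blast
      obtain x l' where xl: "l = x # l'" "length l' = k" using l by (metis length_Suc_conv)
      have "slice k V s t x u" using l xl unfolding exhaustion_Suc slice_def list.sel by auto
      moreover have "bad (slice k V) x \<or> T x" using l(2) unfolding exhaustion_Suc xl list.sel T_def by blast
      ultimately show "(\<exists>x. - t \<le> x \<and> x \<le> t \<and> (T x \<and> slice k V s t x u)) \<or>
        (\<exists>z\<in>{z. bad (slice k V) z}. slice k V s t z u)" unfolding T_def by blast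
    qed
  qed
  show ?case using A B by blast
qed

end

section \<open>Definable choice\<close>

lemma dt_subst:
  assumes "dt M t" "dte M \<sigma>"
  shows "dt M (\<lambda>e. t (\<sigma> e))"
proof -
  have "dte M (\<lambda>e. case_nat (e 0) (\<sigma> (\<lambda>i. e (Suc i))))"
    by (intro dte_case dt_var dte_shift[OF assms(2)])
  from dfn_subst[OF assms(1)[unfolded dt_def] this] show ?thesis unfolding dt_def by simp
qed

lemma dtl_subst: "dtl M m f \<Longrightarrow> dte M \<sigma> \<Longrightarrow> dtl M m (\<lambda>e. f (\<sigma> e))"
  unfolding dtl_def by (auto intro: dt_subst[of M "\<lambda>e. f e ! i" for i])

lemma dt_graph:
  assumes "dfn M (\<lambda>e. P (\<lambda>i. e (Suc i)) (e 0))" "\<And>e y. y = t e \<longleftrightarrow> P e y"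
  shows "dt M t"
  using assms unfolding dt_def by (simp only:)

section \<open>A canonical element of a definable subset of the line\<close>

definition is_lub :: "('a::linorder \<Rightarrow> bool) \<Rightarrow> 'a \<Rightarrow> bool" where
  "is_lub S c \<longleftrightarrow> (\<forall>x. S x \<longrightarrow> x \<le> c) \<and> (\<forall>c'. (\<forall>x. S x \<longrightarrow> x \<le> c') \<longrightarrow> c \<le> c')"

definition is_glb :: "('a::linorder \<Rightarrow> bool) \<Rightarrow> 'a \<Rightarrow> bool" where
  "is_glb S c \<longleftrightarrow> (\<forall>x. S x \<longrightarrow> c \<le> x) \<and> (\<forall>c'. (\<forall>x. S x \<longrightarrow> c' \<le> x) \<longrightarrow> c' \<le> c)"

lemma is_lub_unique: "is_lub S c \<Longrightarrow> is_lub S d \<Longrightarrow> c = d"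
  unfolding is_lub_def by (blast intro: antisym)

lemma is_glb_unique: "is_glb S c \<Longrightarrow> is_glb S d \<Longrightarrow> c = d"
  unfolding is_glb_def by (blast intro: antisym)

text \<open>
  The factor 2 in the third case puts \<open>a + d\<close> strictly inside \<open>S\<close> although \<open>d\<close> is only a
  supremum; the bound \<open>q > 0\<close> makes that supremum finite.
\<close>

definition choice_rel :: "'a::{group_add, linorder} \<Rightarrow> ('a \<Rightarrow> bool) \<Rightarrow> 'a \<Rightarrow> bool" where
  "choice_rel q S y \<longleftrightarrow>
    (if \<not> (\<exists>x. S x) then y = 0
     else if \<exists>x. S x \<and> (\<forall>z. S z \<longrightarrow> x \<le> z) then S y \<and> (\<forall>z. S z \<longrightarrow> y \<le> z)
     else if \<exists>a. \<forall>x. S x \<longrightarrow> a \<le> x then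
       \<exists>a d. is_glb S a \<and> is_lub (\<lambda>d. 0 < d \<and> d \<le> q \<and> (\<forall>x. a < x \<and> x \<le> a + d + d \<longrightarrow> S x)) d \<and>
         y = a + d
     else \<exists>b. is_lub (\<lambda>b. b \<le> 0 \<and> (\<forall>x. x < b \<longrightarrow> S x)) b \<and> y = b + - q)"

context omin
begin

text \<open>Density stands in for division by two: split \<open>l\<close> as
  \<open>y + (- y + l)\<close> and take the smaller part.\<close>

lemma halving:
  fixes l :: 'a
  assumes "0 < l"
  obtains y where "0 < y" "y + y \<le> l"
proof -
  obtain y where y: "0 < y" "y < l" using dense assms by blast
  have z: "0 < - y + l" using add_less(1)[of y 0 "- y + l"] y by simp
  define w where "w = min y (- y + l)"
  have "w + w \<le> y + w" unfolding w_def by (simp only: add_le min.cobounded1)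
  also have "\<dots> \<le> y + (- y + l)" unfolding w_def by (simp only: add_le min.cobounded2)
  finally have "w + w \<le> l" by simp
  then show ?thesis by (intro that[of w]) (use y z in \<open>auto simp: w_def\<close>)
qed

text \<open>Split \<open>d\<close> as \<open>y + (- y + d)\<close> and take the larger part, after
  raising \<open>y\<close> to \<open>y'\<close> to make the inequality strict.\<close>

lemma less_double:
  fixes d :: 'a
  assumes "0 < d"
  obtains w where "w < d" "d < w + w"
proof -
  obtain y where y: "0 < y" "y < d" using dense assms by blast
  obtain y' where y': "y < y'" "y' < d" using dense y(2) by blast
  have z: "- y + d < d" using add_less(2)[of 0 "- y + d" y] y by simp
  define w where "w = max y' (- y + d)"
  have "d = y + (- y + d)" by simp
  also have "\<dots> < y' + (- y + d)" using y'(1) by (simp only: add_less)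
  also have "\<dots> \<le> w + (- y + d)" unfolding w_def by (simp only: add_le max.cobounded1)
  also have "\<dots> \<le> w + w" unfolding w_def by (simp only: add_le max.cobounded2)
  finally have "d < w + w" .
  then show ?thesis by (intro that[of w]) (use y' z in \<open>auto simp: w_def\<close>)
qed

lemma dset_is_lub:
  assumes "dset {x. S x}" "S x" "\<And>x. S x \<Longrightarrow> x \<le> B"
  obtains c where "is_lub S c"
proof -
  obtain c where "\<forall>x\<in>{x. S x}. x \<le> c" "\<forall>c'. (\<forall>x\<in>{x. S x}. x \<le> c') \<longrightarrow> c \<le> c'"
    by (rule dset_lub[OF assms(1), of x B]) (use assms in auto)
  then show ?thesis using that[of c] unfolding is_lub_def by simp
qed

lemma choice_rel_spec:
  assumes S: "dset {x. S x}" and q: "0 < q"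
  shows "\<exists>y. choice_rel q S y \<and> ((\<exists>x. S x) \<longrightarrow> S y)"
proof -
  have dS: "dfn M (\<lambda>e. S (t e))" if "dt M t" for t
    using dfn_subst1[OF that, of "\<lambda>e x. S x"] S unfolding dset_def by simp
  consider (empty) "\<not> (\<exists>x. S x)"
    | (min) "\<exists>x. S x \<and> (\<forall>z. S z \<longrightarrow> x \<le> z)"
    | (below) "\<exists>x. S x" "\<not> (\<exists>x. S x \<and> (\<forall>z. S z \<longrightarrow> x \<le> z))" "\<exists>a. \<forall>x. S x \<longrightarrow> a \<le> x"
    | (unbounded) "\<exists>x. S x" "\<not> (\<exists>x. S x \<and> (\<forall>z. S z \<longrightarrow> x \<le> z))" "\<not> (\<exists>a. \<forall>x. S x \<longrightarrow> a \<le> x)"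
    by blast
  then show ?thesis
  proof cases
    case empty
    then show ?thesis unfolding choice_rel_def by auto
  next
    case min
    then show ?thesis unfolding choice_rel_def by auto
  next
    case below
    obtain a where a: "is_glb S a"
    proof -
      obtain x B where "S x" "\<forall>x. S x \<longrightarrow> B \<le> x" using below by blast
      then obtain c where "\<forall>x\<in>{x. S x}. c \<le> x" "\<forall>c'. (\<forall>x\<in>{x. S x}. c' \<le> x) \<longrightarrow> c' \<le> c"
        by (rule_tac dset_glb[OF S, of x B]) auto
      then show ?thesis using that[of c] unfolding is_glb_def by simp
    qed
    then have le: "\<forall>x. S x \<longrightarrow> a \<le> x" unfolding is_glb_def by blast
    then have "\<not> S a" using below(2) by blast
    obtain b where b: "a < b" "(\<forall>x. a < x \<and> x < b \<longrightarrow> x \<in> {x. S x}) \<or> (\<forall>x. a < x \<and> x < b \<longrightarrow> x \<notin> {x. S x})"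
      by (rule dset_germ_right[OF S])
    \<comment> \<open>Otherwise \<open>b\<close> would be a lower bound of \<open>S\<close> above
      the infimum \<open>a\<close>, as \<open>a\<close> itself is not in \<open>S\<close>.\<close>
    have "\<not> (\<forall>x. a < x \<and> x < b \<longrightarrow> \<not> S x)"
    proof
      assume *: "\<forall>x. a < x \<and> x < b \<longrightarrow> \<not> S x"
      have "b \<le> x" if "S x" for x
      proof -
        have "a \<le> x" "x \<noteq> a" using le that \<open>\<not> S a\<close> by auto
        then show ?thesis using * that by (metis le_neq_trans not_le)
      qed
      then have "b \<le> a" using a unfolding is_glb_def by blast
      then show False using b(1) by simp
    qed
    then have ab: "\<forall>x. a < x \<and> x < b \<longrightarrow> S x" using b(2) by blast
    define D where "D d \<longleftrightarrow> 0 < d \<and> d \<le> q \<and> (\<forall>x. a < x \<and> x \<le> a + d + d \<longrightarrow> S x)" for d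
    obtain b' where b': "a < b'" "b' < b" using dense b(1) by blast
    have "0 < - a + b'" using add_less(1)[of a 0 "- a + b'"] b'(1) by simp
    then obtain y where y: "0 < y" "y + y \<le> - a + b'" by (rule halving)
    have "D (min y q)" unfolding D_def
    proof (intro conjI allI impI)
      show "0 < min y q" "min y q \<le> q" using y q by auto
      fix x assume x: "a < x \<and> x \<le> a + min y q + min y q"
      have "min y q + min y q \<le> y + min y q" by (simp only: add_le min.cobounded1)
      also have "\<dots> \<le> y + y" by (simp only: add_le min.cobounded1)
      also have "\<dots> \<le> - a + b'" by (rule y(2))
      finally have "a + (min y q + min y q) \<le> a + (- a + b')" by (simp only: add_le)
      then have "a + min y q + min y q \<le> b'" by (simp add: add.assoc)
      then have "x < b" using x b'(2) by (meson le_less_trans order_trans)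
      then show "S x" using ab x by blast
    qed
    moreover have "dset {d. D d}" unfolding D_def by (intro dsetI dfn_intros dS)
    moreover have "d \<le> q" if "D d" for d using that unfolding D_def by blast
    ultimately obtain d where d: "is_lub D d" by (rule_tac dset_is_lub[of D])
    have "0 < d" using d \<open>D (min y q)\<close> unfolding is_lub_def D_def by (meson less_le_trans)
    \<comment> \<open>The supremum \<open>d\<close> need not satisfy \<open>D\<close>, but some
      \<open>v > w\<close> does, and \<open>d < w + w \<le> v + v\<close> puts \<open>a + d\<close>
      in the interval that \<open>D v\<close> places inside \<open>S\<close>.\<close>
    then obtain w where w: "w < d" "d < w + w" by (rule less_double)
    obtain v where v: "D v" "w < v" using d w(1) unfolding is_lub_def by (meson not_le)
    have "w + w \<le> w + v" using v(2) by (simp only: add_le less_imp_le)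
    also have "\<dots> \<le> v + v" using v(2) by (simp only: add_le less_imp_le)
    finally have "d \<le> v + v" using w(2) by simp
    then have "a + d \<le> a + v + v" by (simp only: add_le add.assoc)
    moreover have "a < a + d" using add_less(1)[of a 0 d] \<open>0 < d\<close> by simp
    ultimately have "S (a + d)" using v(1) unfolding D_def by blast
    moreover have "choice_rel q S (a + d)"
      using a d below unfolding choice_rel_def D_def by auto
    ultimately show ?thesis by blast
  next
    case unbounded
    obtain b0 where b0: "(\<forall>x<b0. x \<in> {x. S x}) \<or> (\<forall>x<b0. x \<notin> {x. S x})"
      by (rule dset_germ_bot[OF S])
    have "\<not> (\<forall>x<b0. \<not> S x)"
    proof
      assume "\<forall>x<b0. \<not> S x"
      then have "\<forall>x. S x \<longrightarrow> b0 \<le> x" by (meson not_le)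
      then show False using unbounded(3) by blast
    qed
    then have b0': "\<forall>x<b0. S x" using b0 by blast
    \<comment> \<open>The bound 0 keeps the supremum finite even when \<open>S\<close> is the whole
      line.\<close>
    define D where "D b \<longleftrightarrow> b \<le> 0 \<and> (\<forall>x. x < b \<longrightarrow> S x)" for b
    have "D (min b0 0)" unfolding D_def using b0' by simp
    moreover have "dset {d. D d}" unfolding D_def by (intro dsetI dfn_intros dS)
    moreover have "d \<le> 0" if "D d" for d using that unfolding D_def by blast
    ultimately obtain b where b: "is_lub D b" by (rule_tac dset_is_lub[of D])
    have "b + - q < b" using add_less(1)[of b "- q" 0] add_less(1)[of q "- q" 0] q by simp
    then obtain v where v: "D v" "b + - q < v" using b unfolding is_lub_def by (meson not_le)
    then have "S (b + - q)" unfolding D_def by blast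
    moreover have "choice_rel q S (b + - q)"
      using b unbounded unfolding choice_rel_def D_def by auto
    ultimately show ?thesis by blast
  qed
qed

lemma choice_rel_unique: "choice_rel q S y \<Longrightarrow> choice_rel q S y' \<Longrightarrow> y = y'"
proof -
  assume *: "choice_rel q S y" "choice_rel q S y'"
  consider (empty) "\<not> (\<exists>x. S x)"
    | (min) "\<exists>x. S x" "\<exists>x. S x \<and> (\<forall>z. S z \<longrightarrow> x \<le> z)"
    | (below) "\<exists>x. S x" "\<not> (\<exists>x. S x \<and> (\<forall>z. S z \<longrightarrow> x \<le> z))" "\<exists>a. \<forall>x. S x \<longrightarrow> a \<le> x"
    | (unbounded) "\<exists>x. S x" "\<not> (\<exists>x. S x \<and> (\<forall>z. S z \<longrightarrow> x \<le> z))" "\<not> (\<exists>a. \<forall>x. S x \<longrightarrow> a \<le> x)"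
    by blast
  then show ?thesis
  proof cases
    case empty
    with * show ?thesis unfolding choice_rel_def by simp
  next
    case min
    with * have "S y \<and> (\<forall>z. S z \<longrightarrow> y \<le> z)" "S y' \<and> (\<forall>z. S z \<longrightarrow> y' \<le> z)"
      unfolding choice_rel_def by presburger+
    then show ?thesis by (blast intro: antisym)
  next
    case below
    with * have "\<exists>a d. is_glb S a \<and> is_lub (\<lambda>d. 0 < d \<and> d \<le> q \<and> (\<forall>x. a < x \<and> x \<le> a + d + d \<longrightarrow> S x)) d \<and> y = a + d"
      "\<exists>a d. is_glb S a \<and> is_lub (\<lambda>d. 0 < d \<and> d \<le> q \<and> (\<forall>x. a < x \<and> x \<le> a + d + d \<longrightarrow> S x)) d \<and> y' = a + d"
      unfolding choice_rel_def by presburger+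
    then obtain a d a' d' where
      "is_glb S a" "is_lub (\<lambda>d. 0 < d \<and> d \<le> q \<and> (\<forall>x. a < x \<and> x \<le> a + d + d \<longrightarrow> S x)) d" "y = a + d"
      "is_glb S a'" "is_lub (\<lambda>d. 0 < d \<and> d \<le> q \<and> (\<forall>x. a' < x \<and> x \<le> a' + d + d \<longrightarrow> S x)) d'" "y' = a' + d'"
      by blast
    moreover from this have "a' = a" using is_glb_unique by blast
    ultimately show ?thesis using is_lub_unique by blast
  next
    case unbounded
    with * have "\<exists>b. is_lub (\<lambda>b. b \<le> 0 \<and> (\<forall>x. x < b \<longrightarrow> S x)) b \<and> y = b + - q"
      "\<exists>b. is_lub (\<lambda>b. b \<le> 0 \<and> (\<forall>x. x < b \<longrightarrow> S x)) b \<and> y' = b + - q"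
      unfolding choice_rel_def by presburger+
    then show ?thesis using is_lub_unique by blast
  qed
qed

lemma definable_choice1:
  assumes P: "dfn M (\<lambda>e. P (\<lambda>i. e (Suc i)) (e 0))"
  obtains t where "dt M t" "\<forall>e. (\<exists>x. P e x) \<longrightarrow> P e (t e)"
proof -
  obtain q :: 'a where q: "0 < q" using gt_ex by blast
  have dP: "dfn M (\<lambda>e. P (\<sigma> e) (s e))" if "dte M \<sigma>" "dt M s" for \<sigma> s
    using dfn_subst[OF P dte_case[OF that(2,1)]] by simp
  \<comment> \<open>The arbitrary choice is only apparent: \<open>choice_rel\<close> has exactly one
    solution, so it is the graph of \<open>t\<close>, and it is definable.\<close>
  define t where "t e = (SOME y. choice_rel q (P e) y \<and> ((\<exists>x. P e x) \<longrightarrow> P e y))" for e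
  have t: "choice_rel q (P e) (t e) \<and> ((\<exists>x. P e x) \<longrightarrow> P e (t e))" for e
    unfolding t_def by (rule someI_ex, rule choice_rel_spec[OF dset_at[OF P] q])
  have "dt M t"
  proof (rule dt_graph)
    show "dfn M (\<lambda>e. choice_rel q (P (\<lambda>i. e (Suc i))) (e 0))"
      unfolding choice_rel_def is_lub_def is_glb_def if_bool_eq_disj by (intro dfn_intros dP)
    show "y = t e \<longleftrightarrow> choice_rel q (P e) y" for e y
      using t choice_rel_unique by blast
  qed
  then show ?thesis using that t by blast
qed

text \<open>One coordinate at a time: choose a head for which some tail exists, then a tail for that
  head.\<close>

lemma definable_choice:
  assumes "dfn M (\<lambda>e. P (\<lambda>i. e (i + m)) (map (\<lambda>i. e i) [0..<m]))"
  shows "\<exists>f. dtl M m f \<and> (\<forall>e. (\<exists>u. length u = m \<and> P e u) \<longrightarrow> P e (f e))"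
  using assms
proof (induction m arbitrary: P)
  case 0
  show ?case by (intro exI[of _ "\<lambda>e. []"] conjI dtl_Nil) simp
next
  case (Suc m)
  have dP: "dfn M (\<lambda>e. P (\<sigma> e) (f e))" if "dte M \<sigma>" "dtl M (Suc m) f" for \<sigma> f
    by (rule dfn_list[OF Suc.prems that])
  have "dfn M (\<lambda>e. \<exists>u. length u = m \<and> P (\<lambda>i. e (Suc i)) (e 0 # u))"
    by (intro dfn_intros dP)
  then obtain t where t: "dt M t" "\<forall>e. (\<exists>x u. length u = m \<and> P e (x # u)) \<longrightarrow> (\<exists>u. length u = m \<and> P e (t e # u))"
    by (rule definable_choice1)
  have "dfn M (\<lambda>e. P (\<lambda>i. e (i + m)) (t (\<lambda>i. e (i + m)) # map (\<lambda>i. e i) [0..<m]))"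
    by (intro dfn_intros dP dt_shift[OF t(1)])
  from Suc.IH[of "\<lambda>e u. P e (t e # u)", OF this]
  obtain f where f: "dtl M m f" "\<forall>e. (\<exists>u. length u = m \<and> P e (t e # u)) \<longrightarrow> P e (t e # f e)" by blast
  show ?case
  proof (intro exI[of _ "\<lambda>e. t e # f e"] conjI allI impI)
    show "dtl M (Suc m) (\<lambda>e. t e # f e)" by (intro dtl_Cons t f)
    fix e assume "\<exists>u. length u = Suc m \<and> P e u"
    then obtain u where "length u = Suc m" "P e u" by blast
    then have "\<exists>x u. length u = m \<and> P e (x # u)" by (cases u) auto
    then show "P e (t e # f e)" using t(2) f(2) by blast
  qed
qed

end

section \<open>Cofinal maps, poles of fields and neighbourhood bases\<close>

text \<open>Exhausting the family of singletons covers \<open>R^m\<close> by the sets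
  \<open>D s t\<close>, and \<open>g s t\<close> is a definably chosen lower bound of the part of
  \<open>D s t\<close> inside \<open>\<Omega>\<close>. Each \<open>u\<close> lies in
  \<open>D s t\<close> for all small \<open>s\<close> and large \<open>t\<close>.\<close>

lemma (in directed_in_omin) definable_cofinal_map:
  obtains g where "\<forall>s>0. \<forall>t>0. g s t \<in> \<Omega>"
    "\<forall>u\<in>\<Omega>. \<exists>s0>0. \<exists>t0>0. \<forall>s>0. \<forall>t>0. s \<le> s0 \<and> t0 \<le> t \<longrightarrow> le (g s t) u"
    "\<forall>s t. dt M s \<longrightarrow> dt M t \<longrightarrow> dtl M m (\<lambda>e. g (s e) (t e))"
proof -
  define D where "D s t l \<longleftrightarrow> exhaustion m (\<lambda>y u. y = u) s t l" for s t l
  have D: "dfn M (\<lambda>e. D (s e) (t e) (f e))" if "dt M s" "dt M t" "dtl M m f" for s t f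
    unfolding D_def
    by (rule exhaustion_dfn[of m "\<lambda>_ y u. y = u", OF _ dte_id(1) that]) (intro allI impI dfn_list_eq)
  have "bdd (\<lambda>u. l = u)" if "length l = m" for l
    using bdd_empty le_refl unfolding bdd_def by (cases "l \<in> \<Omega>") auto
  with exhaustion_covers_and_bdd[of m "\<lambda>y u. y = u"]
  have ex: "\<forall>l. length l = m \<longrightarrow> (\<exists>s>0. \<exists>t>0. D s t l)"
    and b: "\<forall>s>0. \<forall>t>0. bdd (\<lambda>u. \<exists>l. length l = m \<and> D s t l \<and> l = u)"
    unfolding D_def using dfn_list_eq by blast+
  define P where "P e u \<longleftrightarrow> u \<in> \<Omega> \<and> (\<forall>v\<in>\<Omega>. D (e 0) (e 1) v \<longrightarrow> le u v)" for e :: "nat \<Rightarrow> 'a" and u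
  have "dfn M (\<lambda>e. P (\<lambda>i. e (i + m)) (map (\<lambda>i. e i) [0..<m]))"
    unfolding P_def by (intro dfn_intros D d\<Omega> dle)
  from definable_choice[OF this] obtain f where f: "dtl M m f"
    "\<forall>e. (\<exists>u. length u = m \<and> P e u) \<longrightarrow> P e (f e)" by blast
  \<comment> \<open>\<open>P\<close> reads variables 0 and 1 only, so all later variables may also
    be set to \<open>t\<close>.\<close>
  define g where "g s t = f (case_nat s (\<lambda>_. t))" for s t
  have g: "g s t \<in> \<Omega> \<and> (\<forall>v\<in>\<Omega>. D s t v \<longrightarrow> le (g s t) v)" if st: "0 < s" "0 < t" for s t
  proof -
    obtain w where w: "w \<in> \<Omega>" "\<forall>u\<in>\<Omega>. (\<exists>l. length l = m \<and> D s t l \<and> l = u) \<longrightarrow> le w u"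
      using b[rule_format, OF st] unfolding bdd_def by blast
    then have "P (case_nat s (\<lambda>_. t)) w" unfolding P_def using len by simp
    then have "P (case_nat s (\<lambda>_. t)) (g s t)" unfolding g_def using f(2) len[OF w(1)] by blast
    then show ?thesis unfolding P_def by simp
  qed
  show ?thesis
  proof (rule that[of g])
    show "\<forall>s>0. \<forall>t>0. g s t \<in> \<Omega>" using g by blast
    show "\<forall>u\<in>\<Omega>. \<exists>s0>0. \<exists>t0>0. \<forall>s>0. \<forall>t>0. s \<le> s0 \<and> t0 \<le> t \<longrightarrow> le (g s t) u"
    proof
      fix u assume u: "u \<in> \<Omega>"
      then obtain s0 t0 where st: "0 < s0" "0 < t0" "D s0 t0 u" using ex len by blast
      have "D s t u" if "s \<le> s0" "t0 \<le> t" for s t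
        using exhaustion_mono[OF that] st(3) unfolding D_def by blast
      then show "\<exists>s0>0. \<exists>t0>0. \<forall>s>0. \<forall>t>0. s \<le> s0 \<and> t0 \<le> t \<longrightarrow> le (g s t) u"
        using st(1,2) g u by blast
    qed
    show "\<forall>s t. dt M s \<longrightarrow> dt M t \<longrightarrow> dtl M m (\<lambda>e. g (s e) (t e))"
      unfolding g_def
    proof (intro allI impI dtl_subst[OF f(1)] dte_case)
      fix t assume "dt M t"
      then show "dte M (\<lambda>e _. t e)" unfolding dte_def by blast
    qed
  qed
qed

section \<open>A definable function with a pole, from a definable field\<close>

lemma real_closed_ordered_field_axioms:
  assumes "real_closed_ordered_field (field_on ad mu z e)"
  obtains ng where
    "\<forall>x y w. ad (ad x y) w = ad x (ad y w)" "\<forall>x y. ad x y = ad y x" "\<forall>x. ad z x = x"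
    "\<forall>x. ad x (ng x) = z" "\<forall>x y. mu x y = mu y x" "\<forall>x. mu e x = x"
    "\<forall>x y w. mu (ad x y) w = ad (mu x w) (mu y w)" "\<forall>x. mu z x = z"
    "\<forall>x. x \<noteq> z \<longrightarrow> (\<exists>y. mu x y = e)" "e \<noteq> z"
    "\<forall>x y w. mu (mu x y) w = mu x (mu y w)"
    "\<forall>x y w. x < y \<longrightarrow> ad x w < ad y w" "\<forall>x y. z < x \<longrightarrow> z < y \<longrightarrow> z < mu x y"
proof -
  let ?F = "field_on ad mu z e"
  have F: "field ?F"
    and ord: "\<forall>x y w. x < y \<longrightarrow> ad x w < ad y w" "\<forall>x y. z < x \<longrightarrow> z < y \<longrightarrow> z < mu x y"
    using assms unfolding real_closed_ordered_field_def by (simp_all add: field_on_def)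
  interpret F: field ?F by (rule F)
  have c: "x \<in> carrier ?F" for x by (simp add: field_on_def)
  have ops: "add ?F = ad" "mult ?F = mu" "zero ?F = z" "one ?F = e"
    by (simp_all add: field_on_def)
  note ax = F.a_assoc[OF c c c, unfolded ops] F.a_comm[OF c c, unfolded ops] F.l_zero[OF c, unfolded ops]
    F.r_neg[OF c, unfolded ops] F.m_comm[OF c c, unfolded ops] F.l_one[OF c, unfolded ops]
    F.l_distr[OF c c c, unfolded ops] F.l_null[OF c, unfolded ops] F.m_assoc[OF c c c, unfolded ops]
  have inv: "\<exists>y. mu x y = e" if "x \<noteq> z" for x
  proof -
    have "x \<in> Units ?F" using F.field_Units that c ops by auto
    from F.Units_r_inv[OF this] show ?thesis unfolding ops by blast
  qed
  show ?thesis
    by (rule that[of "a_inv ?F"]; (intro allI, rule ax | rule ord F.one_not_zero[unfolded ops])?)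
      (use inv in blast)
qed

context omin
begin

text \<open>The function is the field reciprocal, moved so that its pole sits at the group's zero
  and cut off from below to stay positive for the group.\<close>

lemma field_pole:
  assumes "expands_ordered_field M"
  obtains b where "\<forall>t. dt M t \<longrightarrow> dt M (\<lambda>e. b (t e))" "\<forall>r. (0::'a) < b r"
    "\<forall>T. \<exists>r0>0. \<forall>r>0. r \<le> r0 \<longrightarrow> T \<le> b r"
proof -
  obtain ad mu z e where dad: "definable M 3 {[x, y, ad x y] |x y. True}"
    and dmu: "definable M 3 {[x, y, mu x y] |x y. True}"
    and F: "real_closed_ordered_field (field_on ad mu z e)"
    using assms unfolding expands_ordered_field_def by blast
  obtain ng where ax: "\<forall>x y w. ad (ad x y) w = ad x (ad y w)" "\<forall>x y. ad x y = ad y x"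
    "\<forall>x. ad z x = x" "\<forall>x. ad x (ng x) = z" "\<forall>x y. mu x y = mu y x" "\<forall>x. mu e x = x"
    "\<forall>x y w. mu (ad x y) w = ad (mu x w) (mu y w)" "\<forall>x. mu z x = z"
    "\<forall>x. x \<noteq> z \<longrightarrow> (\<exists>y. mu x y = e)" and one_zero: "e \<noteq> z"
    and ax': "\<forall>x y w. mu (mu x y) w = mu x (mu y w)"
    "\<forall>x y w. x < y \<longrightarrow> ad x w < ad y w" "\<forall>x y. z < x \<longrightarrow> z < y \<longrightarrow> z < mu x y"
    by (rule real_closed_ordered_field_axioms[OF F])
  note a_assoc = ax(1)[rule_format] and a_comm = ax(2)[rule_format] and l_zero = ax(3)[rule_format]
    and r_neg = ax(4)[rule_format] and m_comm = ax(5)[rule_format] and l_one = ax(6)[rule_format]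
    and l_distr = ax(7)[rule_format] and l_null = ax(8)[rule_format] and inv = ax(9)[rule_format]
    and m_assoc = ax'(1)[rule_format] and ad_less = ax'(2)[rule_format] and mu_pos = ax'(3)[rule_format]
  obtain q :: 'a where q: "0 < q" using gt_ex by blast
  have mu_less: "mu x w < mu y w" if "x < y" "z < w" for x y w
  proof -
    have "z < ad y (ng x)" using ad_less[OF that(1), of "ng x"] by (simp add: r_neg)
    then have "z < mu (ad y (ng x)) w" using that(2) by (rule mu_pos)
    then have "ad z (mu x w) < ad (mu (ad y (ng x)) w) (mu x w)" by (rule ad_less)
    moreover have "ad (ad y (ng x)) x = y" by (metis a_assoc a_comm l_zero r_neg)
    ultimately show ?thesis by (simp add: l_zero l_distr[symmetric])
  qed
  have one_pos: "z < e"
  proof (rule ccontr)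
    assume "\<not> z < e"
    then have "e < z" using one_zero by simp
    then have "z < ng e" using ad_less[of e z "ng e"] by (simp add: r_neg l_zero)
    from mu_less[OF \<open>e < z\<close> this] have "ng e < z" by (simp add: l_one l_null)
    with \<open>z < ng e\<close> show False by simp
  qed
  \<comment> \<open>For \<open>r > 0\<close>, \<open>d\<close> is the field difference of
    \<open>r\<close> and the group's \<open>0\<close>, which may differ from the field's zero
    \<open>z\<close>, and \<open>c\<close> is the reciprocal of \<open>d\<close>. The value is the
    maximum of \<open>q\<close> and \<open>c\<close>; for other \<open>r\<close> it is
    \<open>q\<close> by default.\<close>
  define Q where "Q r y \<longleftrightarrow> (0 < r \<and> (\<exists>d c. ad 0 d = r \<and> mu d c = e \<and> (q \<le> c \<and> y = c \<or> c < q \<and> y = q)))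
    \<or> \<not> 0 < r \<and> y = q" for r y
  have shift: "\<exists>d. ad 0 d = r \<and> z < d" if "0 < r" for r
  proof -
    define d where "d = ad (ng 0) r"
    have "ad 0 d = r" unfolding d_def by (simp add: a_assoc[symmetric] r_neg l_zero)
    moreover have "z < d" unfolding d_def using ad_less[OF that, of "ng 0"]
      by (simp add: r_neg a_comm[of r])
    ultimately show ?thesis by blast
  qed
  have cancel: "d = d'" if "ad 0 d = ad 0 d'" for d d'
    by (metis that a_assoc a_comm l_zero r_neg)
  have inv_unique: "c = c'" if "mu d c = e" "mu d c' = e" for d c c'
    by (metis that m_assoc m_comm l_one)
  have exQ: "\<exists>y. Q r y" for r
  proof (cases "0 < r")
    case True
    then obtain d where d: "ad 0 d = r" "z < d" using shift by blast
    obtain c where "mu d c = e" using inv[of d] d(2) by auto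
    with d True show ?thesis unfolding Q_def by (metis not_le)
  qed (simp add: Q_def)
  define b where "b r = (SOME y. Q r y)" for r
  have Qb: "Q r (b r)" for r unfolding b_def by (rule someI_ex[OF exQ])
  have Q_unique: "y = y'" if "Q r y" "Q r y'" for r y y'
  proof (cases "0 < r")
    case True
    with that obtain d c d' c' where "ad 0 d = r" "mu d c = e" "q \<le> c \<and> y = c \<or> c < q \<and> y = q"
      "ad 0 d' = r" "mu d' c' = e" "q \<le> c' \<and> y' = c' \<or> c' < q \<and> y' = q"
      unfolding Q_def by blast
    moreover from this have "d' = d" using cancel by simp
    moreover from calculation have "c' = c" using inv_unique by blast
    ultimately show ?thesis by auto
  qed (use that in \<open>simp add: Q_def\<close>)
  have ge: "q \<le> b r" for r using Qb[of r] unfolding Q_def by auto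
  have "\<exists>r0>0. \<forall>r>0. r \<le> r0 \<longrightarrow> T \<le> b r" for T
  proof -
    \<comment> \<open>Raising \<open>T\<close> to at least \<open>e\<close> makes it positive in the
      field, so it has a positive reciprocal \<open>d0\<close>. A field difference at most
      \<open>d0\<close> then has a reciprocal at least \<open>T'\<close>.\<close>
    define T' where "T' = max T e"
    have T': "z < T'" unfolding T'_def using one_pos by (simp add: less_max_iff_disj)
    obtain d0 where d0: "mu T' d0 = e" using inv[of T'] T' by auto
    have "z < d0"
    proof (rule ccontr)
      assume "\<not> z < d0"
      moreover have "d0 \<noteq> z" using d0 one_zero l_null m_comm by metis
      ultimately have "d0 < z" by simp
      from mu_less[OF this T'] have "e < z" using d0 m_comm l_null by metis
      then show False using one_pos by simp
    qed
    define r0 where "r0 = ad 0 d0"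
    have "0 < r0" unfolding r0_def using ad_less[OF \<open>z < d0\<close>, of 0] by (simp add: l_zero a_comm[of d0])
    moreover have "T \<le> b r" if r: "0 < r" "r \<le> r0" for r
    proof -
      obtain d c where dc: "ad 0 d = r" "mu d c = e" "q \<le> c \<and> b r = c \<or> c < q \<and> b r = q"
        using Qb[of r] r(1) unfolding Q_def by blast
      have "z < d" using shift[OF r(1)] dc(1) cancel by metis
      have "d \<le> d0"
      proof (rule ccontr)
        assume "\<not> d \<le> d0"
        then have "d0 < d" by simp
        from ad_less[OF this, of 0] have "r0 < r" unfolding r0_def using dc(1) a_comm by metis
        then show False using r(2) by simp
      qed
      have "T' \<le> c"
      proof (rule ccontr)
        assume "\<not> T' \<le> c"
        then have "c < T'" by simp
        from mu_less[OF this \<open>z < d\<close>] have "e < mu T' d" using dc(2) m_comm by metis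
        moreover have "mu T' d \<le> e"
        proof (cases "d = d0")
          case False
          then have "d < d0" using \<open>d \<le> d0\<close> by simp
          from mu_less[OF this T'] show ?thesis using d0 m_comm less_imp_le by metis
        qed (simp add: d0)
        ultimately show False by simp
      qed
      moreover have "T \<le> T'" unfolding T'_def by simp
      moreover have "c \<le> b r" using dc(3) by auto
      ultimately show ?thesis by (meson order_trans)
    qed
    ultimately show ?thesis by blast
  qed
  moreover have "dt M (\<lambda>e. b (t e))" if t: "dt M t" for t
  proof -
    have mem: "[x, y, w] \<in> {[x, y, f x y] |x y. True} \<longleftrightarrow> f x y = w" for x y w :: 'a and f
      by auto
    have three: "dtl M 3 (\<lambda>e. [x e, y e, w e])" if "dt M x" "dt M y" "dt M w" for x y w
      unfolding numeral_3_eq_3 by (intro dfn_intros that)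
    have A: "dfn M (\<lambda>e. ad (x e) (y e) = w e)" if "dt M x" "dt M y" "dt M w" for x y w
      using dfn_mem[OF dad three[OF that]] unfolding mem .
    have Mu: "dfn M (\<lambda>e. mu (x e) (y e) = w e)" if "dt M x" "dt M y" "dt M w" for x y w
      using dfn_mem[OF dmu three[OF that]] unfolding mem .
    show ?thesis
    proof (rule dt_graph)
      show "dfn M (\<lambda>e. Q (t (\<lambda>i. e (Suc i))) (e 0))" unfolding Q_def
        by (intro dfn_intros A Mu dt_shift[OF t])
      show "y = b (t e) \<longleftrightarrow> Q (t e) y" for e y using Qb Q_unique by blast
    qed
  qed
  moreover have "0 < b r" for r using q ge by (rule less_le_trans)
  ultimately show ?thesis using that[of b] by blast
qed

section \<open>Index sets and reindexing of definable families\<close>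

lemma definable_positive_pairs: "definable M 2 {[s, t] |s t. 0 < s \<and> 0 < (t::'a)}"
proof -
  have "map (\<lambda>i. e i) [0..<2] \<in> {[s, t] |s t. 0 < s \<and> 0 < t} \<longleftrightarrow> 0 < e 0 \<and> 0 < e 1" for e :: "nat \<Rightarrow> 'a"
    by (simp add: numeral_2_eq_2)
  moreover have "dfn M (\<lambda>e. 0 < e 0 \<and> 0 < e 1)" by (intro dfn_intros)
  ultimately show ?thesis unfolding definable_iff_dfn by (simp only:) auto
qed

lemma definable_positives: "definable M 1 {[t] |t. 0 < (t::'a)}"
proof -
  have "map (\<lambda>i. e i) [0..<1] \<in> {[t] |t. 0 < t} \<longleftrightarrow> 0 < e 0" for e :: "nat \<Rightarrow> 'a"
    by simp
  moreover have "dfn M (\<lambda>e. 0 < e 0)" by (intro dfn_intros)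
  ultimately show ?thesis unfolding definable_iff_dfn by (simp only:) auto
qed

text \<open>Over \<open>P\<close>, the new total set is the preimage of the old one under the
  definable map from \<open>(u, y)\<close> to \<open>(h u, y)\<close>; the lengths determine where a
  concatenated list splits.\<close>

lemma definable_family_reindex:
  assumes B: "definable_family M m n \<Omega> B" and P: "definable M p P"
    and h: "dtl M m (\<lambda>e. h (map (\<lambda>i. e i) [0..<p]))" "\<forall>u\<in>P. h u \<in> \<Omega>"
  shows "definable_family M p n P (\<lambda>u. B (h u))"
  unfolding definable_family_def
proof (intro conjI P ballI)
  have lenB: "\<forall>u\<in>\<Omega>. \<forall>y\<in>B u. length y = n"
    and G: "definable M (m + n) {u @ y |u y. u \<in> \<Omega> \<and> y \<in> B u}"
    and O: "definable M m \<Omega>"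
    using B unfolding definable_family_def by blast+
  show "length y = n" if "u \<in> P" "y \<in> B (h u)" for u y using that lenB h(2) by blast
  have lenP: "\<forall>u\<in>P. length u = p" and lenO: "\<forall>u\<in>\<Omega>. length u = m"
    using P O unfolding definable_iff_dfn by blast+
  have "map (\<lambda>i. e i) [0..<p + n] \<in> {u @ y |u y. u \<in> P \<and> y \<in> B (h u)} \<longleftrightarrow>
      map (\<lambda>i. e i) [0..<p] \<in> P \<and>
      h (map (\<lambda>i. e i) [0..<p]) @ map (\<lambda>i. e (i + p)) [0..<n] \<in> {u @ y |u y. u \<in> \<Omega> \<and> y \<in> B u}"
    (is "?L \<longleftrightarrow> ?R") for e
  proof -
    have *: "map (\<lambda>i. e i) [0..<p + n] = map (\<lambda>i. e i) [0..<p] @ map (\<lambda>i. e (i + p)) [0..<n]"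
      by (rule nth_equalityI) (auto simp: nth_append)
    show ?thesis
    proof
      assume ?L
      then obtain u y where uy: "map (\<lambda>i. e i) [0..<p + n] = u @ y" "u \<in> P" "y \<in> B (h u)" by blast
      then have "map (\<lambda>i. e i) [0..<p] = u \<and> map (\<lambda>i. e (i + p)) [0..<n] = y"
        using lenP unfolding * by (subst (asm) append_eq_append_conv) auto
      then show ?R using uy h(2) by blast
    next
      assume R: ?R
      then obtain v y where vy: "h (map (\<lambda>i. e i) [0..<p]) @ map (\<lambda>i. e (i + p)) [0..<n] = v @ y"
        "v \<in> \<Omega>" "y \<in> B v" by blast
      have "length (h (map (\<lambda>i. e i) [0..<p])) = length v" using R h(2) lenO vy(2) by simp
      then have "h (map (\<lambda>i. e i) [0..<p]) = v \<and> map (\<lambda>i. e (i + p)) [0..<n] = y"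
        using vy(1) by (subst (asm) append_eq_append_conv) auto
      then show ?L unfolding * using R vy by blast
    qed
  qed
  moreover have "dfn M (\<lambda>e. map (\<lambda>i. e i) [0..<p] \<in> P \<and>
      h (map (\<lambda>i. e i) [0..<p]) @ map (\<lambda>i. e (i + p)) [0..<n] \<in> {u @ y |u y. u \<in> \<Omega> \<and> y \<in> B u})"
    by (intro dfn_conj dfn_mem[OF P] dfn_mem[OF G] dtl_append h(1) dtl_map dt_var)
  ultimately show "definable M (p + n) {u @ y |u y. u \<in> P \<and> y \<in> B (h u)}"
    unfolding definable_iff_dfn using lenP lenB h(2) by (simp only:) auto
qed

end

text \<open>The basic sets around \<open>x\<close> are directed under inclusion because the
  intersection of two of them is an open set around \<open>x\<close>, so
  \<open>definable_cofinal_map\<close> applies to their indices.\<close>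

lemma (in omin) definable_neighbourhood_basis:
  assumes B: "definable_family M m n \<Omega> B" and lenT: "\<forall>x\<in>topspace T. length x = n"
    and T: "openin T = arbitrary union_of (\<lambda>U. U \<in> B ` \<Omega>)" and x: "x \<in> topspace T"
  obtains g where "\<forall>s>0. \<forall>t>0. g s t \<in> \<Omega> \<and> nhd T x (B (g s t))"
    "\<forall>N. nhd T x N \<longrightarrow> (\<exists>s0>0. \<exists>t0>0. \<forall>s>0. \<forall>t>0. s \<le> s0 \<and> t0 \<le> t \<longrightarrow> B (g s t) \<subseteq> N)"
    "\<forall>s t. dt M s \<longrightarrow> dt M t \<longrightarrow> dtl M m (\<lambda>e. g (s e) (t e))"
proof -
  define G where "G = {u @ y |u y. u \<in> \<Omega> \<and> y \<in> B u}"
  have dO: "definable M m \<Omega>" and lenB: "\<forall>u\<in>\<Omega>. \<forall>y\<in>B u. length y = n"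
    and dG: "definable M (m + n) G"
    using B unfolding definable_family_def G_def by blast+
  have lenO: "\<forall>u\<in>\<Omega>. length u = m" using dO unfolding definable_iff_dfn by blast
  have G: "u @ y \<in> G \<longleftrightarrow> y \<in> B u" if "u \<in> \<Omega>" for u y
  proof
    assume "u @ y \<in> G"
    then obtain v z where vz: "u @ y = v @ z" "v \<in> \<Omega>" "z \<in> B v" unfolding G_def by blast
    moreover have "length u = length v" using lenO that vz(2) by simp
    ultimately show "y \<in> B u" by simp
  qed (use that G_def in blast)
  have openB: "openin T (B u)" if "u \<in> \<Omega>" for u
    unfolding T by (rule union_of_inc) (use that in \<open>auto simp: arbitrary_def\<close>)
  have basis: "\<exists>u\<in>\<Omega>. x \<in> B u \<and> B u \<subseteq> U" if "openin T U" "x \<in> U" for U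
    using that unfolding T union_of_def by blast
  define Om where "Om = {u \<in> \<Omega>. x \<in> B u}"
  \<comment> \<open>Inclusion is expressed through the total set \<open>G\<close> to be definable on
    all lists, as the values of \<open>B\<close> outside \<open>\<Omega>\<close> are arbitrary; on
    \<open>\<Omega>\<close> it is inclusion of the sets \<open>B u\<close>.\<close>
  define le where "le u v \<longleftrightarrow> (\<forall>y. length y = n \<longrightarrow> u @ y \<in> G \<longrightarrow> v @ y \<in> G)" for u v
  have le: "le u v \<longleftrightarrow> B u \<subseteq> B v" if "u \<in> \<Omega>" "v \<in> \<Omega>" for u v
    unfolding le_def using G that lenB by blast
  interpret directed_in_omin M m Om le
  proof
    show "length u = m" if "u \<in> Om" for u using that lenO unfolding Om_def by blast
    show "dfn M (\<lambda>e. f e \<in> Om)" if f: "dtl M m f" for f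
    proof -
      have "dfn M (\<lambda>e. f e \<in> \<Omega> \<and> f e @ x \<in> G)"
        by (intro dfn_conj dfn_mem[OF dO f] dfn_mem[OF dG] dtl_append f dtl_const) (use lenT x in blast)
      moreover have "f e \<in> \<Omega> \<and> f e @ x \<in> G \<longleftrightarrow> f e \<in> Om" for e
        using G unfolding Om_def by blast
      ultimately show ?thesis by (simp only:)
    qed
    show "dfn M (\<lambda>e. le (f e) (g e))" if "dtl M m f" "dtl M m g" for f g
      unfolding le_def
      by (intro dfn_list_all dfn_imp dfn_mem[OF dG] dtl_append dtl_map dt_var
        dtl_shift[OF that(1)] dtl_shift[OF that(2)])
    show "le u u" for u unfolding le_def by blast
    show "le u w" if "le u v" "le v w" for u v w using that unfolding le_def by blast
    show "\<exists>w\<in>Om. le w u \<and> le w v" if u: "u \<in> Om" and v: "v \<in> Om" for u v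
    proof -
      have "openin T (B u \<inter> B v)" "x \<in> B u \<inter> B v"
        using u v openB unfolding Om_def by auto
      then obtain w where "w \<in> \<Omega>" "x \<in> B w" "B w \<subseteq> B u \<inter> B v" using basis by blast
      then show ?thesis using u v le unfolding Om_def by blast
    qed
    show "Om \<noteq> {}" using basis[OF openin_topspace x] unfolding Om_def by blast
  qed
  obtain g where g: "\<forall>s>0. \<forall>t>0. g s t \<in> Om"
    "\<forall>u\<in>Om. \<exists>s0>0. \<exists>t0>0. \<forall>s>0. \<forall>t>0. s \<le> s0 \<and> t0 \<le> t \<longrightarrow> le (g s t) u"
    "\<forall>s t. dt M s \<longrightarrow> dt M t \<longrightarrow> dtl M m (\<lambda>e. g (s e) (t e))"
    by (rule definable_cofinal_map)
  show ?thesis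
  proof (rule that[OF _ _ g(3)]; intro allI impI)
    fix s t :: 'a assume "0 < s" "0 < t"
    then have "g s t \<in> Om" using g(1) by blast
    then show "g s t \<in> \<Omega> \<and> nhd T x (B (g s t))"
      using openB openin_subset unfolding Om_def nhd_def by blast
  next
    fix N assume "nhd T x N"
    then obtain U where U: "openin T U" "x \<in> U" "U \<subseteq> N" unfolding nhd_def by blast
    from basis[OF U(1,2)] U(3) obtain u where u: "u \<in> Om" "B u \<subseteq> N" unfolding Om_def by auto
    then obtain s0 t0 where st: "0 < s0" "0 < t0"
      "\<forall>s>0. \<forall>t>0. s \<le> s0 \<and> t0 \<le> t \<longrightarrow> le (g s t) u" using g(2) by blast
    have "B (g s t) \<subseteq> N" if "0 < s" "0 < t" "s \<le> s0 \<and> t0 \<le> t" for s t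
    proof -
      have "le (g s t) u" "g s t \<in> \<Omega>" "u \<in> \<Omega>" using st(3) g(1) that u(1) unfolding Om_def by blast+
      then show ?thesis using le u(2) by blast
    qed
    then show "\<exists>s0>0. \<exists>t0>0. \<forall>s>0. \<forall>t>0. s \<le> s0 \<and> t0 \<le> t \<longrightarrow> B (g s t) \<subseteq> N" using st by blast
  qed
qed

theorem theorem6p4:
  fixes M :: "('f, 'r, 'a::{group_add, unbounded_dense_linorder}) expansion"
    and n :: nat and T :: "'a list topology" and \<B> :: "'a list set set"
  assumes "ominimal_ordered_group M"
    and "definable_topological_space M n T \<B>"
  shows
    "(\<forall>x\<in>topspace T. \<exists>A.
        definable_family M 2 n {[s, t] |s t. 0 < s \<and> 0 < t} A \<and>
        A ` {[s, t] |s t. 0 < s \<and> 0 < t} \<subseteq> \<B> \<and>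
        nhd_basis T x (A ` {[s, t] |s t. 0 < s \<and> 0 < t}) \<and>
        (\<forall>N. nhd T x N \<longrightarrow>
          (\<exists>s\<^sub>N>0. \<exists>t\<^sub>N>0. \<forall>s>0. \<forall>t>0. s \<le> s\<^sub>N \<and> t\<^sub>N \<le> t \<longrightarrow> A [s, t] \<subseteq> N)))
     \<and>
     (expands_ordered_field M \<longrightarrow>
      (\<forall>x\<in>topspace T. \<exists>A.
        definable_family M 1 n {[t] |t. 0 < t} A \<and>
        A ` {[t] |t. 0 < t} \<subseteq> \<B> \<and>
        nhd_basis T x (A ` {[t] |t. 0 < t}) \<and>
        (\<forall>N. nhd T x N \<longrightarrow> (\<exists>t\<^sub>N>0. \<forall>t>0. t \<le> t\<^sub>N \<longrightarrow> A [t] \<subseteq> N))))"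
proof -
  interpret omin M by unfold_locales (rule assms(1))
  obtain m \<Omega> B where B: "definable_family M m n \<Omega> B" and BB: "\<B> = B ` \<Omega>"
    and lenT: "\<forall>x\<in>topspace T. length x = n" and T: "openin T = arbitrary union_of (\<lambda>U. U \<in> B ` \<Omega>)"
    using assms(2) unfolding definable_topological_space_def by blast
  show ?thesis
  proof (intro conjI impI ballI)
    fix x assume x: "x \<in> topspace T"
    obtain g where g: "\<forall>s>0. \<forall>t>0. g s t \<in> \<Omega> \<and> nhd T x (B (g s t))"
      "\<forall>N. nhd T x N \<longrightarrow> (\<exists>s0>0. \<exists>t0>0. \<forall>s>0. \<forall>t>0. s \<le> s0 \<and> t0 \<le> t \<longrightarrow> B (g s t) \<subseteq> N)"
      "\<forall>s t. dt M s \<longrightarrow> dt M t \<longrightarrow> dtl M m (\<lambda>e. g (s e) (t e))"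
      by (rule definable_neighbourhood_basis[OF B lenT T x])
    let ?P = "{[s, t] |s t. 0 < s \<and> 0 < (t::'a)}"
    define h where "h u = g (u ! 0) (u ! 1)" for u
    have h: "h u \<in> \<Omega> \<and> nhd T x (B (h u))" if "u \<in> ?P" for u
      using that g(1) unfolding h_def by auto
    show "\<exists>A. definable_family M 2 n ?P A \<and> A ` ?P \<subseteq> \<B> \<and> nhd_basis T x (A ` ?P) \<and>
        (\<forall>N. nhd T x N \<longrightarrow>
          (\<exists>s\<^sub>N>0. \<exists>t\<^sub>N>0. \<forall>s>0. \<forall>t>0. s \<le> s\<^sub>N \<and> t\<^sub>N \<le> t \<longrightarrow> A [s, t] \<subseteq> N))"
    proof (intro exI[of _ "\<lambda>u. B (h u)"] conjI)
      show "definable_family M 2 n ?P (\<lambda>u. B (h u))"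
      proof (rule definable_family_reindex[OF B definable_positive_pairs])
        show "dtl M m (\<lambda>e. h (map (\<lambda>i. e i) [0..<2]))"
          unfolding h_def using g(3) dt_var[of M 0] dt_var[of M 1] by simp
        show "\<forall>u\<in>?P. h u \<in> \<Omega>" using h by blast
      qed
      show "(\<lambda>u. B (h u)) ` ?P \<subseteq> \<B>" unfolding BB using h by blast
      show ev: "\<forall>N. nhd T x N \<longrightarrow>
          (\<exists>s\<^sub>N>0. \<exists>t\<^sub>N>0. \<forall>s>0. \<forall>t>0. s \<le> s\<^sub>N \<and> t\<^sub>N \<le> t \<longrightarrow> B (h [s, t]) \<subseteq> N)"
        using g(2) unfolding h_def by simp
      show "nhd_basis T x ((\<lambda>u. B (h u)) ` ?P)" unfolding nhd_basis_def
      proof (intro conjI ballI allI impI)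
        show "nhd T x N" if "N \<in> (\<lambda>u. B (h u)) ` ?P" for N using that h by blast
        fix N assume "nhd T x N"
        then obtain s t where "0 < s" "0 < t" "B (h [s, t]) \<subseteq> N" using ev by (meson order_refl)
        then show "\<exists>N'\<in>(\<lambda>u. B (h u)) ` ?P. N' \<subseteq> N" by blast
      qed
    qed
  next
    fix x assume "expands_ordered_field M" and x: "x \<in> topspace T"
    then obtain b where b: "\<forall>t. dt M t \<longrightarrow> dt M (\<lambda>e. b (t e))" "\<forall>r. (0::'a) < b r"
      "\<forall>T. \<exists>r0>0. \<forall>r>0. r \<le> r0 \<longrightarrow> T \<le> b r" by (rule_tac field_pole)
    obtain g where g: "\<forall>s>0. \<forall>t>0. g s t \<in> \<Omega> \<and> nhd T x (B (g s t))"
      "\<forall>N. nhd T x N \<longrightarrow> (\<exists>s0>0. \<exists>t0>0. \<forall>s>0. \<forall>t>0. s \<le> s0 \<and> t0 \<le> t \<longrightarrow> B (g s t) \<subseteq> N)"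
      "\<forall>s t. dt M s \<longrightarrow> dt M t \<longrightarrow> dtl M m (\<lambda>e. g (s e) (t e))"
      by (rule definable_neighbourhood_basis[OF B lenT T x])
    let ?P = "{[t] |t. 0 < (t::'a)}"
    define h where "h u = g (u ! 0) (b (u ! 0))" for u
    have h: "h u \<in> \<Omega> \<and> nhd T x (B (h u))" if "u \<in> ?P" for u
      using that g(1) b(2) unfolding h_def by auto
    show "\<exists>A. definable_family M 1 n ?P A \<and> A ` ?P \<subseteq> \<B> \<and> nhd_basis T x (A ` ?P) \<and>
        (\<forall>N. nhd T x N \<longrightarrow> (\<exists>t\<^sub>N>0. \<forall>t>0. t \<le> t\<^sub>N \<longrightarrow> A [t] \<subseteq> N))"
    proof (intro exI[of _ "\<lambda>u. B (h u)"] conjI)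
      show "definable_family M 1 n ?P (\<lambda>u. B (h u))"
      proof (rule definable_family_reindex[OF B definable_positives])
        show "dtl M m (\<lambda>e. h (map (\<lambda>i. e i) [0..<1]))"
          unfolding h_def using g(3) b(1) dt_var[of M 0] by simp
        show "\<forall>u\<in>?P. h u \<in> \<Omega>" using h by blast
      qed
      show "(\<lambda>u. B (h u)) ` ?P \<subseteq> \<B>" unfolding BB using h by blast
      show ev: "\<forall>N. nhd T x N \<longrightarrow> (\<exists>t\<^sub>N>0. \<forall>t>0. t \<le> t\<^sub>N \<longrightarrow> B (h [t]) \<subseteq> N)"
      proof (intro allI impI)
        fix N assume "nhd T x N"
        then obtain s0 t0 where st: "0 < s0" "0 < t0"
          "\<forall>s>0. \<forall>t>0. s \<le> s0 \<and> t0 \<le> t \<longrightarrow> B (g s t) \<subseteq> N" using g(2) by blast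
        obtain r0 where r0: "0 < r0" "\<forall>r>0. r \<le> r0 \<longrightarrow> t0 \<le> b r" using b(3) by blast
        \<comment> \<open>The bound \<open>t \<le> s0\<close> controls the first parameter, and
          \<open>t \<le> r0\<close> pushes the second one, \<open>b t\<close>, up to at least
          \<open>t0\<close>.\<close>
        have "B (h [t]) \<subseteq> N" if "0 < t" "t \<le> min s0 r0" for t
          using st(3) r0(2) b(2) that unfolding h_def by simp
        moreover have "0 < min s0 r0" using st r0 by simp
        ultimately show "\<exists>t\<^sub>N>0. \<forall>t>0. t \<le> t\<^sub>N \<longrightarrow> B (h [t]) \<subseteq> N" by blast
      qed
      show "nhd_basis T x ((\<lambda>u. B (h u)) ` ?P)" unfolding nhd_basis_def
      proof (intro conjI ballI allI impI)
        show "nhd T x N" if "N \<in> (\<lambda>u. B (h u)) ` ?P" for N using that h by blast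
        fix N assume "nhd T x N"
        then obtain t where "0 < t" "B (h [t]) \<subseteq> N" using ev by (meson order_refl)
        then show "\<exists>N'\<in>(\<lambda>u. B (h u)) ` ?P. N' \<subseteq> N" by blast
      qed
    qed
  qed
qed

end
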